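(* $$\limsup_{z\to\infty}\limsup_{n\to\infty}\Big|\frac{e^z}{z}\,\mathbf P\left(M_n<\tfrac32\ln n-z\right)-C_1c_0\Big|=0,$$ where $C_1>0$ is the constant such that $\limsup_{z\to\infty}\limsup_{n\to\infty}\big|e^z\mathbf P(M_n^{\rm kill}<\frac32\ln n-z)-C_1\big|=0$, and $c_0=\lim_{x\to\infty}R(x)/x\in(0,\infty)$.
   Context: Branching random walk: let $\mathcal L$ be a point process on $\mathbb R$. The process starts with one particle (generation $0$) at position $0$. At time $1$ it dies and gives birth to particles positioned according to $\mathcal L$. At each time $n$, the particles of generation $n$ die and give birth to independent copies of $\mathcal L$, translated to their positions. $\mathbb T$ is the genealogical tree, $|x|$ is the generation of $x\in\mathbb T$, $V(x)\in\mathbb R$ its position, and $x_k$ the ancestor of $x$ at generation $k\le|x|$; $\mathbf P,\mathbf E$ are the law and expectation. Notation: $y_+=\max(y,0)$, $\ln_+y=\max(\ln y,0)$, $\min\emptyset=\infty$. Standing assumptions: (1) $\mathbf E[\sum_{|x|=1}1]>1$ (the number of children may be infinite with positive probability), $\mathbf E[\sum_{|x|=1}e^{-V(x)}]=1$, $\mathbf E[\sum_{|x|=1}V(x)e^{-V(x)}]=0$; (2) the distribution of $\mathcal L$ is non-lattice, i.e. there are no $h>0$, $b\in\mathbb R$ such that almost surely all points of $\mathcal L$ lie in $b+h\mathbb Z$; (3) $\mathbf E[\sum_{|x|=1}V(x)^2e^{-V(x)}]<\infty$; (4) with $X=\sum_{|x|=1}e^{-V(x)}$ and $\tilde X=\sum_{|x|=1}V(x)_+e^{-V(x)}$: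 $\mathbf E[X(\ln_+X)^2]<\infty$ and $\mathbf E[\tilde X\ln_+\tilde X]<\infty$. Minima: $M_n=\min\{V(x):|x|=n\}$ and $M_n^{\rm kill}=\min\{V(x):|x|=n,\ V(x_k)\ge0\ \forall\,0\le k\le n\}$. The constant $C_1\in(0,\infty)$ in the claim exists under these assumptions. Associated random walk: $(S_n)_{n\ge0}$ with $S_0=0$ and i.i.d. increments, the law of $S_1$ being given by $\mathbf E[f(S_1)]=\mathbf E[\sum_{|x|=1}f(V(x))e^{-V(x)}]$ for measurable $f\ge0$; it is centered with finite variance. Its renewal function is $R(x)=0$ for $x<0$, $R(0)=1$, and for $x>0$, $R(x)=\sum_{k\ge0}\mathbf P(S_k\ge-x,\ S_k<\min_{0\le j\le k-1}S_j)$. The limit $c_0=\lim_{x\to\infty}R(x)/x$ exists and lies in $(0,\infty)$. *)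

theory Defs
  imports "HOL-Probability.Probability"
begin

text \<open>
  Vertices carry Ulam--Harris labels: the root is \<open>[]\<close> and \<open>u @ [i]\<close> is the \<open>i\<close>-th potential child
  of \<open>u\<close>. The copy of the point process used by \<open>u\<close> is given by an enumeration of its points:
  it has \<open>N u\<close> points (possibly infinitely many), located at \<open>A u i\<close> for \<open>i < N u\<close>, relative to the
  position of \<open>u\<close>. Values \<open>A u i\<close> with \<open>i \<ge> N u\<close> are meaningless and never used.
\<close>

definition offspring ::
  "(nat list \<Rightarrow> 'a \<Rightarrow> enat) \<Rightarrow> (nat list \<Rightarrow> nat \<Rightarrow> 'a \<Rightarrow> real) \<Rightarrow> nat list \<Rightarrow> 'a \<Rightarrow> enat \<times> (nat \<Rightarrow> real)"
  where "offspring N A u \<omega> = (N u \<omega>, \<lambda>i. A u i \<omega>)"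

definition offspring_space :: "(enat \<times> (nat \<Rightarrow> real)) measure"
  where "offspring_space = count_space UNIV \<Otimes>\<^sub>M (\<Pi>\<^sub>M i\<in>UNIV. borel)"

definition tree :: "(nat list \<Rightarrow> 'a \<Rightarrow> enat) \<Rightarrow> 'a \<Rightarrow> nat list set"
  where "tree N \<omega> = {x. \<forall>k<length x. enat (x ! k) < N (take k x) \<omega>}"

definition generation :: "(nat list \<Rightarrow> 'a \<Rightarrow> enat) \<Rightarrow> nat \<Rightarrow> 'a \<Rightarrow> nat list set"
  where "generation N n \<omega> = {x \<in> tree N \<omega>. length x = n}"

definition position :: "(nat list \<Rightarrow> nat \<Rightarrow> 'a \<Rightarrow> real) \<Rightarrow> nat list \<Rightarrow> 'a \<Rightarrow> real"
  where "position A x \<omega> = (\<Sum>k<length x. A (take k x) (x ! k) \<omega>)"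

text \<open>
  The minima are infima in \<open>ereal\<close>, so that the minimum of the empty set is \<open>\<infinity>\<close>. Under the
  assumptions below the infima are almost surely attained (or taken over the empty set), since
  \<open>\<Sum>\<^bsub>|x|=n\<^esub> exp (- V(x))\<close> has mean one. The ancestor of \<open>x\<close> at generation \<open>k\<close> is \<open>take k x\<close>.
\<close>

definition min_position ::
  "(nat list \<Rightarrow> 'a \<Rightarrow> enat) \<Rightarrow> (nat list \<Rightarrow> nat \<Rightarrow> 'a \<Rightarrow> real) \<Rightarrow> nat \<Rightarrow> 'a \<Rightarrow> ereal"
  where "min_position N A n \<omega> = (INF x\<in>generation N n \<omega>. ereal (position A x \<omega>))"

definition min_position_kill ::
  "(nat list \<Rightarrow> 'a \<Rightarrow> enat) \<Rightarrow> (nat list \<Rightarrow> nat \<Rightarrow> 'a \<Rightarrow> real) \<Rightarrow> nat \<Rightarrow> 'a \<Rightarrow> ereal"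
  where "min_position_kill N A n \<omega> =
    (INF x\<in>{x \<in> generation N n \<omega>. \<forall>k\<le>n. 0 \<le> position A (take k x) \<omega>}. ereal (position A x \<omega>))"

definition ln_plus :: "real \<Rightarrow> real"
  where "ln_plus y = max (ln y) 0"

locale branching_random_walk = prob_space P
  for P :: "'a measure" and N :: "nat list \<Rightarrow> 'a \<Rightarrow> enat" and A :: "nat list \<Rightarrow> nat \<Rightarrow> 'a \<Rightarrow> real" +
  assumes offspring_indep: "indep_vars (\<lambda>_. offspring_space) (offspring N A) UNIV"
    and offspring_ident:
      "\<And>u. distr P offspring_space (offspring N A u) = distr P offspring_space (offspring N A [])"

text \<open>
  Sums of nonnegative terms whose finiteness is part of the claim are taken in \<open>ennreal\<close>.
  The three real-valued sums (in \<open>mean_zero\<close>, \<open>X_integrable\<close> and \<open>X_tilde_integrable\<close>)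
  are almost surely absolutely convergent, and the first has an absolutely integrable sum, because
  \<open>exp (- V)\<close> and \<open>V\<^sup>2 * exp (- V)\<close> both have finite first-generation expectation.
\<close>

locale critical_branching_random_walk = branching_random_walk P N A
  for P :: "'a measure" and N :: "nat list \<Rightarrow> 'a \<Rightarrow> enat" and A :: "nat list \<Rightarrow> nat \<Rightarrow> 'a \<Rightarrow> real" +
  assumes supercritical:
      "(\<integral>\<^sup>+\<omega>. (\<Sum>\<^sub>\<infinity>x\<in>generation N 1 \<omega>. 1) \<partial>P) > 1"
    and mass_one:
      "(\<integral>\<^sup>+\<omega>. (\<Sum>\<^sub>\<infinity>x\<in>generation N 1 \<omega>. ennreal (exp (- position A x \<omega>))) \<partial>P) = 1"
    and mean_zero:
      "(\<integral>\<omega>. (\<Sum>\<^sub>\<infinity>x\<in>generation N 1 \<omega>. position A x \<omega> * exp (- position A x \<omega>)) \<partial>P) = 0"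
    and non_lattice:
      "\<not> (\<exists>h>0. \<exists>b. AE \<omega> in P. \<forall>x\<in>generation N 1 \<omega>. \<exists>k::int. position A x \<omega> = b + h * of_int k)"
    and second_moment:
      "(\<integral>\<^sup>+\<omega>. (\<Sum>\<^sub>\<infinity>x\<in>generation N 1 \<omega>.
          ennreal ((position A x \<omega>)\<^sup>2 * exp (- position A x \<omega>))) \<partial>P) < \<infinity>"
    and X_integrable:
      "integrable P (\<lambda>\<omega>. let X = (\<Sum>\<^sub>\<infinity>x\<in>generation N 1 \<omega>. exp (- position A x \<omega>))
          in X * (ln_plus X)\<^sup>2)"
    and X_tilde_integrable:
      "integrable P (\<lambda>\<omega>. let X = (\<Sum>\<^sub>\<infinity>x\<in>generation N 1 \<omega>.
            max (position A x \<omega>) 0 * exp (- position A x \<omega>))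
          in X * ln_plus X)"

definition walk :: "(nat \<Rightarrow> 'b \<Rightarrow> real) \<Rightarrow> nat \<Rightarrow> 'b \<Rightarrow> real"
  where "walk \<xi> n \<omega> = (\<Sum>i<n. \<xi> i \<omega>)"

text \<open>The walk lives on its own probability space \<open>Q\<close>; only its law matters.\<close>

locale associated_random_walk =
  brw: branching_random_walk P N A + Q: prob_space Q
  for P :: "'a measure" and N :: "nat list \<Rightarrow> 'a \<Rightarrow> enat" and A :: "nat list \<Rightarrow> nat \<Rightarrow> 'a \<Rightarrow> real"
    and Q :: "'b measure" and \<xi> :: "nat \<Rightarrow> 'b \<Rightarrow> real" +
  assumes steps_indep: "Q.indep_vars (\<lambda>_. borel) \<xi> UNIV"
    and steps_law: "\<And>i f. f \<in> borel_measurable borel \<Longrightarrow>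
      (\<integral>\<^sup>+\<omega>. f (\<xi> i \<omega>) \<partial>Q) =
      (\<integral>\<^sup>+\<omega>. (\<Sum>\<^sub>\<infinity>x\<in>generation N 1 \<omega>.
          f (position A x \<omega>) * ennreal (exp (- position A x \<omega>))) \<partial>P)"

definition renewal_fun :: "'b measure \<Rightarrow> (nat \<Rightarrow> 'b \<Rightarrow> real) \<Rightarrow> real \<Rightarrow> real"
  where "renewal_fun Q \<xi> x =
    (if x < 0 then 0 else if x = 0 then 1
     else (\<Sum>k. measure Q {\<omega> \<in> space Q. walk \<xi> k \<omega> \<ge> - x \<and> (\<forall>j<k. walk \<xi> k \<omega> < walk \<xi> j \<omega>)}))"

end

theory Submission imports Defs begin

text \<open>
  Work with positions shifted by the starting point \<open>t\<close>, so that the target is \<open>c = 3/2 * ln n\<close>, and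
  write \<open>excess\<close> for \<open>exp t\<close> times the probability of reaching the target in \<open>n\<close> steps although
  every successful line of descent goes below a barrier \<open>b\<close>. Conditioning on the first generation,
  the many-to-one formula and a union bound show that \<open>excess\<close> is a subsolution of a recursion
  driven by the associated random walk; unrolled, the recursion bounds
  \<open>exp z * P (M n < c - z)\<close> by the mean over the strict descending records \<open>s\<close> of the walk started
  at \<open>z\<close> of the killed tails \<open>exp s * P (M_kill < c - s)\<close>. These tend to \<open>C\<^sub>1\<close>, and the mean number of
  records above a level \<open>a\<close> is \<open>R (z - a)\<close>; records below \<open>a\<close> contribute at most \<open>exp a\<close>.

  Conversely, the inequality of the recursion is an equality up to the event that two children
  succeed. Its contribution from a particle at \<open>t\<close> is at most \<open>1 + t\<close> times
  \<open>E (X; X > exp (t/2)) + (1 + t) * exp (- t/2)\<close>, by the upper bound,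
  where \<open>X\<close> is the sum of \<open>exp (- V)\<close> over the first generation. The walk killed below
  \<open>a\<close> visits each unit interval at most \<open>O(z)\<close> times in the mean (by duality the excursions above
  the running minimum do so boundedly often), so the total error is \<open>O(z)\<close> times the tail beyond
  \<open>a\<close> of a series that converges because \<open>E (X * (ln_plus X)\<^sup>2)\<close> is finite.
\<close>

subsection \<open>Records and killed Green functions of random walks\<close>

text \<open>The hypothesis on the killed tails is an iterated limit: it controls
  \<open>N \<rightarrow> \<infinity>\<close> for each fixed starting point \<open>s\<close>, with no
  uniformity in \<open>s\<close>. Moreover a record at time \<open>k\<close> leaves
  \<open>N - k\<close> generations while the target stays that of horizon \<open>N\<close>, which is
  harmless only for fixed \<open>k\<close>. Every bound is therefore split into a part valid for all
  \<open>N\<close> (the constant \<open>K\<close>, the linear bound \<open>B0 * (1 + b)\<close>,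
  \<open>error_main\<close>) and a remainder that vanishes as \<open>N\<close> grows by dominated
  convergence (\<open>overshoot\<close>, \<open>under\<close>, \<open>error_rest\<close>).

  The state is a pair of position and barrier. The initial barrier \<open>z + 1\<close> makes every
  success count as one below the barrier, and makes the start a record; afterwards the barrier is
  the running minimum, so that excess and record sums obey the same first-step recursion.

  Cutting \<open>X\<close> at exp (t/2) balances the two error terms: a success from
  \<open>t\<close> has probability of order (1 + t) exp (- t), which leaves exp (- t/2), while large
  \<open>X\<close> is felt only at levels t < 2 ln X. The number of these levels and the weight 1 +
  t give one power of ln X each.\<close>

definition partial_sum :: "nat \<Rightarrow> (nat \<Rightarrow> real) \<Rightarrow> real"
  where "partial_sum k \<omega> = (\<Sum>i<k. \<omega> i)"

lemma partial_sum_0 [simp]: "partial_sum 0 \<omega> = 0"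
  by (simp add: partial_sum_def)

text \<open>The relation \<open>r\<close> is \<open><\<close> or \<open>\<le>\<close>: strict
  records are those of the renewal function, weak ones come from reversing time in the killed walk.
  The bound \<open>b\<close> stands for the minimum over an earlier past, which makes the notion
  stable under removal of the first step.\<close>

definition is_record :: "(real \<Rightarrow> real \<Rightarrow> bool) \<Rightarrow> real \<Rightarrow> real \<Rightarrow> nat \<Rightarrow> (nat \<Rightarrow> real) \<Rightarrow> bool"
  where "is_record r t b k \<omega> \<longleftrightarrow>
    r (t + partial_sum k \<omega>) b \<and> (\<forall>j<k. r (partial_sum k \<omega>) (partial_sum j \<omega>))"

text \<open>The weight \<open>\<psi>\<close> may depend on the time \<open>k\<close> because a
  record at time \<open>k\<close> leaves only \<open>n - k\<close> generations.\<close>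

definition record_sum ::
  "real measure \<Rightarrow> (real \<Rightarrow> real \<Rightarrow> bool) \<Rightarrow> real \<Rightarrow> real \<Rightarrow> (nat \<Rightarrow> real \<Rightarrow> ennreal) \<Rightarrow> ennreal"
  where "record_sum \<mu> r t b \<psi> =
    (\<Sum>k. \<integral>\<^sup>+\<omega>. (if is_record r t b k \<omega> then \<psi> k (t + partial_sum k \<omega>) else 0) \<partial>(\<Pi>\<^sub>M i\<in>(UNIV::nat set). \<mu>))"

definition alive :: "real \<Rightarrow> real \<Rightarrow> nat \<Rightarrow> (nat \<Rightarrow> real) \<Rightarrow> bool"
  where "alive a t k \<omega> \<longleftrightarrow> (\<forall>j\<le>k. a \<le> t + partial_sum j \<omega>)"

definition killed_green ::
  "real measure \<Rightarrow> real \<Rightarrow> real \<Rightarrow> (nat \<Rightarrow> real \<Rightarrow> ennreal) \<Rightarrow> ennreal"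
  where "killed_green \<mu> a t \<psi> =
    (\<Sum>k. \<integral>\<^sup>+\<omega>. (if alive a t k \<omega> then \<psi> k (t + partial_sum k \<omega>) else 0) \<partial>(\<Pi>\<^sub>M i\<in>(UNIV::nat set). \<mu>))"

section \<open>Measurability and first-step recursions\<close>

lemma pred_strict_or_weak [measurable (raw)]:
  fixes f g :: "'c \<Rightarrow> real"
  assumes "f \<in> borel_measurable M" "g \<in> borel_measurable M"
  shows "r \<in> {(<), (\<le>)} \<Longrightarrow> Measurable.pred M (\<lambda>x. r (f x) (g x))"
  using assms by auto

lemma partial_sum_case_nat: "partial_sum (Suc k) (case_nat x \<omega>) = x + partial_sum k \<omega>"
  unfolding partial_sum_def by (subst sum.lessThan_Suc_shift) simp

lemma all_less_Suc_shift: "(\<forall>j<Suc k. Q j) \<longleftrightarrow> Q 0 \<and> (\<forall>j<k. Q (Suc j))"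
  using less_Suc_eq_0_disj by auto

text \<open>After the first step the start \<open>t\<close> belongs to the past, so a later record
  has to beat both \<open>t\<close> and \<open>b\<close>.\<close>

lemma is_record_case_nat:
  assumes "r \<in> {(<), (\<le>)}"
  shows "is_record r t b (Suc k) (case_nat x \<omega>) \<longleftrightarrow> is_record r (t + x) (min t b) k \<omega>"
proof -
  have "r s (min t b) \<longleftrightarrow> r s t \<and> r s b" for s
    using assms by auto
  moreover have "r (x + partial_sum k \<omega>) 0 \<longleftrightarrow> r (t + x + partial_sum k \<omega>) t"
    using assms by auto
  moreover have "r (x + u) (x + v) \<longleftrightarrow> r u v" for u v
    using assms by auto
  ultimately show ?thesis
    unfolding is_record_def all_less_Suc_shift partial_sum_case_nat by (auto simp: add.assoc)
qed

lemma alive_case_nat: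
  "alive a t (Suc k) (case_nat x \<omega>) \<longleftrightarrow> a \<le> t \<and> alive a (t + x) k \<omega>"
  unfolding alive_def less_Suc_eq_le[symmetric]
  by (subst all_less_Suc_shift) (simp add: partial_sum_case_nat add.assoc)

locale step_law = prob_space \<mu> for \<mu> :: "real measure" +
  assumes sets_mu [measurable_cong, simp]: "sets \<mu> = sets borel"
begin

sublocale path: sequence_space \<mu>
  unfolding sequence_space_def by (intro product_prob_spaceI prob_space_axioms)

abbreviation "paths \<equiv> \<Pi>\<^sub>M i\<in>(UNIV::nat set). \<mu>"

lemma space_mu [simp]: "space \<mu> = UNIV"
  using sets_eq_imp_space_eq[OF sets_mu] by simp

lemma nn_integral_paths_Suc:
  assumes [measurable]: "f \<in> borel_measurable paths"
  shows "(\<integral>\<^sup>+\<omega>. f \<omega> \<partial>paths) = (\<integral>\<^sup>+x. \<integral>\<^sup>+\<omega>. f (case_nat x \<omega>) \<partial>paths \<partial>\<mu>)"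
proof -
  have "(\<integral>\<^sup>+\<omega>. f \<omega> \<partial>paths) = (\<integral>\<^sup>+z. f (case z of (x, \<omega>) \<Rightarrow> case_nat x \<omega>) \<partial>(\<mu> \<Otimes>\<^sub>M paths))"
    by (subst path.PiM_iter[symmetric], subst nn_integral_distr) simp_all
  also have "\<dots> = (\<integral>\<^sup>+x. \<integral>\<^sup>+\<omega>. f (case_nat x \<omega>) \<partial>paths \<partial>\<mu>)"
    by (subst path.P.nn_integral_fst[symmetric]) simp_all
  finally show ?thesis .
qed

lemma measurable_partial_sum [measurable]: "partial_sum k \<in> borel_measurable paths"
  unfolding partial_sum_def by measurable

lemma pred_is_record [measurable (raw)]:
  assumes "r \<in> {(<), (\<le>)}"
  assumes [measurable]: "f \<in> borel_measurable M" "g \<in> borel_measurable M" "h \<in> measurable M paths"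
  shows "Measurable.pred M (\<lambda>x. is_record r (f x) (g x) k (h x))"
proof -
  have [measurable]: "(\<lambda>x. h x i) \<in> borel_measurable M" for i
  proof -
    have "(\<lambda>x. h x i) \<in> measurable M \<mu>" by measurable
    then show ?thesis by (simp cong: measurable_cong_sets)
  qed
  show ?thesis
  unfolding is_record_def partial_sum_def using assms(1) by measurable
qed

lemma pred_alive [measurable (raw)]:
  assumes [measurable]: "f \<in> borel_measurable M" "g \<in> borel_measurable M" "h \<in> measurable M paths"
  shows "Measurable.pred M (\<lambda>x. alive (f x) (g x) k (h x))"
proof -
  have [measurable]: "(\<lambda>x. h x i) \<in> borel_measurable M" for i
  proof -
    have "(\<lambda>x. h x i) \<in> measurable M \<mu>" by measurable
    then show ?thesis by (simp cong: measurable_cong_sets)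
  qed
  show ?thesis
  unfolding alive_def partial_sum_def by measurable
qed

lemma measurable_record_integrand:
  assumes "r \<in> {(<), (\<le>)}"
  assumes [measurable]: "f \<in> borel_measurable M" "g \<in> borel_measurable M" "h \<in> measurable M paths"
    "\<psi> k \<in> borel_measurable borel"
  shows "(\<lambda>x. if is_record r (f x) (g x) k (h x) then \<psi> k (f x + partial_sum k (h x)) else 0)
    \<in> borel_measurable M"
  using assms(1) by measurable

lemma measurable_alive_integrand:
  assumes [measurable]: "f \<in> borel_measurable M" "h \<in> measurable M paths"
    "\<psi> k \<in> borel_measurable borel"
  shows "(\<lambda>x. if alive a (f x) k (h x) then \<psi> k (f x + partial_sum k (h x)) else 0)
    \<in> borel_measurable M"
  by measurable

lemma measurable_record_term:
  assumes "r \<in> {(<), (\<le>)}" "\<psi> k \<in> borel_measurable borel"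
  assumes [measurable]: "f \<in> borel_measurable M" "g \<in> borel_measurable M"
  shows "(\<lambda>x. \<integral>\<^sup>+\<omega>. (if is_record r (f x) (g x) k \<omega>
    then \<psi> k (f x + partial_sum k \<omega>) else 0) \<partial>paths) \<in> borel_measurable M"
  by (intro path.P.borel_measurable_nn_integral,
      unfold case_prod_beta, intro measurable_record_integrand assms(1,2)) measurable

lemma measurable_alive_term:
  assumes "\<psi> k \<in> borel_measurable borel"
  assumes [measurable]: "f \<in> borel_measurable M"
  shows "(\<lambda>x. \<integral>\<^sup>+\<omega>. (if alive a (f x) k \<omega>
    then \<psi> k (f x + partial_sum k \<omega>) else 0) \<partial>paths) \<in> borel_measurable M"
  by (intro path.P.borel_measurable_nn_integral,
      unfold case_prod_beta, intro measurable_alive_integrand assms(1)) measurable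

lemma measurable_record_sum [measurable (raw)]:
  assumes "r \<in> {(<), (\<le>)}" "\<And>k. \<psi> k \<in> borel_measurable borel"
  assumes "f \<in> borel_measurable M" "g \<in> borel_measurable M"
  shows "(\<lambda>x. record_sum \<mu> r (f x) (g x) \<psi>) \<in> borel_measurable M"
  unfolding record_sum_def
  by (intro borel_measurable_suminf_order measurable_record_term assms)

lemma measurable_killed_green [measurable (raw)]:
  assumes "\<And>k. \<psi> k \<in> borel_measurable borel" "f \<in> borel_measurable M"
  shows "(\<lambda>x. killed_green \<mu> a (f x) \<psi>) \<in> borel_measurable M"
  unfolding killed_green_def
  by (intro borel_measurable_suminf_order measurable_alive_term assms)

text \<open>Time 0 contributes if the start beats \<open>b\<close>; from then on the minimum of the
  past is \<open>min t b\<close> and the clock of \<open>\<psi>\<close> has advanced by one.\<close>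

lemma record_sum_rec:
  assumes r: "r \<in> {(<), (\<le>)}" and \<psi>: "\<And>k. \<psi> k \<in> borel_measurable borel"
  shows "record_sum \<mu> r t b \<psi> =
    (if r t b then \<psi> 0 t else 0) + (\<integral>\<^sup>+x. record_sum \<mu> r (t + x) (min t b) (\<lambda>k. \<psi> (Suc k)) \<partial>\<mu>)"
proof -
  define F where "F k = (\<integral>\<^sup>+\<omega>. (if is_record r t b k \<omega> then \<psi> k (t + partial_sum k \<omega>) else 0) \<partial>paths)" for k
  note [measurable] = \<psi>
  have "F (Suc k) = (\<integral>\<^sup>+x. \<integral>\<^sup>+\<omega>. (if is_record r (t + x) (min t b) k \<omega>
      then \<psi> (Suc k) (t + x + partial_sum k \<omega>) else 0) \<partial>paths \<partial>\<mu>)" for k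
    unfolding F_def
    by (subst nn_integral_paths_Suc, rule measurable_record_integrand[OF r _ _ _ \<psi>])
      (simp_all add: is_record_case_nat[OF r] partial_sum_case_nat add.assoc cong: if_cong)
  then have "(\<Sum>k. F (Suc k)) = (\<integral>\<^sup>+x. record_sum \<mu> r (t + x) (min t b) (\<lambda>k. \<psi> (Suc k)) \<partial>\<mu>)"
    unfolding record_sum_def
    by (subst nn_integral_suminf)
      (use measurable_record_term[OF r, of "\<lambda>k. \<psi> (Suc k)" _ "\<lambda>x. t + x" \<mu> "\<lambda>_. min t b"] in simp_all)
  moreover have "F 0 = (if r t b then \<psi> 0 t else 0)"
    by (simp add: F_def is_record_def path.P.emeasure_space_1)
  moreover have "record_sum \<mu> r t b \<psi> = F 0 + (\<Sum>k. F (Suc k))"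
    unfolding record_sum_def F_def[symmetric]
    using suminf_offset[of F 1] by (simp add: summableI)
  ultimately show ?thesis by simp
qed

lemma killed_green_rec:
  assumes \<psi>: "\<And>k. \<psi> k \<in> borel_measurable borel"
  shows "killed_green \<mu> a t \<psi> =
    (if a \<le> t then \<psi> 0 t + (\<integral>\<^sup>+x. killed_green \<mu> a (t + x) (\<lambda>k. \<psi> (Suc k)) \<partial>\<mu>) else 0)"
proof -
  define F where "F k = (\<integral>\<^sup>+\<omega>. (if alive a t k \<omega> then \<psi> k (t + partial_sum k \<omega>) else 0) \<partial>paths)" for k
  note [measurable] = \<psi>
  have "F (Suc k) = (\<integral>\<^sup>+x. \<integral>\<^sup>+\<omega>. (if a \<le> t \<and> alive a (t + x) k \<omega>
      then \<psi> (Suc k) (t + x + partial_sum k \<omega>) else 0) \<partial>paths \<partial>\<mu>)" for k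
    unfolding F_def
    by (subst nn_integral_paths_Suc, rule measurable_alive_integrand[OF _ _ \<psi>])
      (simp_all add: alive_case_nat partial_sum_case_nat add.assoc cong: if_cong)
  then have "(\<Sum>k. F (Suc k)) = (if a \<le> t then \<integral>\<^sup>+x. killed_green \<mu> a (t + x) (\<lambda>k. \<psi> (Suc k)) \<partial>\<mu> else 0)"
    unfolding killed_green_def
    by (cases "a \<le> t", simp_all, subst nn_integral_suminf)
      (use measurable_alive_term[of "\<lambda>k. \<psi> (Suc k)" _ "\<lambda>x. t + x" \<mu>] in simp_all)
  moreover have "F 0 = (if a \<le> t then \<psi> 0 t else 0)"
    by (simp add: F_def alive_def path.P.emeasure_space_1)
  moreover have "killed_green \<mu> a t \<psi> = F 0 + (\<Sum>k. F (Suc k))"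
    unfolding killed_green_def F_def[symmetric]
    using suminf_offset[of F 1] by (simp add: summableI)
  ultimately show ?thesis by simp
qed

lemma emeasure_mu_UNIV [simp]: "emeasure \<mu> UNIV = 1"
  using emeasure_space_1 by simp

lemma record_sum_mono:
  assumes r: "r \<in> {(<), (\<le>)}"
    and le: "\<And>k s. r s b \<Longrightarrow> s \<le> t \<Longrightarrow> \<psi> k s \<le> \<phi> k s"
  shows "record_sum \<mu> r t b \<psi> \<le> record_sum \<mu> r t b \<phi>"
proof -
  have "\<psi> k (t + partial_sum k \<omega>) \<le> \<phi> k (t + partial_sum k \<omega>)" if "is_record r t b k \<omega>" for k \<omega>
  proof -
    have "r (partial_sum k \<omega>) 0 \<or> k = 0"
      using that unfolding is_record_def by (metis gr0I partial_sum_0)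
    then have "partial_sum k \<omega> \<le> 0"
      using r by auto
    then show ?thesis
      using that le unfolding is_record_def by auto
  qed
  then show ?thesis
    unfolding record_sum_def
    by (intro suminf_le nn_integral_mono summableI) auto
qed

lemma record_sum_add:
  assumes r: "r \<in> {(<), (\<le>)}"
    and \<psi>: "\<And>k. \<psi> k \<in> borel_measurable borel" and \<phi>: "\<And>k. \<phi> k \<in> borel_measurable borel"
  shows "record_sum \<mu> r t b (\<lambda>k s. \<psi> k s + \<phi> k s) = record_sum \<mu> r t b \<psi> + record_sum \<mu> r t b \<phi>"
proof -
  have "(\<integral>\<^sup>+\<omega>. (if is_record r t b k \<omega> then \<psi> k (t + partial_sum k \<omega>) + \<phi> k (t + partial_sum k \<omega>) else 0) \<partial>paths)
     = (\<integral>\<^sup>+\<omega>. (if is_record r t b k \<omega> then \<psi> k (t + partial_sum k \<omega>) else 0) \<partial>paths)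
     + (\<integral>\<^sup>+\<omega>. (if is_record r t b k \<omega> then \<phi> k (t + partial_sum k \<omega>) else 0) \<partial>paths)" for k
    by (subst nn_integral_add[symmetric])
      (auto intro!: nn_integral_cong measurable_record_integrand[OF r] \<psi> \<phi>)
  then show ?thesis
    unfolding record_sum_def by (simp add: suminf_add summableI)
qed

lemma record_sum_cmult:
  assumes r: "r \<in> {(<), (\<le>)}" and \<psi>: "\<And>k. \<psi> k \<in> borel_measurable borel"
  shows "record_sum \<mu> r t b (\<lambda>k s. c * \<psi> k s) = c * record_sum \<mu> r t b \<psi>"
proof -
  have "(\<integral>\<^sup>+\<omega>. (if is_record r t b k \<omega> then c * \<psi> k (t + partial_sum k \<omega>) else 0) \<partial>paths)
     = c * (\<integral>\<^sup>+\<omega>. (if is_record r t b k \<omega> then \<psi> k (t + partial_sum k \<omega>) else 0) \<partial>paths)" for k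
    by (subst nn_integral_cmult[symmetric])
      (auto intro!: nn_integral_cong measurable_record_integrand[OF r] \<psi>)
  then show ?thesis
    unfolding record_sum_def by simp
qed

text \<open>Reduces a bound to finite horizons, where \<open>record_sum_rec\<close> allows induction
  on the horizon.\<close>

lemma record_sum_le_truncated:
  assumes "\<And>n. record_sum \<mu> r t b (\<lambda>k s. if k < n then \<psi> k s else 0) \<le> B"
  shows "record_sum \<mu> r t b \<psi> \<le> B"
proof -
  define F where "F k = (\<integral>\<^sup>+\<omega>. (if is_record r t b k \<omega> then \<psi> k (t + partial_sum k \<omega>) else 0) \<partial>paths)" for k
  have "(\<Sum>k<n. F k) \<le> B" for n
  proof -
    have "record_sum \<mu> r t b (\<lambda>k s. if k < n then \<psi> k s else 0) = (\<Sum>k. if k < n then F k else 0)"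
      unfolding record_sum_def F_def by (intro suminf_cong) (simp cong: if_cong)
    also have "\<dots> = (\<Sum>k<n. F k)"
      by (subst suminf_finite[of "{..<n}"]) auto
    finally show ?thesis using assms[of n] by simp
  qed
  then show ?thesis
    unfolding record_sum_def F_def[symmetric] by (intro suminf_le_const summableI)
qed

lemma killed_green_mono:
  assumes "\<And>k s. a \<le> s \<Longrightarrow> \<psi> k s \<le> \<phi> k s"
  shows "killed_green \<mu> a t \<psi> \<le> killed_green \<mu> a t \<phi>"
  unfolding killed_green_def
  by (intro suminf_le nn_integral_mono summableI) (use assms in \<open>auto simp: alive_def\<close>)

lemma killed_green_add:
  assumes \<psi>: "\<And>k. \<psi> k \<in> borel_measurable borel" and \<phi>: "\<And>k. \<phi> k \<in> borel_measurable borel"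
  shows "killed_green \<mu> a t (\<lambda>k s. \<psi> k s + \<phi> k s) = killed_green \<mu> a t \<psi> + killed_green \<mu> a t \<phi>"
proof -
  have "(\<integral>\<^sup>+\<omega>. (if alive a t k \<omega> then \<psi> k (t + partial_sum k \<omega>) + \<phi> k (t + partial_sum k \<omega>) else 0) \<partial>paths)
     = (\<integral>\<^sup>+\<omega>. (if alive a t k \<omega> then \<psi> k (t + partial_sum k \<omega>) else 0) \<partial>paths)
     + (\<integral>\<^sup>+\<omega>. (if alive a t k \<omega> then \<phi> k (t + partial_sum k \<omega>) else 0) \<partial>paths)" for k
    by (subst nn_integral_add[symmetric])
      (auto intro!: nn_integral_cong measurable_alive_integrand \<psi> \<phi>)
  then show ?thesis
    unfolding killed_green_def by (simp add: suminf_add summableI)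
qed

lemma killed_green_cmult:
  assumes \<psi>: "\<And>k. \<psi> k \<in> borel_measurable borel"
  shows "killed_green \<mu> a t (\<lambda>k s. c * \<psi> k s) = c * killed_green \<mu> a t \<psi>"
proof -
  have "(\<integral>\<^sup>+\<omega>. (if alive a t k \<omega> then c * \<psi> k (t + partial_sum k \<omega>) else 0) \<partial>paths)
     = c * (\<integral>\<^sup>+\<omega>. (if alive a t k \<omega> then \<psi> k (t + partial_sum k \<omega>) else 0) \<partial>paths)" for k
    by (subst nn_integral_cmult[symmetric])
      (auto intro!: nn_integral_cong measurable_alive_integrand \<psi>)
  then show ?thesis
    unfolding killed_green_def by simp
qed

lemma killed_green_suminf:
  assumes \<psi>: "\<And>i k. \<psi> i k \<in> borel_measurable borel"
  shows "killed_green \<mu> a t (\<lambda>k s. \<Sum>i. \<psi> i k s) = (\<Sum>i. killed_green \<mu> a t (\<psi> i))"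
proof -
  define F where "F i k = (\<integral>\<^sup>+\<omega>. (if alive a t k \<omega> then \<psi> i k (t + partial_sum k \<omega>) else 0) \<partial>paths)" for i k
  have "(\<integral>\<^sup>+\<omega>. (if alive a t k \<omega> then (\<Sum>i. \<psi> i k (t + partial_sum k \<omega>)) else 0) \<partial>paths) = (\<Sum>i. F i k)" for k
    unfolding F_def
    by (subst nn_integral_suminf[symmetric])
      (auto intro!: nn_integral_cong measurable_alive_integrand \<psi>)
  then have "killed_green \<mu> a t (\<lambda>k s. \<Sum>i. \<psi> i k s) = (\<Sum>k. \<Sum>i. F i k)"
    unfolding killed_green_def by simp
  also have "\<dots> = (\<Sum>i. \<Sum>k. F i k)"
    using nn_integral_suminf[of F "count_space UNIV"] by (simp add: nn_integral_count_space_nat)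
  finally show ?thesis
    unfolding killed_green_def F_def .
qed

lemma killed_green_le_truncated:
  assumes "\<And>n. killed_green \<mu> a t (\<lambda>k s. if k < n then \<psi> k s else 0) \<le> B"
  shows "killed_green \<mu> a t \<psi> \<le> B"
proof -
  define F where "F k = (\<integral>\<^sup>+\<omega>. (if alive a t k \<omega> then \<psi> k (t + partial_sum k \<omega>) else 0) \<partial>paths)" for k
  have "(\<Sum>k<n. F k) \<le> B" for n
  proof -
    have "killed_green \<mu> a t (\<lambda>k s. if k < n then \<psi> k s else 0) = (\<Sum>k. if k < n then F k else 0)"
      unfolding killed_green_def F_def by (intro suminf_cong) (simp cong: if_cong)
    also have "\<dots> = (\<Sum>k<n. F k)"
      by (subst suminf_finite[of "{..<n}"]) auto
    finally show ?thesis using assms[of n] by simp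
  qed
  then show ?thesis
    unfolding killed_green_def F_def[symmetric] by (intro suminf_le_const summableI)
qed

section \<open>Uniform bounds on the mean number of records\<close>

lemma nn_integral_exp_min_less_1:
  assumes "emeasure \<mu> {x. x < 0} \<noteq> 0"
  shows "(\<integral>\<^sup>+x. ennreal (exp (min x 0)) \<partial>\<mu>) < 1"
proof -
  have "(\<integral>\<^sup>+x. ennreal (exp (min x 0)) \<partial>\<mu>) < (\<integral>\<^sup>+x. 1 \<partial>\<mu>)"
  proof (rule nn_integral_less)
    have "(\<integral>\<^sup>+x. ennreal (exp (min x 0)) \<partial>\<mu>) \<le> (\<integral>\<^sup>+x. 1 \<partial>\<mu>)"
      by (intro nn_integral_mono) simp
    then show "(\<integral>\<^sup>+x. ennreal (exp (min x 0)) \<partial>\<mu>) \<noteq> \<infinity>"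
      by (auto simp: top_unique)
    show "\<not> (AE x in \<mu>. 1 \<le> ennreal (exp (min x 0)))"
    proof
      assume "AE x in \<mu>. 1 \<le> ennreal (exp (min x 0))"
      then have "AE x in \<mu>. x \<notin> {x. x < 0}"
        by eventually_elim (auto simp: min_def)
      then show False
        using assms by (subst (asm) AE_iff_measurable[of "{x. x < 0}"]) auto
    qed
  qed (auto simp: min_def)
  then show ?thesis by simp
qed

text \<open>The mean of \<open>exp\<close> over all records is finite because \<open>exp\<close> contracts by a factor
  \<open>E (exp (min X 0)) < 1\<close> from one record to the next.\<close>

lemma record_sum_exp_le:
  assumes r: "r \<in> {(<), (\<le>)}"
    and c: "1 + c * (\<integral>\<^sup>+x. ennreal (exp (min x 0)) \<partial>\<mu>) \<le> c"
  shows "record_sum \<mu> r t b (\<lambda>k s. ennreal (exp s)) \<le> c * ennreal (exp (min t b))"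
proof (rule record_sum_le_truncated)
  fix n
  show "record_sum \<mu> r t b (\<lambda>k s. if k < n then ennreal (exp s) else 0) \<le> c * ennreal (exp (min t b))"
  proof (induction n arbitrary: t b)
    case 0
    then show ?case by (simp add: record_sum_def)
  next
    case (Suc n)
    have "record_sum \<mu> r t b (\<lambda>k s. if k < Suc n then ennreal (exp s) else 0) =
      (if r t b then ennreal (exp t) else 0) + (\<integral>\<^sup>+x. record_sum \<mu> r (t + x) (min t b) (\<lambda>k s. if k < n then ennreal (exp s) else 0) \<partial>\<mu>)"
      by (subst record_sum_rec[OF r]) simp_all
    also have "\<dots> \<le> (if r t b then ennreal (exp t) else 0) +
        (\<integral>\<^sup>+x. c * ennreal (exp (min (t + x) (min t b))) \<partial>\<mu>)"
      by (intro add_left_mono nn_integral_mono Suc.IH)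
    also have "\<dots> \<le> c * ennreal (exp (min t b))"
    \<comment> \<open>A record at the start is paid for by the contraction, through the inequality
      for \<open>c\<close>; if there is none, the barrier stays at \<open>b\<close> and its value
      exp b bounds all that follows.\<close>
    proof (cases "r t b")
      case True
      then have tb: "t \<le> b" using r by auto
      have "ennreal (exp (min (t + x) (min t b))) = ennreal (exp t) * ennreal (exp (min x 0))" for x
        using tb by (auto simp: min_def ennreal_mult[symmetric] exp_add[symmetric])
      then have "(\<integral>\<^sup>+x. c * ennreal (exp (min (t + x) (min t b))) \<partial>\<mu>) =
        c * (ennreal (exp t) * (\<integral>\<^sup>+x. ennreal (exp (min x 0)) \<partial>\<mu>))"
        by (simp add: nn_integral_cmult)
      then have "(if r t b then ennreal (exp t) else 0) + (\<integral>\<^sup>+x. c * ennreal (exp (min (t + x) (min t b))) \<partial>\<mu>)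
        = ennreal (exp t) * (1 + c * (\<integral>\<^sup>+x. ennreal (exp (min x 0)) \<partial>\<mu>))"
        using True by (simp add: algebra_simps)
      also have "\<dots> \<le> ennreal (exp t) * c"
        by (intro mult_left_mono c) simp
      finally show ?thesis using tb by (simp add: mult.commute min_def)
    next
      case False
      then have "b \<le> t" using r by auto
      then have "(\<integral>\<^sup>+x. c * ennreal (exp (min (t + x) (min t b))) \<partial>\<mu>) \<le> (\<integral>\<^sup>+x. c * ennreal (exp b) \<partial>\<mu>)"
        by (intro nn_integral_mono mult_left_mono ennreal_leI) auto
      then show ?thesis
        using False \<open>b \<le> t\<close> by (simp add: min_absorb2)
    qed
    finally show ?case .
  qed
qed

text \<open>While the walk is above \<open>u + 1\<close> nothing is counted. Once it is at or below
  \<open>u + 1\<close>, exp (s - u) dominates the indicator and the exponential bound gives at most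
  \<open>c * exp 1\<close>, whatever the start and the barrier.\<close>

lemma record_sum_unit_interval_le:
  assumes r: "r \<in> {(<), (\<le>)}"
    and c: "1 + c * (\<integral>\<^sup>+x. ennreal (exp (min x 0)) \<partial>\<mu>) \<le> c"
  shows "record_sum \<mu> r t b (\<lambda>k s. indicator {u..u + 1} s) \<le> c * ennreal (exp 1)"
proof (rule record_sum_le_truncated)
  fix n
  show "record_sum \<mu> r t b (\<lambda>k s. if k < n then indicator {u..u + 1} s else 0) \<le> c * ennreal (exp 1)"
  proof (induction n arbitrary: t b)
    case 0
    then show ?case by (simp add: record_sum_def)
  next
    case (Suc n)
    show ?case
    proof (cases "t \<le> u + 1")
      case True
      have "record_sum \<mu> r t b (\<lambda>k s. if k < Suc n then indicator {u..u + 1} s else 0) \<le>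
        record_sum \<mu> r t b (\<lambda>k s. ennreal (exp (- u)) * ennreal (exp s))"
        by (intro record_sum_mono r)
          (auto simp: ennreal_mult[symmetric] exp_add[symmetric] indicator_def)
      also have "\<dots> = ennreal (exp (- u)) * record_sum \<mu> r t b (\<lambda>k s. ennreal (exp s))"
        by (intro record_sum_cmult r) simp
      also have "\<dots> \<le> ennreal (exp (- u)) * (c * ennreal (exp (u + 1)))"
        using True
        by (intro mult_left_mono order.trans[OF record_sum_exp_le[OF r c]]) (auto intro!: mult_left_mono ennreal_leI)
      also have "\<dots> = c * ennreal (exp 1)"
        by (simp add: ennreal_mult[symmetric] exp_add[symmetric] mult.left_commute)
      finally show ?thesis .
    next
      case False
      have "record_sum \<mu> r t b (\<lambda>k s. if k < Suc n then indicator {u..u + 1} s else 0) =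
        (\<integral>\<^sup>+x. record_sum \<mu> r (t + x) (min t b) (\<lambda>k s. if k < n then indicator {u..u + 1} s else 0) \<partial>\<mu>)"
        using False by (subst record_sum_rec[OF r]) simp_all
      also have "\<dots> \<le> (\<integral>\<^sup>+x. c * ennreal (exp 1) \<partial>\<mu>)"
        by (intro nn_integral_mono Suc.IH)
      finally show ?thesis by simp
    qed
  qed
qed

lemma ex_record_constant:
  assumes "emeasure \<mu> {x. x < 0} \<noteq> 0"
  obtains c :: real where "c \<ge> 1"
    "\<And>r t b u. r \<in> {(<), (\<le>)} \<Longrightarrow> record_sum \<mu> r t b (\<lambda>k s. indicator {u..u + 1} s) \<le> ennreal c"
proof -
  obtain q where q: "0 \<le> q" "q < 1" "(\<integral>\<^sup>+x. ennreal (exp (min x 0)) \<partial>\<mu>) = ennreal q"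
    using nn_integral_exp_min_less_1[OF assms]
    by (cases "\<integral>\<^sup>+x. ennreal (exp (min x 0)) \<partial>\<mu>") (auto simp: ennreal_less_one_iff)
  \<comment> \<open>\<open>1 / (1 - q)\<close> is the sum of the geometric series with ratio
    \<open>q\<close>, the solution of c = 1 + c q.\<close>
  have *: "1 + ennreal (1 / (1 - q)) * ennreal q \<le> ennreal (1 / (1 - q))"
  proof -
    have "1 + 1 / (1 - q) * q = 1 / (1 - q)"
      using q by (simp add: field_simps)
    moreover have "1 + ennreal (1 / (1 - q)) * ennreal q = ennreal (1 + 1 / (1 - q) * q)"
      using q by (subst ennreal_plus) (auto simp: ennreal_mult[symmetric])
    ultimately show ?thesis by simp
  qed
  show thesis
  proof
    show "1 \<le> 1 / (1 - q) * exp (1::real)"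
      using q mult_mono[of 1 "1 / (1 - q)" 1 "exp (1::real)"] by (simp add: field_simps)
    fix r t b u assume "(r :: real \<Rightarrow> real \<Rightarrow> bool) \<in> {(<), (\<le>)}"
    from record_sum_unit_interval_le[OF this, of "ennreal (1 / (1 - q))" t b u] q *
    show "record_sum \<mu> r t b (\<lambda>k s. indicator {u..u + 1} s) \<le> ennreal (1 / (1 - q) * exp 1)"
      by (subst ennreal_mult) auto
  qed
qed

text \<open>The counted records lie between \<open>a\<close> and \<open>b\<close>, a range covered
  by at most \<open>b - a + 2\<close> unit intervals.\<close>

lemma record_sum_ge_le:
  assumes r: "r \<in> {(<), (\<le>)}" and "a \<le> b"
    and c: "0 \<le> c" "\<And>u. record_sum \<mu> r t b (\<lambda>k s. indicator {u..u + 1} s) \<le> ennreal c"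
  shows "record_sum \<mu> r t b (\<lambda>k s. indicator {a..} s) \<le> ennreal (c * (b - a + 2))"
proof -
  have fin: "record_sum \<mu> r t b (\<lambda>k s. \<Sum>i<m. indicator {a + real i..a + real i + 1} s) \<le> ennreal (c * real m)" for m
  proof (induction m)
    case 0
    then show ?case by (simp add: record_sum_def)
  next
    case (Suc m)
    have "record_sum \<mu> r t b (\<lambda>k s. \<Sum>i<Suc m. indicator {a + real i..a + real i + 1} s)
      = record_sum \<mu> r t b (\<lambda>k s. \<Sum>i<m. indicator {a + real i..a + real i + 1} s)
       + record_sum \<mu> r t b (\<lambda>k s. indicator {a + real m..a + real m + 1} s)"
      by (subst record_sum_add[OF r, symmetric]) simp_all
    also have "\<dots> \<le> ennreal (c * real m) + ennreal c"
      by (intro add_mono Suc.IH c)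
    also have "\<dots> = ennreal (c * real (Suc m))"
      using c(1) by (simp add: ennreal_plus[symmetric] algebra_simps del: ennreal_plus)
    finally show ?case .
  qed
  define m where "m = nat \<lfloor>b - a\<rfloor> + 1"
  have "record_sum \<mu> r t b (\<lambda>k s. indicator {a..} s)
    \<le> record_sum \<mu> r t b (\<lambda>k s. \<Sum>i<m. indicator {a + real i..a + real i + 1} s)"
  proof (intro record_sum_mono r)
    fix s assume "r s b"
    then have sb: "s \<le> b" using r by auto
    show "indicator {a..} s \<le> (\<Sum>i<m. indicator {a + real i..a + real i + 1} s :: ennreal)"
    proof (cases "a \<le> s")
      case True
      define i where "i = nat \<lfloor>s - a\<rfloor>"
      have "i < m" unfolding i_def m_def using True sb by (simp add: nat_mono floor_mono less_Suc_eq_le)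
      moreover have "s \<in> {a + real i..a + real i + 1}"
        unfolding i_def using True by (auto simp: of_nat_nat) linarith+
      ultimately have "(1::ennreal) \<le> (\<Sum>i<m. indicator {a + real i..a + real i + 1} s)"
        using member_le_sum[of i "{..<m}" "\<lambda>i. indicator {a + real i..a + real i + 1} s :: ennreal"] by simp
      then show ?thesis using True by simp
    qed simp
  qed
  also have "\<dots> \<le> ennreal (c * real m)" by (rule fin)
  also have "\<dots> \<le> ennreal (c * (b - a + 2))"
    using assms(2) c(1) by (intro ennreal_leI mult_left_mono) (simp_all add: m_def of_nat_nat; linarith)
  finally show ?thesis .
qed

end

lemma tendsto_if_0:
  fixes f :: "nat \<Rightarrow> ennreal"
  shows "(P \<Longrightarrow> f \<longlonglongrightarrow> 0) \<Longrightarrow> (\<lambda>n. if P then f n else 0) \<longlonglongrightarrow> 0"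
  by (cases P) auto

section \<open>Time reversal and the Green function of the killed walk\<close>

context step_law
begin

text \<open>An injective choice of coordinates of an i.i.d. sequence is again i.i.d.; this is
  checked on cylinder sets.\<close>

lemma distr_paths_reindex:
  fixes \<rho> :: "nat \<Rightarrow> nat" and g :: "real \<Rightarrow> real"
  assumes [measurable]: "g \<in> borel_measurable borel" and \<rho>: "inj \<rho>"
  shows "distr paths (\<Pi>\<^sub>M i\<in>UNIV. distr \<mu> borel g) (\<lambda>\<omega> i. g (\<omega> (\<rho> i))) = (\<Pi>\<^sub>M i\<in>UNIV. distr \<mu> borel g)"
proof -
  have [measurable]: "g \<in> borel_measurable \<mu>" by measurable
  interpret D: prob_space "distr \<mu> borel g" by (rule prob_space_distr) measurable
  interpret DP: product_prob_space "\<lambda>_::nat. distr \<mu> borel g" UNIV by (intro product_prob_spaceI D.prob_space_axioms)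
  have [measurable]: "(\<lambda>\<omega> i. g (\<omega> (\<rho> i))) \<in> measurable paths (\<Pi>\<^sub>M i\<in>UNIV. distr \<mu> borel g)"
    by (intro measurable_PiM_single') (auto simp: space_PiM)
  show ?thesis
  proof (rule DP.PiM_eq)
    fix J :: "nat set" and F :: "nat \<Rightarrow> real set"
    assume J: "finite J" and F: "\<And>j. j \<in> J \<Longrightarrow> F j \<in> sets (distr \<mu> borel g)"
    have gF: "g -` F j \<in> sets \<mu>" if "j \<in> J" for j
      using measurable_sets[OF \<open>g \<in> borel_measurable \<mu>\<close>, of "F j"] F[OF that] by simp
    have "emeasure (distr paths (\<Pi>\<^sub>M i\<in>UNIV. distr \<mu> borel g) (\<lambda>\<omega> i. g (\<omega> (\<rho> i))))
        (prod_emb UNIV (\<lambda>_. distr \<mu> borel g) J (Pi\<^sub>E J F))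
      = emeasure paths (prod_emb UNIV (\<lambda>_. \<mu>) (\<rho> ` J) (\<Pi>\<^sub>E i\<in>\<rho> ` J. g -` F (inv \<rho> i)))"
    proof (subst emeasure_distr)
      show "prod_emb UNIV (\<lambda>_. distr \<mu> borel g) J (Pi\<^sub>E J F) \<in> sets (\<Pi>\<^sub>M i\<in>UNIV. distr \<mu> borel g)"
        using J F by (intro sets_PiM_I) auto
      show "emeasure paths ((\<lambda>\<omega> i. g (\<omega> (\<rho> i))) -` prod_emb UNIV (\<lambda>_. distr \<mu> borel g) J (Pi\<^sub>E J F) \<inter> space paths)
        = emeasure paths (prod_emb UNIV (\<lambda>_. \<mu>) (\<rho> ` J) (\<Pi>\<^sub>E i\<in>\<rho> ` J. g -` F (inv \<rho> i)))"
        using \<rho> by (intro arg_cong[where f="emeasure paths"])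
          (auto simp: prod_emb_def space_PiM PiE_iff extensional_def)
    qed simp
    also have "\<dots> = (\<Prod>i\<in>\<rho> ` J. emeasure \<mu> (g -` F (inv \<rho> i)))"
      using J \<rho> gF by (intro path.emeasure_PiM_emb) auto
    also have "\<dots> = (\<Prod>j\<in>J. emeasure (distr \<mu> borel g) (F j))"
      using F \<rho> by (subst prod.reindex) (auto simp: emeasure_distr inj_on_def intro!: prod.cong)
    finally show "emeasure (distr paths (\<Pi>\<^sub>M i\<in>UNIV. distr \<mu> borel g) (\<lambda>\<omega> i. g (\<omega> (\<rho> i))))
        (prod_emb UNIV (\<lambda>_. distr \<mu> borel g) J (Pi\<^sub>E J F)) = (\<Prod>j\<in>J. emeasure (distr \<mu> borel g) (F j))" .
  qed simp
qed

lemma step_law_reflect: "step_law (distr \<mu> borel uminus)"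
  unfolding step_law_def step_law_axioms_def by (auto intro!: prob_space_distr)

text \<open>Duality: read backwards and reflected, a path that stays above its starting point until time
  \<open>k\<close> is a path with a weak record at time \<open>k\<close>.\<close>

lemma killed_green_eq_record_sum_reflect:
  assumes \<psi>: "\<And>k. \<psi> k \<in> borel_measurable borel"
  shows "killed_green \<mu> s s \<psi> = record_sum (distr \<mu> borel uminus) (\<le>) (- s) (- s) (\<lambda>k x. \<psi> k (- x))"
proof -
  interpret R: step_law "distr \<mu> borel uminus" by (rule step_law_reflect)
  note [measurable] = \<psi>
  have "(\<integral>\<^sup>+\<omega>. (if is_record (\<le>) (- s) (- s) k \<omega> then \<psi> k (- (- s + partial_sum k \<omega>)) else 0) \<partial>R.paths)
    = (\<integral>\<^sup>+\<omega>. (if alive s s k \<omega> then \<psi> k (s + partial_sum k \<omega>) else 0) \<partial>paths)" for k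
  proof -
    \<comment> \<open>Reverses the first \<open>k\<close> steps and fixes the others, so that the
      map is injective on all indices.\<close>
    define \<rho> where "\<rho> i = (if i < k then k - 1 - i else i)" for i
    have \<rho>: "inj \<rho>" by (auto simp: \<rho>_def inj_def split: if_splits)
    have ps: "partial_sum j (\<lambda>i. - \<omega> (\<rho> i)) = - (partial_sum k \<omega> - partial_sum (k - j) \<omega>)" if "j \<le> k" for j \<omega>
    proof -
      have "partial_sum j (\<lambda>i. - \<omega> (\<rho> i)) = (\<Sum>i<j. - \<omega> (k - 1 - i))"
        unfolding partial_sum_def using that by (intro sum.cong) (auto simp: \<rho>_def)
      also have "\<dots> = - (\<Sum>i\<in>{k - j..<k}. \<omega> i)"
        unfolding sum_negf using that
        by (intro arg_cong[where f=uminus] sum.reindex_bij_witness[where i="\<lambda>i. k - 1 - i" and j="\<lambda>i. k - 1 - i"]) auto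
      also have "(\<Sum>i\<in>{k - j..<k}. \<omega> i) = partial_sum k \<omega> - partial_sum (k - j) \<omega>"
        unfolding partial_sum_def lessThan_atLeast0
        by (subst sum_diff_nat_ivl) (use that in auto)
      finally show ?thesis .
    qed
    have rec: "is_record (\<le>) (- s) (- s) k (\<lambda>i. - \<omega> (\<rho> i)) \<longleftrightarrow> alive s s k \<omega>" for \<omega>
    proof -
      have "is_record (\<le>) (- s) (- s) k (\<lambda>i. - \<omega> (\<rho> i)) \<longleftrightarrow> (\<forall>j\<le>k. 0 \<le> partial_sum (k - j) \<omega>)"
        unfolding is_record_def using ps by (force simp: le_less)
      also have "\<dots> \<longleftrightarrow> (\<forall>j\<le>k. 0 \<le> partial_sum j \<omega>)"
        by (metis diff_diff_cancel diff_le_self)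
      finally show ?thesis by (simp add: alive_def)
    qed
    have meas: "(\<lambda>\<omega>. if is_record (\<le>) (- s) (- s) k \<omega> then \<psi> k (- (- s + partial_sum k \<omega>)) else 0) \<in> borel_measurable R.paths"
      by (rule R.measurable_record_integrand[of _ _ _ _ _ "\<lambda>k x. \<psi> k (- x)"]) simp_all
    have "(\<integral>\<^sup>+\<omega>. (if is_record (\<le>) (- s) (- s) k \<omega> then \<psi> k (- (- s + partial_sum k \<omega>)) else 0) \<partial>R.paths)
      = (\<integral>\<^sup>+\<omega>. (if is_record (\<le>) (- s) (- s) k (\<lambda>i. - \<omega> (\<rho> i)) then \<psi> k (- (- s + partial_sum k (\<lambda>i. - \<omega> (\<rho> i)))) else 0) \<partial>paths)"
      by (subst distr_paths_reindex[symmetric, OF _ \<rho>], simp, subst nn_integral_distr)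
        (use meas in \<open>auto intro!: measurable_PiM_single' simp: space_PiM\<close>)
    also have "\<dots> = (\<integral>\<^sup>+\<omega>. (if alive s s k \<omega> then \<psi> k (s + partial_sum k \<omega>) else 0) \<partial>paths)"
      by (simp add: rec ps add.commute cong: if_cong)
    finally show ?thesis .
  qed
  then show ?thesis
    unfolding killed_green_def record_sum_def by simp
qed

text \<open>Duality turns visits above the starting point into weak records of the reflected walk,
  which goes down when the original goes up; the interval becomes [- u - 1, - u].\<close>

lemma ex_green_constant:
  assumes "emeasure \<mu> {x. 0 < x} \<noteq> 0"
  obtains c :: real where "c \<ge> 1"
    "\<And>s u. killed_green \<mu> s s (\<lambda>k x. indicator {u..u + 1} x) \<le> ennreal c"
proof -
  interpret R: step_law "distr \<mu> borel uminus" by (rule step_law_reflect)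
  have "emeasure (distr \<mu> borel uminus) {x. x < 0} = emeasure \<mu> {x. 0 < x}"
    by (subst emeasure_distr) (auto intro!: arg_cong[where f="emeasure \<mu>"])
  with assms obtain c where c: "1 \<le> c" "\<And>r t b u. r \<in> {(<), (\<le>)} \<Longrightarrow>
      record_sum (distr \<mu> borel uminus) r t b (\<lambda>k s. indicator {u..u + 1} s) \<le> ennreal c"
    using R.ex_record_constant by auto
  have "killed_green \<mu> s s (\<lambda>k x. indicator {u..u + 1} x) \<le> ennreal c" for s u
  proof -
    have "indicator {u..u + 1} (- x) = (indicator {- u - 1..- u - 1 + 1} x :: ennreal)" for x :: real
      by (auto simp: indicator_def)
    then show ?thesis
      using c(2)[of "(\<le>)" "- s" "- s" "- u - 1"] by (simp add: killed_green_eq_record_sum_reflect)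
  qed
  with c(1) that show thesis by blast
qed

text \<open>Each visit of an interval by the walk killed below \<open>a\<close> is charged to the last record before it.\<close>

lemma killed_green_le_record_sum:
  assumes V: "\<And>s. killed_green \<mu> s s (\<lambda>k x. indicator {u..u + 1} x) \<le> V"
  shows "killed_green \<mu> a t (\<lambda>k x. indicator {u..u + 1} x) \<le> V * record_sum \<mu> (<) t (t + 1) (\<lambda>k s. indicator {a..} s)"
proof (rule killed_green_le_truncated)
  fix n
  define I where "I n = (\<lambda>k x. if k < n then indicator {u..u + 1} x else (0::ennreal))" for n :: nat
  define J where "J n = (\<lambda>k x. if k < n then indicator {a..} x else (0::ennreal))" for n :: nat
  have [measurable]: "I n k \<in> borel_measurable borel" "J n k \<in> borel_measurable borel" for n k
    by (simp_all add: I_def J_def)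
  have IS: "(\<lambda>k. I (Suc n) (Suc k)) = I n" "(\<lambda>k. J (Suc n) (Suc k)) = J n" for n
    by (simp_all add: I_def J_def)
  have Vn: "killed_green \<mu> s s (I n) \<le> V" for s n
    by (rule order.trans[OF killed_green_mono V]) (auto simp: I_def)
  have I0: "killed_green \<mu> a t (I 0) = 0" for a t
    by (simp add: killed_green_def I_def)
  \<comment> \<open>Here \<open>b\<close> is the running minimum. A step below \<open>b\<close> is a
    new record: the argument restarts with the barrier at that record, the visits during the
    excursion above it cost at most \<open>V\<close>, and the record itself contributes the 1 that
    pays for them.\<close>
  have *: "b \<le> t \<Longrightarrow> a \<le> b \<Longrightarrow> killed_green \<mu> a t (I n) \<le> killed_green \<mu> b t (I n) + V * record_sum \<mu> (<) t b (J n)" for t b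
  proof (induction n arbitrary: t b)
    case 0
    then show ?case by (simp add: I0)
  next
    case (Suc n)
    have step: "killed_green \<mu> a (t + x) (I n) \<le> killed_green \<mu> b (t + x) (I n) + V * record_sum \<mu> (<) (t + x) b (J n)" for x
    proof (cases "b \<le> t + x")
      case True
      then show ?thesis using Suc by blast
    next
      case False
      let ?s = "t + x"
      show ?thesis
      proof (cases "a \<le> ?s \<and> n \<noteq> 0")
        case True
        then obtain m where m: "n = Suc m" using not0_implies_Suc by blast
        have J: "record_sum \<mu> (<) ?s b (J n) = 1 + record_sum \<mu> (<) ?s ?s (J n)"
          unfolding m using True False
          by (subst (1 2) record_sum_rec) (auto simp: IS min_def, auto simp: J_def)
        have "killed_green \<mu> a ?s (I n) \<le> killed_green \<mu> ?s ?s (I n) + V * record_sum \<mu> (<) ?s ?s (J n)"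
          using True by (intro Suc.IH) auto
        also have "\<dots> \<le> V + V * record_sum \<mu> (<) ?s ?s (J n)"
          by (intro add_right_mono Vn)
        also have "\<dots> = V * record_sum \<mu> (<) ?s b (J n)"
          unfolding J by (simp add: distrib_left)
        finally show ?thesis by (simp add: add_increasing)
      next
        case F: False
        then have "killed_green \<mu> a ?s (I n) = 0"
          by (cases "n = 0") (auto simp: I0 killed_green_rec)
        then show ?thesis by simp
      qed
    qed
    have "killed_green \<mu> a t (I (Suc n)) = I (Suc n) 0 t + (\<integral>\<^sup>+x. killed_green \<mu> a (t + x) (I n) \<partial>\<mu>)"
      using Suc.prems by (subst killed_green_rec) (auto simp: IS)
    also have "\<dots> \<le> I (Suc n) 0 t + (\<integral>\<^sup>+x. killed_green \<mu> b (t + x) (I n) + V * record_sum \<mu> (<) (t + x) b (J n) \<partial>\<mu>)"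
      by (intro add_left_mono nn_integral_mono step)
    also have "\<dots> = I (Suc n) 0 t + (\<integral>\<^sup>+x. killed_green \<mu> b (t + x) (I n) \<partial>\<mu>) + V * (\<integral>\<^sup>+x. record_sum \<mu> (<) (t + x) b (J n) \<partial>\<mu>)"
      by (subst nn_integral_add) (auto simp: nn_integral_cmult add.assoc)
    also have "I (Suc n) 0 t + (\<integral>\<^sup>+x. killed_green \<mu> b (t + x) (I n) \<partial>\<mu>) = killed_green \<mu> b t (I (Suc n))"
      using Suc.prems by (subst (2) killed_green_rec) (auto simp: IS)
    also have "(\<integral>\<^sup>+x. record_sum \<mu> (<) (t + x) b (J n) \<partial>\<mu>) = record_sum \<mu> (<) t b (J (Suc n))"
      using Suc.prems by (subst (2) record_sum_rec) (auto simp: IS min_absorb2)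
    finally show ?case .
  qed
  show "killed_green \<mu> a t (\<lambda>k x. if k < n then indicator {u..u + 1} x else 0) \<le> V * record_sum \<mu> (<) t (t + 1) (\<lambda>k s. indicator {a..} s)"
  proof (cases "a \<le> t \<and> n \<noteq> 0")
    case True
    then obtain m where m: "n = Suc m" using not0_implies_Suc by blast
    \<comment> \<open>With barrier \<open>t + 1\<close> the start counts as a record and pays for
      the first excursion.\<close>
    have J: "record_sum \<mu> (<) t (t + 1) (J n) = 1 + record_sum \<mu> (<) t t (J n)"
      unfolding m using True
      by (subst (1 2) record_sum_rec) (auto simp: IS min_def, auto simp: J_def)
    have "killed_green \<mu> a t (I n) \<le> killed_green \<mu> t t (I n) + V * record_sum \<mu> (<) t t (J n)"
      using True by (intro *) auto
    also have "\<dots> \<le> V + V * record_sum \<mu> (<) t t (J n)"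
      by (intro add_right_mono Vn)
    also have "\<dots> = V * record_sum \<mu> (<) t (t + 1) (J n)"
      unfolding J by (simp add: distrib_left)
    also have "\<dots> \<le> V * record_sum \<mu> (<) t (t + 1) (\<lambda>k s. indicator {a..} s)"
      by (intro mult_left_mono record_sum_mono) (auto simp: J_def)
    finally show ?thesis by (simp add: I_def)
  next
    case F: False
    then have "killed_green \<mu> a t (I n) = 0"
      by (cases "n = 0") (auto simp: I0 killed_green_rec)
    then show ?thesis by (simp add: I_def)
  qed
qed

text \<open>Dominated convergence is used twice: along the paths for each time \<open>k\<close>, and
  then for the sum over \<open>k\<close>, read as an integral over counting measure. Both dominating
  functions are integrable because the mean number of records above \<open>a\<close> is
  finite.\<close>

lemma tendsto_record_sum_0:
  assumes r: "r \<in> {(<), (\<le>)}" and \<psi>: "\<And>n k. \<psi> n k \<in> borel_measurable borel"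
    and lim: "\<And>k s. (\<lambda>n. \<psi> n k s) \<longlonglongrightarrow> 0"
    and w: "\<And>n k s. r s b \<Longrightarrow> \<psi> n k s \<le> ennreal B * indicator {a..} s"
    and fin: "record_sum \<mu> r t b (\<lambda>k s. indicator {a..} s) < \<infinity>"
  shows "(\<lambda>n. record_sum \<mu> r t b (\<psi> n)) \<longlonglongrightarrow> 0"
proof -
  define F where "F \<psi> k = (\<integral>\<^sup>+\<omega>. (if is_record r t b k \<omega> then \<psi> k (t + partial_sum k \<omega>) else 0) \<partial>paths)"
    for \<psi> :: "nat \<Rightarrow> real \<Rightarrow> ennreal" and k
  define W where "W = (\<lambda>(k::nat) s. ennreal B * indicator {a..} (s::real))"
  have W_meas: "W k \<in> borel_measurable borel" for k by (simp add: W_def)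
  have sumW: "(\<Sum>k. F W k) < \<infinity>"
  proof -
    have "(\<Sum>k. F W k) = ennreal B * record_sum \<mu> r t b (\<lambda>k s. indicator {a..} s)"
      unfolding W_def by (subst record_sum_cmult[OF r, symmetric]) (simp_all add: record_sum_def F_def[abs_def])
    then show ?thesis using fin by (simp add: ennreal_mult_less_top)
  qed
  have Fle: "F (\<psi> n) k \<le> F W k" for n k
    unfolding F_def using w by (intro nn_integral_mono) (auto simp: is_record_def W_def)
  have FW: "F W k < \<infinity>" for k
  proof -
    have "F W k \<le> (\<Sum>k. F W k)"
      using sum_le_suminf[OF summableI, of "{k}" "F W"] by simp
    then show ?thesis using sumW by (rule le_less_trans)
  qed
  have "(\<lambda>n. F (\<psi> n) k) \<longlonglongrightarrow> (\<integral>\<^sup>+\<omega>. 0 \<partial>paths)" for k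
    unfolding F_def
  proof (rule nn_integral_dominated_convergence)
    show "(\<integral>\<^sup>+\<omega>. (if is_record r t b k \<omega> then W k (t + partial_sum k \<omega>) else 0) \<partial>paths) < \<infinity>"
      using FW[of k] by (simp add: F_def)
    show "AE \<omega> in paths. (\<lambda>n. if is_record r t b k \<omega> then \<psi> n k (t + partial_sum k \<omega>) else 0) \<longlonglongrightarrow> 0"
      by (intro AE_I2 tendsto_if_0 lim)
    show "AE \<omega> in paths. (if is_record r t b k \<omega> then \<psi> n k (t + partial_sum k \<omega>) else 0) \<le>
      (if is_record r t b k \<omega> then W k (t + partial_sum k \<omega>) else 0)" for n
      using w by (intro AE_I2) (auto simp: is_record_def W_def)
  qed (auto intro!: measurable_record_integrand[OF r] \<psi> W_meas)
  then have "(\<lambda>n. \<integral>\<^sup>+k. F (\<psi> n) k \<partial>count_space UNIV) \<longlonglongrightarrow> (\<integral>\<^sup>+(k::nat). 0 \<partial>count_space UNIV)"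
    using sumW Fle
    by (intro nn_integral_dominated_convergence[where w="F W"]) (auto simp: nn_integral_count_space_nat)
  then show ?thesis
    by (simp add: nn_integral_count_space_nat record_sum_def F_def)
qed

text \<open>Only the times below \<open>d\<close> enter, so that a constant dominates although the
  Green function over all times may have infinite mass.\<close>

lemma tendsto_killed_green_0:
  assumes \<psi>: "\<And>n k. \<psi> n k \<in> borel_measurable borel"
    and lim: "\<And>k s. k < d \<Longrightarrow> a \<le> s \<Longrightarrow> (\<lambda>n. \<psi> n k s) \<longlonglongrightarrow> 0"
    and w: "\<And>n k s. \<psi> n k s \<le> ennreal B"
  shows "(\<lambda>n. killed_green \<mu> a t (\<lambda>k s. if k < d then \<psi> n k s else 0)) \<longlonglongrightarrow> 0"
proof -
  define F where "F n k = (\<integral>\<^sup>+\<omega>. (if alive a t k \<omega> then \<psi> n k (t + partial_sum k \<omega>) else 0) \<partial>paths)" for n k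
  have "(\<lambda>n. F n k) \<longlonglongrightarrow> (\<integral>\<^sup>+\<omega>. 0 \<partial>paths)" if "k < d" for k
    unfolding F_def
  proof (rule nn_integral_dominated_convergence[where w="\<lambda>_. ennreal B"])
    show "AE \<omega> in paths. (\<lambda>n. if alive a t k \<omega> then \<psi> n k (t + partial_sum k \<omega>) else 0) \<longlonglongrightarrow> 0"
      using that lim by (intro AE_I2 tendsto_if_0) (auto simp: alive_def)
  qed (auto intro!: measurable_alive_integrand \<psi> w AE_I2 simp: path.P.emeasure_space_1 ennreal_mult_less_top)
  then have "(\<lambda>n. \<Sum>k<d. F n k) \<longlonglongrightarrow> (\<Sum>k<d. 0)"
    by (intro tendsto_sum) simp
  moreover have "killed_green \<mu> a t (\<lambda>k s. if k < d then \<psi> n k s else 0) = (\<Sum>k<d. F n k)" for n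
  proof -
    have "killed_green \<mu> a t (\<lambda>k s. if k < d then \<psi> n k s else 0) = (\<Sum>k. if k < d then F n k else 0)"
      unfolding killed_green_def F_def by (intro suminf_cong) (simp cong: if_cong)
    also have "\<dots> = (\<Sum>k<d. F n k)"
      by (subst suminf_finite[of "{..<d}"]) auto
    finally show ?thesis .
  qed
  ultimately show ?thesis by simp
qed

end

subsection \<open>The law of the family of offspring\<close>

definition graft :: "'c \<Rightarrow> (nat \<Rightarrow> nat list \<Rightarrow> 'c) \<Rightarrow> nat list \<Rightarrow> 'c"
  where "graft z f u = (case u of [] \<Rightarrow> z | i # v \<Rightarrow> f i v)"

lemma graft_simps [simp]: "graft z f [] = z" "graft z f (i # v) = f i v"
  by (simp_all add: graft_def)

text \<open>\<open>hit c n b t\<close>: a particle at \<open>t\<close> has a descendant \<open>n\<close> generations later that lies below \<open>c\<close>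
  and whose ancestral line never goes below the barrier \<open>b\<close>; \<open>b = - \<infinity>\<close> means no barrier.\<close>

primrec hit :: "real \<Rightarrow> nat \<Rightarrow> ereal \<Rightarrow> real \<Rightarrow> (nat list \<Rightarrow> enat \<times> (nat \<Rightarrow> real)) \<Rightarrow> bool" where
  "hit c 0 b t w \<longleftrightarrow> b \<le> ereal t \<and> t < c"
| "hit c (Suc n) b t w \<longleftrightarrow> b \<le> ereal t \<and>
    (\<exists>i. enat i < fst (w []) \<and> hit c n b (t + snd (w []) i) (\<lambda>v. w (i # v)))"

lemma hit_graft: "hit c (Suc n) b t (graft z f) \<longleftrightarrow>
    b \<le> ereal t \<and> (\<exists>i. enat i < fst z \<and> hit c n b (t + snd z i) (f i))"
  by simp

lemma hit_above: "hit c n b t w \<Longrightarrow> b \<le> ereal t"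
  by (cases n) auto

lemma hit_antimono: "hit c n b t w \<Longrightarrow> b' \<le> b \<Longrightarrow> hit c n b' t w"
  by (induction n arbitrary: t w) (auto intro: order.trans)

definition child_sum :: "enat \<times> (nat \<Rightarrow> real) \<Rightarrow> (real \<Rightarrow> ennreal) \<Rightarrow> ennreal"
  where "child_sum z g = (\<Sum>i. if enat i < fst z then g (snd z i) else 0)"

lemma child_sum_mono: "(\<And>x. g x \<le> h x) \<Longrightarrow> child_sum z g \<le> child_sum z h"
  unfolding child_sum_def by (intro suminf_le summableI) auto

lemma child_sum_add: "child_sum z (\<lambda>x. g x + h x) = child_sum z g + child_sum z h"
  unfolding child_sum_def by (subst suminf_add) (auto intro!: summableI suminf_cong)

lemma child_sum_cmult: "child_sum z (\<lambda>x. k * g x) = k * child_sum z g"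
  unfolding child_sum_def ennreal_suminf_cmult[symmetric] by (intro suminf_cong) auto

section \<open>Branching property of the family of offspring\<close>

locale offspring_law = prob_space L for L :: "(enat \<times> (nat \<Rightarrow> real)) measure" +
  assumes sets_L [measurable_cong]: "sets L = sets offspring_space"
begin

abbreviation "tree_law \<equiv> \<Pi>\<^sub>M u\<in>(UNIV::nat list set). L"
abbreviation "forest_law \<equiv> \<Pi>\<^sub>M i\<in>(UNIV::nat set). tree_law"

sublocale tr: product_prob_space "\<lambda>_::nat list. L" UNIV
  by (intro product_prob_spaceI prob_space_axioms)

sublocale fo: sequence_space tree_law
  unfolding sequence_space_def by (intro product_prob_spaceI tr.P.prob_space_axioms)

lemma space_L [simp]: "space L = UNIV"
  using sets_eq_imp_space_eq[OF sets_L] by (simp add: offspring_space_def space_pair_measure space_PiM)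

lemma space_trees [simp]: "space tree_law = UNIV"
  by (simp add: space_PiM)

lemma space_forests [simp]: "space forest_law = UNIV"
  by (simp add: space_PiM)

lemma measurable_fst_L [measurable]: "fst \<in> measurable L (count_space UNIV)"
  by (subst measurable_cong_sets[OF sets_L refl]) (simp add: offspring_space_def)

lemma measurable_snd_L [measurable]: "(\<lambda>z. snd z i) \<in> borel_measurable L"
  by (subst measurable_cong_sets[OF sets_L refl]) (simp add: offspring_space_def)

lemma measurable_graft [measurable]: "(\<lambda>(z, f). graft z f) \<in> measurable (L \<Otimes>\<^sub>M forest_law) tree_law"
proof (rule measurable_PiM_single')
  fix u :: "nat list"
  show "(\<lambda>x. (case x of (z, f) \<Rightarrow> graft z f) u) \<in> measurable (L \<Otimes>\<^sub>M forest_law) L"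
  proof (cases u)
    case (Cons i v)
    have "(\<lambda>x. snd x i) \<in> measurable (L \<Otimes>\<^sub>M forest_law) tree_law"
      by measurable
    then have "(\<lambda>x. snd x i v) \<in> measurable (L \<Otimes>\<^sub>M forest_law) L"
      by measurable
    then show ?thesis by (simp add: case_prod_beta Cons)
  qed (simp add: case_prod_beta)
qed simp

text \<open>This is the branching property: the copy at the root and the subfamilies of the children
  are independent, and each subfamily has the law of the whole. A cylinder over a finite
  \<open>J\<close> splits into a condition at the root and, for each first letter \<open>i\<close>,
  a cylinder over the words that follow \<open>i\<close>.\<close>

lemma distr_graft: "distr (L \<Otimes>\<^sub>M forest_law) tree_law (\<lambda>(z, f). graft z f) = tree_law"
proof (rule tr.PiM_eq)
  fix J :: "nat list set" and E assume J: "finite J" and E: "\<And>j. j \<in> J \<Longrightarrow> E j \<in> sets L"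
  define K where "K = hd ` (J - {[]})"
  define Jc where "Jc i = {v. i # v \<in> J}" for i
  define C where "C i = prod_emb UNIV (\<lambda>_. L) (Jc i) (\<Pi>\<^sub>E v\<in>Jc i. E (i # v))" for i
  have finJc: "finite (Jc i)" for i
    using finite_vimageI[OF J, of "(#) i"] by (simp add: Jc_def vimage_def inj_def)
  have inK: "i # v \<in> J \<Longrightarrow> i \<in> K" for i v
    unfolding K_def by (rule image_eqI[of _ _ "i # v"]) auto
  have finK: "finite K" using J by (simp add: K_def)
  have C: "C i \<in> sets tree_law" for i
    unfolding C_def using finJc E by (intro sets_PiM_I) (auto simp: Jc_def)
  let ?X = "prod_emb UNIV (\<lambda>_. L) J (Pi\<^sub>E J E)"
  let ?E0 = "if [] \<in> J then E [] else UNIV"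
  let ?F = "prod_emb UNIV (\<lambda>_. tree_law) K (Pi\<^sub>E K C)"
  have E0: "?E0 \<in> sets L" using E sets.top[of L] by auto
  have X: "?X \<in> sets tree_law" using J E by (intro sets_PiM_I) auto
  have pre: "(\<lambda>(z, f). graft z f) -` ?X \<inter> space (L \<Otimes>\<^sub>M forest_law) = ?E0 \<times> ?F"
  proof (intro set_eqI)
    fix x :: "(enat \<times> (nat \<Rightarrow> real)) \<times> (nat \<Rightarrow> nat list \<Rightarrow> enat \<times> (nat \<Rightarrow> real))"
    obtain z f where x: "x = (z, f)" by (cases x)
    have "(\<forall>u\<in>J. graft z f u \<in> E u) \<longleftrightarrow> ([] \<in> J \<longrightarrow> z \<in> E []) \<and> (\<forall>i\<in>K. \<forall>v\<in>Jc i. f i v \<in> E (i # v))"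
      (is "?l \<longleftrightarrow> ?r")
    proof
      assume l: ?l
      have "z \<in> E []" if "[] \<in> J" using bspec[OF l that] by simp
      moreover have "f i v \<in> E (i # v)" if "v \<in> Jc i" for i v
        using bspec[OF l, of "i # v"] that by (simp add: Jc_def)
      ultimately show ?r by blast
    next
      assume r: ?r
      show ?l
      proof
        fix u assume "u \<in> J"
        then show "graft z f u \<in> E u"
          using r inK by (cases u) (auto simp: Jc_def)
      qed
    qed
    then show "x \<in> (\<lambda>(z, f). graft z f) -` ?X \<inter> space (L \<Otimes>\<^sub>M forest_law) \<longleftrightarrow> x \<in> ?E0 \<times> ?F"
      unfolding x by (auto simp: prod_emb_def PiE_iff C_def space_pair_measure)
  qed
  have "emeasure (distr (L \<Otimes>\<^sub>M forest_law) tree_law (\<lambda>(z, f). graft z f)) ?X = emeasure (L \<Otimes>\<^sub>M forest_law) (?E0 \<times> ?F)"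
    by (subst emeasure_distr[OF measurable_graft X]) (simp only: pre)
  also have "\<dots> = emeasure L ?E0 * emeasure forest_law ?F"
    using finK C E0 by (intro fo.P.emeasure_pair_measure_Times sets_PiM_I) auto
  also have "emeasure forest_law ?F = (\<Prod>i\<in>K. emeasure tree_law (C i))"
    using finK C by (intro fo.emeasure_PiM_emb) auto
  also have "\<dots> = (\<Prod>i\<in>K. \<Prod>v\<in>Jc i. emeasure L (E (i # v)))"
    unfolding C_def using finJc E by (intro prod.cong refl tr.emeasure_PiM_emb) (auto simp: Jc_def)
  also have "\<dots> = (\<Prod>(i, v)\<in>Sigma K Jc. emeasure L (E (i # v)))"
    using finK finJc by (intro prod.Sigma) auto
  also have "\<dots> = (\<Prod>u\<in>J - {[]}. emeasure L (E u))"
    by (rule prod.reindex_bij_witness[where i="\<lambda>u. (hd u, tl u)" and j="\<lambda>(i, v). i # v"])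
      (auto simp: K_def Jc_def)
  also have "emeasure L ?E0 * \<dots> = (\<Prod>u\<in>J. emeasure L (E u))"
    using prod.remove[OF J, of "[]" "\<lambda>u. emeasure L (E u)"] emeasure_space_1 by auto
  finally show "emeasure (distr (L \<Otimes>\<^sub>M forest_law) tree_law (\<lambda>(z, f). graft z f)) ?X = (\<Prod>u\<in>J. emeasure L (E u))" .
qed simp

lemma nn_integral_trees:
  assumes [measurable]: "f \<in> borel_measurable tree_law"
  shows "(\<integral>\<^sup>+w. f w \<partial>tree_law) = (\<integral>\<^sup>+z. \<integral>\<^sup>+w. f (graft z w) \<partial>forest_law \<partial>L)"
proof -
  have "(\<integral>\<^sup>+w. f w \<partial>tree_law) = (\<integral>\<^sup>+x. f (case x of (z, w) \<Rightarrow> graft z w) \<partial>(L \<Otimes>\<^sub>M forest_law))"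
    by (subst distr_graft[symmetric], subst nn_integral_distr) simp_all
  also have "\<dots> = (\<integral>\<^sup>+z. \<integral>\<^sup>+w. f (graft z w) \<partial>forest_law \<partial>L)"
    by (subst fo.P.nn_integral_fst[symmetric]) simp_all
  finally show ?thesis .
qed

lemma pred_hit [measurable (raw)]:
  assumes "b \<in> borel_measurable M" "t \<in> borel_measurable M" "w \<in> measurable M tree_law"
  shows "Measurable.pred M (\<lambda>x. hit c n (b x) (t x) (w x))"
  using assms
proof (induction n arbitrary: t w)
  case 0
  note [measurable] = 0
  show ?case unfolding hit.simps by measurable
next
  case (Suc n)
  note [measurable] = Suc.prems
  have [measurable]: "(\<lambda>x. w x []) \<in> measurable M L"
    by measurable
  have [measurable]: "(\<lambda>x. fst (w x [])) \<in> measurable M (count_space UNIV)" "(\<lambda>x. snd (w x []) i) \<in> borel_measurable M" for i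
    using measurable_compose[OF \<open>(\<lambda>x. w x []) \<in> measurable M L\<close> measurable_fst_L]
      measurable_compose[OF \<open>(\<lambda>x. w x []) \<in> measurable M L\<close> measurable_snd_L] by simp_all
  have [measurable]: "(\<lambda>x v. w x (i # v)) \<in> measurable M tree_law" for i
    by (rule measurable_PiM_single') simp_all
  have [measurable]: "Measurable.pred M (\<lambda>x. hit c n (b x) (t x + snd (w x []) i) (\<lambda>v. w x (i # v)))" for i
    by (rule Suc.IH) measurable
  show ?case unfolding hit.simps by measurable
qed

lemma emeasure_trees_eq:
  assumes "Measurable.pred tree_law Q"
  shows "emeasure tree_law {w. Q w} = (\<integral>\<^sup>+z. emeasure forest_law {f. Q (graft z f)} \<partial>L)"
proof -
  have "emeasure tree_law {w. Q w} = (\<integral>\<^sup>+w. indicator {w. Q w} w \<partial>tree_law)"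
    using assms by (subst nn_integral_indicator) (auto simp: pred_def)
  also have "\<dots> = (\<integral>\<^sup>+z. \<integral>\<^sup>+w. indicator {w. Q w} (graft z w) \<partial>forest_law \<partial>L)"
    using assms by (intro nn_integral_trees) (auto simp: pred_def)
  also have "\<dots> = (\<integral>\<^sup>+z. emeasure forest_law {f. Q (graft z f)} \<partial>L)"
  proof (intro nn_integral_cong)
    fix z
    have "(\<lambda>f. graft z f) \<in> measurable forest_law tree_law"
      using measurable_compose[OF measurable_Pair1' measurable_graft, of z] by simp
    then have "{f. Q (graft z f)} \<in> sets forest_law"
      using assms measurable_sets[of "graft z" forest_law tree_law "{w. Q w}"] by (auto simp: pred_def vimage_def)
    then have "(\<integral>\<^sup>+w. indicator {f. Q (graft z f)} w \<partial>forest_law) = emeasure forest_law {f. Q (graft z f)}"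
      by (rule nn_integral_indicator)
    then show "(\<integral>\<^sup>+w. indicator {w. Q w} (graft z w) \<partial>forest_law) = emeasure forest_law {f. Q (graft z f)}"
      by (simp add: indicator_def)
  qed
  finally show ?thesis .
qed

lemma measurable_emeasure_forest_law:
  assumes "Measurable.pred (M \<Otimes>\<^sub>M forest_law) (\<lambda>x. Q (fst x) (snd x))"
  shows "(\<lambda>x. emeasure forest_law {f. Q x f}) \<in> borel_measurable M"
proof -
  have "(\<lambda>x. emeasure forest_law (Pair x -` {x\<in>space (M \<Otimes>\<^sub>M forest_law). Q (fst x) (snd x)})) \<in> borel_measurable M"
    using assms by (intro fo.P.measurable_emeasure_Pair) (simp add: pred_def)
  moreover have "emeasure forest_law {f. Q x f} = emeasure forest_law (Pair x -` {x\<in>space (M \<Otimes>\<^sub>M forest_law). Q (fst x) (snd x)})"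
    if "x \<in> space M" for x
    using that by (simp add: space_pair_measure vimage_def)
  ultimately show ?thesis
    by (subst measurable_cong) auto
qed

lemma measurable_emeasure_tree_law:
  assumes "Measurable.pred (M \<Otimes>\<^sub>M tree_law) (\<lambda>x. Q (fst x) (snd x))"
  shows "(\<lambda>x. emeasure tree_law {f. Q x f}) \<in> borel_measurable M"
proof -
  have "(\<lambda>x. emeasure tree_law (Pair x -` {x\<in>space (M \<Otimes>\<^sub>M tree_law). Q (fst x) (snd x)})) \<in> borel_measurable M"
    using assms by (intro tr.P.measurable_emeasure_Pair) (simp add: pred_def)
  moreover have "emeasure tree_law {f. Q x f} = emeasure tree_law (Pair x -` {x\<in>space (M \<Otimes>\<^sub>M tree_law). Q (fst x) (snd x)})"
    if "x \<in> space M" for x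
    using that by (simp add: space_pair_measure vimage_def)
  ultimately show ?thesis
    by (subst measurable_cong) auto
qed

lemma measurable_child_sum [measurable]:
  assumes [measurable]: "g \<in> borel_measurable borel"
  shows "(\<lambda>z. child_sum z g) \<in> borel_measurable L"
  unfolding child_sum_def by measurable

lemma emeasure_forests_component:
  assumes "{w. Q w} \<in> sets tree_law"
  shows "emeasure forest_law {f. Q (f i)} = emeasure tree_law {w. Q w}"
  using fo.emeasure_PiM_Collect_single[of i "{w. Q w}"] assms by simp

text \<open>In a finite product the factor of component \<open>i\<close> can be split off;
  infinitely many siblings are reached as a limit of finite products.\<close>

lemma emeasure_forests_indep:
  assumes X: "{w. X w} \<in> sets tree_law" and Y: "\<And>j. {w. Y j w} \<in> sets tree_law"
  shows "emeasure forest_law {f. X (f i) \<and> (\<forall>j. j \<noteq> i \<longrightarrow> Y j (f j))} =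
    emeasure tree_law {w. X w} * emeasure forest_law {f. \<forall>j. j \<noteq> i \<longrightarrow> Y j (f j)}"
proof -
  define E where "E j = (if j = i then {w. X w} else {w. Y j w})" for j
  define E' where "E' j = (if j = i then UNIV else {w. Y j w})" for j
  have U: "UNIV \<in> sets tree_law" using sets.top[of tree_law] by simp
  have EE: "E j \<in> sets tree_law" "E' j \<in> sets tree_law" for j
    using X Y U by (auto simp: E_def E'_def)
  have *: "(\<Prod>j\<le>n. measure tree_law (E j)) = measure tree_law {w. X w} * (\<Prod>j\<le>n. measure tree_law (E' j))" if "i \<le> n" for n
  proof -
    have 1: "measure tree_law UNIV = 1" using tr.P.prob_space by simp
    have "(\<Prod>j\<in>{..n} - {i}. measure tree_law (E j)) = (\<Prod>j\<in>{..n} - {i}. measure tree_law (E' j))"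
      by (intro prod.cong) (auto simp: E_def E'_def)
    moreover have "(\<Prod>j\<le>n. measure tree_law (G j)) = measure tree_law (G i) * (\<Prod>j\<in>{..n} - {i}. measure tree_law (G j))" for G
      using that by (intro prod.remove) auto
    ultimately show ?thesis
      using 1 by (simp add: E_def E'_def)
  qed
  have "(\<lambda>n. \<Prod>j\<le>n. measure tree_law (E j)) \<longlonglongrightarrow> measure tree_law {w. X w} * measure forest_law (Pi UNIV E')"
  proof (rule Lim_transform_eventually)
    show "(\<lambda>n. measure tree_law {w. X w} * (\<Prod>j\<le>n. measure tree_law (E' j))) \<longlonglongrightarrow> measure tree_law {w. X w} * measure forest_law (Pi UNIV E')"
      by (intro tendsto_mult tendsto_const fo.measure_PiM_countable EE)
    show "\<forall>\<^sub>F n in sequentially. measure tree_law {w. X w} * (\<Prod>j\<le>n. measure tree_law (E' j)) = (\<Prod>j\<le>n. measure tree_law (E j))"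
      using eventually_ge_at_top[of i] by eventually_elim (simp add: *)
  qed
  then have "measure forest_law (Pi UNIV E) = measure tree_law {w. X w} * measure forest_law (Pi UNIV E')"
    by (rule LIMSEQ_unique[OF fo.measure_PiM_countable[OF EE(1)]])
  moreover have "Pi UNIV E = {f. X (f i) \<and> (\<forall>j. j \<noteq> i \<longrightarrow> Y j (f j))}" "Pi UNIV E' = {f. \<forall>j. j \<noteq> i \<longrightarrow> Y j (f j)}"
    unfolding Pi_def E_def E'_def by force+
  ultimately show ?thesis
    by (simp add: tr.P.emeasure_eq_measure fo.P.emeasure_eq_measure ennreal_mult)
qed

section \<open>Success probabilities with and without barrier\<close>

definition hit_prob :: "real \<Rightarrow> nat \<Rightarrow> ereal \<Rightarrow> real \<Rightarrow> ennreal"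
  where "hit_prob c n b t = emeasure tree_law {w. hit c n b t w}"

definition gap :: "real \<Rightarrow> nat \<Rightarrow> real \<Rightarrow> real \<Rightarrow> ennreal"
  where "gap c n b t = emeasure tree_law {w. hit c n (- \<infinity>) t w \<and> \<not> hit c n (ereal b) t w}"

definition offspring_hit :: "real \<Rightarrow> nat \<Rightarrow> real \<Rightarrow> enat \<times> (nat \<Rightarrow> real) \<Rightarrow> ennreal"
  where "offspring_hit c n t z =
    emeasure forest_law {f. \<exists>i. enat i < fst z \<and> hit c n (- \<infinity>) (t + snd z i) (f i)}"

lemma sets_hit [measurable]: "{w. hit c n b t w} \<in> sets tree_law"
proof -
  have "Measurable.pred tree_law (\<lambda>w. hit c n b t w)" by measurable
  then show ?thesis by (simp add: pred_def)
qed

lemma measurable_gap [measurable (raw)]: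
  assumes [measurable]: "b \<in> borel_measurable M" "t \<in> borel_measurable M"
  shows "(\<lambda>x. gap c n (b x) (t x)) \<in> borel_measurable M"
  unfolding gap_def by (rule measurable_emeasure_tree_law) measurable

lemma measurable_hit_prob [measurable (raw)]:
  assumes [measurable]: "b \<in> borel_measurable M" "t \<in> borel_measurable M"
  shows "(\<lambda>x. hit_prob c n (b x) (t x)) \<in> borel_measurable M"
  unfolding hit_prob_def by (rule measurable_emeasure_tree_law) measurable

lemma pred_offspring_hit:
  "Measurable.pred (L \<Otimes>\<^sub>M forest_law)
    (\<lambda>x. \<exists>i. enat i < fst (fst x) \<and> hit c n b (t + snd (fst x) i) (snd x i))"
proof -
  have [measurable]: "(\<lambda>x. fst (fst x)) \<in> measurable (L \<Otimes>\<^sub>M forest_law) (count_space UNIV)"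
    by (rule measurable_compose[OF measurable_fst measurable_fst_L])
  have [measurable]: "(\<lambda>x. snd (fst x) i) \<in> borel_measurable (L \<Otimes>\<^sub>M forest_law)" for i
    by (rule measurable_compose[OF measurable_fst measurable_snd_L])
  show ?thesis by measurable
qed

lemma measurable_offspring_hit [measurable]: "offspring_hit c n t \<in> borel_measurable L"
  unfolding offspring_hit_def by (rule measurable_emeasure_forest_law, rule pred_offspring_hit)

lemma offspring_hit_le_1: "offspring_hit c n t z \<le> 1"
  unfolding offspring_hit_def by (rule fo.P.emeasure_le_1)

lemma nn_integral_offspring_hit: "(\<integral>\<^sup>+z. offspring_hit c n t z \<partial>L) = hit_prob c (Suc n) (- \<infinity>) t"
  unfolding hit_prob_def offspring_hit_def
  by (subst emeasure_trees_eq) (simp_all only: hit_graft, simp_all, measurable)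

text \<open>A line started below \<open>b\<close> cannot respect \<open>b\<close>, so the barrier
  may be lowered to the start: either some successful line stays above \<open>t\<close>, which is
  success of the killed process, or all of them go below \<open>t\<close>.\<close>

lemma gap_below:
  assumes "t < b"
  shows "gap c n b t = hit_prob c n t t + gap c n t t"
proof -
  have "{w. hit c n (- \<infinity>) t w \<and> \<not> hit c n (ereal b) t w} =
    {w. hit c n (ereal t) t w} \<union> {w. hit c n (- \<infinity>) t w \<and> \<not> hit c n (ereal t) t w}"
    using hit_above[of c n "ereal b" t] hit_antimono[of c n "ereal t" t _ "- \<infinity>"] assms by auto
  moreover have "{w. hit c n (- \<infinity>) t w \<and> \<not> hit c n (ereal t) t w} \<in> sets tree_law"
    using sets.Diff[OF sets_hit[of c n "- \<infinity>" t] sets_hit[of c n "ereal t" t]]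
    by (simp add: set_diff_eq)
  ultimately show ?thesis
    unfolding gap_def hit_prob_def by (subst plus_emeasure) (auto)
qed

text \<open>Applied with \<open>b = t + 1\<close>, this brings the probability without any barrier
  into the recursion for gaps.\<close>

lemma gap_no_barrier:
  assumes "t < b"
  shows "gap c n b t = hit_prob c n (- \<infinity>) t"
  unfolding gap_def hit_prob_def using hit_above[of c n "ereal b" t] assms
  by (intro arg_cong[where f="emeasure tree_law"]) auto

lemma gap_le_1: "gap c n b t \<le> 1"
  unfolding gap_def by (rule tr.P.emeasure_le_1)

section \<open>Conditioning the gap on the first generation\<close>

context
  fixes c :: real and n :: nat and b t :: real
  assumes bt: "b \<le> t"
begin

abbreviation "gap_event z f \<equiv> hit c (Suc n) (- \<infinity>) t (graft z f) \<and> \<not> hit c (Suc n) (ereal b) t (graft z f)"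
abbreviation "child_gap z i f \<equiv>
  hit c n (- \<infinity>) (t + snd z i) (f i) \<and> \<not> hit c n (ereal b) (t + snd z i) (f i)"

lemma sets_forest_hit: "{f. hit c n b' s (f i)} \<in> sets forest_law"
proof -
  have "Measurable.pred forest_law (\<lambda>f. hit c n b' s (f i))" by measurable
  then show ?thesis by (simp add: pred_def)
qed

lemma gap_Suc: "gap c (Suc n) b t = (\<integral>\<^sup>+z. emeasure forest_law {f. gap_event z f} \<partial>L)"
  unfolding gap_def by (subst emeasure_trees_eq) (simp_all del: hit.simps)

lemma gap_event_iff: "gap_event z f \<longleftrightarrow>
   (\<exists>i. enat i < fst z \<and> child_gap z i f) \<and> \<not> (\<exists>i. enat i < fst z \<and> hit c n (ereal b) (t + snd z i) (f i))"
  using bt by auto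

lemma sets_child_gap: "{f. child_gap z i f} \<in> sets forest_law"
  using sets.Diff[OF sets_forest_hit[of "- \<infinity>"] sets_forest_hit[of "ereal b"]] by (simp add: set_diff_eq)

lemma emeasure_child_gap: "emeasure forest_law {f. child_gap z i f} = gap c n b (t + snd z i)"
  unfolding gap_def
  using sets.Diff[OF sets_hit[of c n "- \<infinity>"] sets_hit[of c n "ereal b"]]
  by (intro emeasure_forests_component) (simp add: set_diff_eq)

text \<open>Union bound: the child responsible for success at the parent cannot succeed within the
  barrier, since then the parent would too, so that child has a gap of its own.\<close>

lemma gap_Suc_le: "gap c (Suc n) b t \<le> (\<integral>\<^sup>+z. child_sum z (\<lambda>x. gap c n b (t + x)) \<partial>L)"
  unfolding gap_Suc
proof (intro nn_integral_mono)
  fix z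
  define E where "E i = (if enat i < fst z then {f. child_gap z i f} else {})" for i
  have "emeasure forest_law {f. gap_event z f} \<le> emeasure forest_law (\<Union>i. E i)"
    using sets_child_gap by (intro emeasure_mono) (auto simp: gap_event_iff E_def simp del: hit.simps)
  also have "\<dots> \<le> (\<Sum>i. emeasure forest_law (E i))"
    using sets_child_gap by (intro emeasure_subadditive_countably) (auto simp: E_def)
  also have "\<dots> = child_sum z (\<lambda>x. gap c n b (t + x))"
    unfolding child_sum_def E_def by (intro suminf_cong) (auto simp: emeasure_child_gap)
  finally show "emeasure forest_law {f. gap_event z f} \<le> child_sum z (\<lambda>x. gap c n b (t + x))" .
qed

lemma sets_gap_event: "{f. gap_event z f} \<in> sets forest_law"
proof -
  have "Measurable.pred forest_law (\<lambda>f. \<exists>i. enat i < fst z \<and> hit c n b' (t + snd z i) (f i))" for b'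
    by measurable
  then have *: "{f. \<exists>i. enat i < fst z \<and> hit c n b' (t + snd z i) (f i)} \<in> sets forest_law" for b'
    by (simp add: pred_def)
  have "{f. gap_event z f} = {f. \<exists>i. enat i < fst z \<and> hit c n (- \<infinity>) (t + snd z i) (f i)} -
     {f. \<exists>i. enat i < fst z \<and> hit c n (ereal b) (t + snd z i) (f i)}"
    using bt by auto
  then show ?thesis using sets.Diff[OF * *] by simp
qed

text \<open>The events that exactly one child succeeds and does so only thanks to the missing barrier
  are disjoint.\<close>

lemma gap_Suc_ge_pointwise:
  "child_sum z (\<lambda>x. if a \<le> t + x then gap c n b (t + x) else 0) \<le> emeasure forest_law {f. gap_event z f} +
    child_sum z (\<lambda>x. if a \<le> t + x then gap c n b (t + x) else 0) * offspring_hit c n t z"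
proof -
  define I where "I = {i. enat i < fst z \<and> a \<le> t + snd z i}"
  define D where "D i = gap c n b (t + snd z i)" for i
  define others where "others i = {f. \<forall>j. j \<noteq> i \<longrightarrow> \<not> (enat j < fst z \<and> hit c n (- \<infinity>) (t + snd z j) (f j))}" for i
  define G where "G i = (if i \<in> I then {f. child_gap z i f} \<inter> others i else {})" for i
  have others: "others i \<in> sets forest_law" for i
  proof -
    have "Measurable.pred forest_law (\<lambda>f. \<forall>j. j \<noteq> i \<longrightarrow> \<not> (enat j < fst z \<and> hit c n (- \<infinity>) (t + snd z j) (f j)))"
      by measurable
    then show ?thesis by (simp add: pred_def others_def)
  qed
  \<comment> \<open>The gap at child \<open>i\<close> and the failure of its siblings concern
    different subtrees and are therefore independent.\<close>
  have G: "emeasure forest_law (G i) = (if i \<in> I then D i * emeasure forest_law (others i) else 0)" for i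
  proof -
    have 1: "{w. hit c n (- \<infinity>) (t + snd z i) w \<and> \<not> hit c n (ereal b) (t + snd z i) w} \<in> sets tree_law"
      using sets.Diff[OF sets_hit[of c n "- \<infinity>"] sets_hit[of c n "ereal b"]] by (simp add: set_diff_eq)
    have "{w. \<not> (enat j < fst z \<and> hit c n (- \<infinity>) (t + snd z j) w)} \<in> sets tree_law" for j
    proof -
      have "Measurable.pred tree_law (\<lambda>w. \<not> (enat j < fst z \<and> hit c n (- \<infinity>) (t + snd z j) w))"
        by measurable
      then show ?thesis by (simp add: pred_def)
    qed
    from emeasure_forests_indep[OF 1 this, of i] show ?thesis
      unfolding G_def D_def others_def gap_def by (auto simp: Int_def)
  qed
  have disj: "disjoint_family G"
    unfolding disjoint_family_on_def G_def others_def I_def by auto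
  have Gsets: "range G \<subseteq> sets forest_law"
    using others sets_child_gap by (auto simp: G_def)
  have Gsub: "G i \<subseteq> {f. gap_event z f}" for i
  proof
    fix f assume f: "f \<in> G i"
    then have i: "enat i < fst z" "child_gap z i f" and o: "\<And>j. j \<noteq> i \<Longrightarrow> enat j < fst z \<Longrightarrow> \<not> hit c n (- \<infinity>) (t + snd z j) (f j)"
      by (auto simp: G_def I_def others_def split: if_splits)
    have "\<not> hit c n (ereal b) (t + snd z j) (f j)" if "enat j < fst z" for j
      using i(2) o[OF _ that] hit_antimono[of c n "ereal b" "t + snd z j" "f j" "- \<infinity>"] by (cases "j = i") auto
    with i show "f \<in> {f. gap_event z f}"
      unfolding gap_event_iff by blast
  qed
  \<comment> \<open>If the siblings of \<open>i\<close> do not all fail, then some child succeeds;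
    so asking for an isolated success loses at most the fraction
    \<open>offspring_hit\<close>.\<close>
  have oh: "1 \<le> emeasure forest_law (others i) + offspring_hit c n t z" for i
  proof -
    have H: "{f. \<exists>i. enat i < fst z \<and> hit c n (- \<infinity>) (t + snd z i) (f i)} \<in> sets forest_law"
    proof -
      have "Measurable.pred forest_law (\<lambda>f. \<exists>i. enat i < fst z \<and> hit c n (- \<infinity>) (t + snd z i) (f i))"
        by measurable
      then show ?thesis by (simp add: pred_def)
    qed
    have "1 = emeasure forest_law UNIV"
      using fo.P.emeasure_space_1 by simp
    also have "\<dots> \<le> emeasure forest_law (others i \<union> {f. \<exists>i. enat i < fst z \<and> hit c n (- \<infinity>) (t + snd z i) (f i)})"
      using others H by (intro emeasure_mono) (auto simp: others_def)
    also have "\<dots> \<le> emeasure forest_law (others i) + offspring_hit c n t z"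
      unfolding offspring_hit_def using others H by (intro emeasure_subadditive)
    finally show ?thesis .
  qed
  have "child_sum z (\<lambda>x. if a \<le> t + x then gap c n b (t + x) else 0) = (\<Sum>i. if i \<in> I then D i else 0)"
    unfolding child_sum_def by (intro suminf_cong) (auto simp: I_def D_def)
  also have "\<dots> \<le> (\<Sum>i. emeasure forest_law (G i) + (if i \<in> I then D i else 0) * offspring_hit c n t z)"
  proof (intro suminf_le summableI)
    fix i
    have "D i * 1 \<le> D i * (emeasure forest_law (others i) + offspring_hit c n t z)"
      by (intro mult_left_mono oh) simp
    then show "(if i \<in> I then D i else 0) \<le> emeasure forest_law (G i) + (if i \<in> I then D i else 0) * offspring_hit c n t z"
      by (simp add: G distrib_left)
  qed
  also have "\<dots> = (\<Sum>i. emeasure forest_law (G i)) + (\<Sum>i. if i \<in> I then D i else 0) * offspring_hit c n t z"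
    by (subst suminf_add[symmetric]) (auto intro!: summableI)
  also have "(\<Sum>i. emeasure forest_law (G i)) = emeasure forest_law (\<Union>i. G i)"
    by (rule suminf_emeasure[OF Gsets disj])
  also have "\<dots> \<le> emeasure forest_law {f. gap_event z f}"
    using Gsub sets_gap_event by (intro emeasure_mono) auto
  also have "(\<Sum>i. if i \<in> I then D i else 0) = child_sum z (\<lambda>x. if a \<le> t + x then gap c n b (t + x) else 0)"
    unfolding child_sum_def by (intro suminf_cong) (auto simp: I_def D_def)
  finally show ?thesis by (simp add: add_right_mono)
qed

lemma gap_Suc_ge:
  "(\<integral>\<^sup>+z. child_sum z (\<lambda>x. if a \<le> t + x then gap c n b (t + x) else 0) \<partial>L) \<le> gap c (Suc n) b t +
    (\<integral>\<^sup>+z. child_sum z (\<lambda>x. if a \<le> t + x then gap c n b (t + x) else 0) * offspring_hit c n t z \<partial>L)"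
proof -
  have "Measurable.pred (L \<Otimes>\<^sub>M forest_law) (\<lambda>x. gap_event (fst x) (snd x))"
    using pred_offspring_hit[of c n "- \<infinity>" t] pred_offspring_hit[of c n "ereal b" t] bt
    unfolding hit_graft by measurable
  then have [measurable]: "(\<lambda>z. emeasure forest_law {f. gap_event z f}) \<in> borel_measurable L"
    by (rule measurable_emeasure_forest_law)
  show ?thesis
    unfolding gap_Suc
    by (subst nn_integral_add[symmetric]) (simp, measurable, intro nn_integral_mono gap_Suc_ge_pointwise)
qed

end

end

subsection \<open>Excess over lines of descent staying above a barrier\<close>

lemma ennreal_le_add_diff: "(x::ennreal) \<le> y + (x - y)"
  by (cases "y \<le> x") (auto simp: add_diff_inverse_ennreal intro: add_increasing2)

locale branching_laws = offspring_law L + step: step_law \<mu> for L and \<mu> :: "real measure" +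
  assumes many_to_one: "f \<in> borel_measurable borel \<Longrightarrow>
    (\<integral>\<^sup>+z. child_sum z (\<lambda>x. f x * ennreal (exp (- x))) \<partial>L) = (\<integral>\<^sup>+x. f x \<partial>\<mu>)"
begin

definition excess :: "real \<Rightarrow> nat \<Rightarrow> real \<Rightarrow> real \<Rightarrow> ennreal"
  where "excess c n b t = ennreal (exp t) * gap c n b t"

definition kill_tail :: "real \<Rightarrow> nat \<Rightarrow> real \<Rightarrow> ennreal"
  where "kill_tail c n t = ennreal (exp t) * hit_prob c n (ereal t) t"

definition offspring_mass :: "enat \<times> (nat \<Rightarrow> real) \<Rightarrow> ennreal"
  where "offspring_mass z = child_sum z (\<lambda>x. ennreal (exp (- x)))"

lemma measurable_excess [measurable (raw)]:
  assumes [measurable]: "b \<in> borel_measurable M" "t \<in> borel_measurable M"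
  shows "(\<lambda>x. excess c n (b x) (t x)) \<in> borel_measurable M"
  unfolding excess_def by measurable

lemma measurable_kill_tail [measurable]: "kill_tail c n \<in> borel_measurable borel"
  unfolding kill_tail_def by measurable

lemma measurable_offspring_mass [measurable]: "offspring_mass \<in> borel_measurable L"
  unfolding offspring_mass_def by measurable

lemma nn_integral_offspring_mass: "(\<integral>\<^sup>+z. offspring_mass z \<partial>L) = 1"
  using many_to_one[of "\<lambda>_. 1"] by (simp add: offspring_mass_def)

lemma excess_below: "t < b \<Longrightarrow> excess c n b t = kill_tail c n t + excess c n t t"
  by (simp add: excess_def kill_tail_def gap_below distrib_left)

lemma excess_le_exp: "excess c n b t \<le> ennreal (exp t)"
  using mult_left_mono[OF gap_le_1, of "ennreal (exp t)"] by (simp add: excess_def)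

lemma kill_tail_le_exp: "kill_tail c n t \<le> ennreal (exp t)"
proof -
  have "kill_tail c n t \<le> excess c n (t + 1) t"
    by (simp add: excess_below)
  also note excess_le_exp
  finally show ?thesis .
qed

text \<open>The factor exp t of the parent is that of the child times exp (- x), which is exactly
  the tilt in the many-to-one formula. This is why the recursion for \<open>excess\<close> carries
  no weights.\<close>

lemma exp_gap: "ennreal (exp t) * gap c n b (t + x) = excess c n b (t + x) * ennreal (exp (- x))"
proof -
  have "ennreal (exp t) = ennreal (exp (t + x)) * ennreal (exp (- x))"
    by (simp add: ennreal_mult[symmetric] exp_add[symmetric])
  then show ?thesis
    unfolding excess_def by (simp only: mult_ac)
qed

lemma excess_0: "b \<le> t \<Longrightarrow> excess c 0 b t = 0"
  by (simp add: excess_def gap_def)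

lemma excess_Suc_le:
  assumes "b \<le> t"
  shows "excess c (Suc n) b t \<le> (\<integral>\<^sup>+x. excess c n b (t + x) \<partial>\<mu>)"
proof -
  have "excess c (Suc n) b t \<le> ennreal (exp t) * (\<integral>\<^sup>+z. child_sum z (\<lambda>x. gap c n b (t + x)) \<partial>L)"
    unfolding excess_def by (intro mult_left_mono gap_Suc_le assms) simp
  also have "\<dots> = (\<integral>\<^sup>+z. child_sum z (\<lambda>x. excess c n b (t + x) * ennreal (exp (- x))) \<partial>L)"
    by (simp add: nn_integral_cmult[symmetric] child_sum_cmult[symmetric] exp_gap)
  also have "\<dots> = (\<integral>\<^sup>+x. excess c n b (t + x) \<partial>\<mu>)"
    by (rule many_to_one) measurable
  finally show ?thesis .
qed

lemma excess_Suc_ge: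
  assumes "b \<le> t"
  shows "(\<integral>\<^sup>+x. (if a \<le> t + x then excess c n b (t + x) else 0) \<partial>\<mu>) \<le> excess c (Suc n) b t +
    (\<integral>\<^sup>+z. child_sum z (\<lambda>x. (if a \<le> t + x then excess c n b (t + x) else 0) * ennreal (exp (- x)))
       * offspring_hit c n t z \<partial>L)"
proof -
  have *: "ennreal (exp t) * (if a \<le> t + x then gap c n b (t + x) else 0) =
      (if a \<le> t + x then excess c n b (t + x) else 0) * ennreal (exp (- x))" for x
    by (simp add: exp_gap)
  have "(\<integral>\<^sup>+x. (if a \<le> t + x then excess c n b (t + x) else 0) \<partial>\<mu>) =
     (\<integral>\<^sup>+z. child_sum z (\<lambda>x. (if a \<le> t + x then excess c n b (t + x) else 0) * ennreal (exp (- x))) \<partial>L)"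
    by (rule many_to_one[symmetric]) measurable
  also have "\<dots> = ennreal (exp t) * (\<integral>\<^sup>+z. child_sum z (\<lambda>x. if a \<le> t + x then gap c n b (t + x) else 0) \<partial>L)"
    by (simp only: *[symmetric] child_sum_cmult) (rule nn_integral_cmult, measurable)
  also have "\<dots> \<le> ennreal (exp t) * (gap c (Suc n) b t +
     (\<integral>\<^sup>+z. child_sum z (\<lambda>x. if a \<le> t + x then gap c n b (t + x) else 0) * offspring_hit c n t z \<partial>L))"
    by (intro mult_left_mono gap_Suc_ge assms) simp
  also have "\<dots> = excess c (Suc n) b t + (\<integral>\<^sup>+z. ennreal (exp t) *
     (child_sum z (\<lambda>x. if a \<le> t + x then gap c n b (t + x) else 0) * offspring_hit c n t z) \<partial>L)"
    unfolding distrib_left excess_def by (subst nn_integral_cmult) simp_all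
  also have "\<dots> = excess c (Suc n) b t +
    (\<integral>\<^sup>+z. child_sum z (\<lambda>x. (if a \<le> t + x then excess c n b (t + x) else 0) * ennreal (exp (- x)))
       * offspring_hit c n t z \<partial>L)"
    by (simp only: *[symmetric] child_sum_cmult mult.assoc)
  finally show ?thesis .
qed

text \<open>Where the mass is at most exp (t/2) it is replaced by that constant; the probability of
  success is exp (- t) times an excess, which leaves the factor exp (- t/2). Where the mass is
  larger, success is bounded by 1.\<close>

lemma mass_offspring_hit_le:
  "(\<integral>\<^sup>+z. offspring_mass z * offspring_hit c n t z \<partial>L) \<le>
    (\<integral>\<^sup>+z. (if ennreal (exp (t / 2)) < offspring_mass z then offspring_mass z else 0) \<partial>L)
    + ennreal (exp (- (t / 2))) * excess c (Suc n) (t + 1) t"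
proof -
  have "(\<integral>\<^sup>+z. offspring_mass z * offspring_hit c n t z \<partial>L) \<le>
    (\<integral>\<^sup>+z. (if ennreal (exp (t / 2)) < offspring_mass z then offspring_mass z else 0)
        + ennreal (exp (t / 2)) * offspring_hit c n t z \<partial>L)"
  proof (intro nn_integral_mono)
    fix z
    show "offspring_mass z * offspring_hit c n t z \<le> (if ennreal (exp (t / 2)) < offspring_mass z then offspring_mass z else 0)
        + ennreal (exp (t / 2)) * offspring_hit c n t z"
      using mult_left_mono[OF offspring_hit_le_1, of "offspring_mass z" c n t z]
      by (auto intro: mult_right_mono add_increasing2)
  qed
  also have "\<dots> = (\<integral>\<^sup>+z. (if ennreal (exp (t / 2)) < offspring_mass z then offspring_mass z else 0) \<partial>L)
    + ennreal (exp (t / 2)) * hit_prob c (Suc n) (- \<infinity>) t"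
    by (subst nn_integral_add) (simp_all add: nn_integral_cmult nn_integral_offspring_hit)
  also have "ennreal (exp (t / 2)) * hit_prob c (Suc n) (- \<infinity>) t = ennreal (exp (- (t / 2))) * excess c (Suc n) (t + 1) t"
    unfolding excess_def
    by (subst gap_no_barrier) (simp_all add: ennreal_mult[symmetric] exp_add[symmetric] flip: mult.assoc)
  finally show ?thesis .
qed

text \<open>Crude companion of the preceding bound; it keeps the error bounded uniformly in
  \<open>n\<close>, as dominated convergence requires.\<close>

lemma mass_offspring_hit_le_1: "(\<integral>\<^sup>+z. offspring_mass z * offspring_hit c n t z \<partial>L) \<le> 1"
proof -
  have "(\<integral>\<^sup>+z. offspring_mass z * offspring_hit c n t z \<partial>L) \<le> (\<integral>\<^sup>+z. offspring_mass z * 1 \<partial>L)"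
    by (intro nn_integral_mono mult_left_mono offspring_hit_le_1) simp
  then show ?thesis by (simp add: nn_integral_offspring_mass)
qed

section \<open>Unrolling the recursion along the records\<close>

definition overshoot :: "real \<Rightarrow> real \<Rightarrow> real \<Rightarrow> nat \<Rightarrow> nat \<Rightarrow> real \<Rightarrow> ennreal"
  where "overshoot K a c n k s = (if k \<le> n \<and> a \<le> s then kill_tail c (n - k) s - ennreal K else 0)"

lemma measurable_overshoot [measurable]: "overshoot K a c n k \<in> borel_measurable borel"
  unfolding overshoot_def by measurable

text \<open>A position below the barrier is a new record: it releases one killed tail and becomes
  the new barrier.\<close>

lemma excess_eq:
  "excess c n b t = (if t < b then kill_tail c n t else 0) + excess c n (min t b) t"
  by (cases "t < b") (simp_all add: excess_below min_def)

text \<open>Below \<open>a\<close> the trivial bound exp t \<le> exp a ends the induction. Since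
  averaging over a step preserves the constant exp a, it is paid only once and not at every
  record.\<close>

lemma excess_le_record_sum:
  "excess c n b t \<le> ennreal (exp a) +
    record_sum \<mu> (<) t b (\<lambda>k s. if k \<le> n \<and> a \<le> s then kill_tail c (n - k) s else 0)"
proof (induction n arbitrary: b t)
  case 0
  show ?case
  proof (cases "t < a")
    case True
    then have "excess c 0 b t \<le> ennreal (exp a)"
      by (intro order.trans[OF excess_le_exp]) simp
    then show ?thesis by (simp add: add_increasing2)
  next
    case False
    then show ?thesis
      by (subst excess_eq, subst step.record_sum_rec) (auto simp: excess_0 add_increasing add_increasing2)
  qed
next
  case (Suc n)
  show ?case
  proof (cases "t < a")
    case True
    then have "excess c (Suc n) b t \<le> ennreal (exp a)"
      by (intro order.trans[OF excess_le_exp]) simp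
    then show ?thesis by (simp add: add_increasing2)
  next
    case False
    let ?\<psi> = "\<lambda>n k s. if k \<le> n \<and> a \<le> s then kill_tail c (n - k) s else 0"
    have "excess c (Suc n) (min t b) t \<le> (\<integral>\<^sup>+x. excess c n (min t b) (t + x) \<partial>\<mu>)"
      by (intro excess_Suc_le) simp
    also have "\<dots> \<le> (\<integral>\<^sup>+x. ennreal (exp a) + record_sum \<mu> (<) (t + x) (min t b) (?\<psi> n) \<partial>\<mu>)"
      by (intro nn_integral_mono Suc.IH)
    also have "\<dots> = ennreal (exp a) + (\<integral>\<^sup>+x. record_sum \<mu> (<) (t + x) (min t b) (?\<psi> n) \<partial>\<mu>)"
      by (subst nn_integral_add) simp_all
    finally have "excess c (Suc n) b t \<le> ennreal (exp a) + ((if t < b then kill_tail c (Suc n) t else 0) +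
        (\<integral>\<^sup>+x. record_sum \<mu> (<) (t + x) (min t b) (?\<psi> n) \<partial>\<mu>))"
      by (subst excess_eq) (simp add: add.left_commute add_left_mono)
    also have "(if t < b then kill_tail c (Suc n) t else 0) +
        (\<integral>\<^sup>+x. record_sum \<mu> (<) (t + x) (min t b) (?\<psi> n) \<partial>\<mu>) = record_sum \<mu> (<) t b (?\<psi> (Suc n))"
      using False by (subst (2) step.record_sum_rec) (simp_all cong: if_cong)
    finally show ?thesis .
  qed
qed

text \<open>Each killed tail is cut at level \<open>K\<close>: the part up to \<open>K\<close> only
  counts records, and the part above \<open>K\<close> disappears in the limit.\<close>

lemma excess_le_overshoot:
  "excess c n b t \<le> ennreal (exp a) + ennreal K * record_sum \<mu> (<) t b (\<lambda>k s. indicator {a..} s) +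
    record_sum \<mu> (<) t b (overshoot K a c n)"
proof -
  have "record_sum \<mu> (<) t b (\<lambda>k s. if k \<le> n \<and> a \<le> s then kill_tail c (n - k) s else 0) \<le>
    record_sum \<mu> (<) t b (\<lambda>k s. ennreal K * indicator {a..} s + overshoot K a c n k s)"
    by (intro step.record_sum_mono) (auto simp: overshoot_def ennreal_le_add_diff)
  also have "\<dots> = ennreal K * record_sum \<mu> (<) t b (\<lambda>k s. indicator {a..} s) +
    record_sum \<mu> (<) t b (overshoot K a c n)"
    by (subst step.record_sum_add) (simp_all add: step.record_sum_cmult)
  finally show ?thesis
    by (intro order.trans[OF excess_le_record_sum[of c n b t a]]) (simp add: add.assoc add_left_mono)
qed

lemma record_sum_eq_0:
  assumes "\<And>k s. s < b \<Longrightarrow> s \<le> t \<Longrightarrow> \<psi> k s = 0"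
  shows "record_sum \<mu> (<) t b \<psi> = 0"
proof -
  have "record_sum \<mu> (<) t b \<psi> \<le> record_sum \<mu> (<) t b (\<lambda>_ _. 0)"
    using assms by (intro step.record_sum_mono) auto
  then show ?thesis by (simp add: record_sum_def)
qed

text \<open>Each use of the recursion costs one error term at the current position; collected over
  \<open>d\<close> steps these form a Green function of the walk killed below \<open>a\<close>. At
  time \<open>j\<close> there are \<open>n - j\<close> generations left and \<open>n - 1 - j\<close>
  for the children, whence the index of \<open>err\<close>. A fixed \<open>u\<close> can bound the
  barrier throughout because the running minimum only decreases.\<close>

lemma record_sum_le_excess:
  assumes err: "\<And>n. err n \<in> borel_measurable borel"
    and err_le: "\<And>n b t. a \<le> b \<Longrightarrow> b \<le> t \<Longrightarrow> b \<le> u \<Longrightarrow>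
      (\<integral>\<^sup>+z. child_sum z (\<lambda>x. (if a \<le> t + x then excess c n b (t + x) else 0) * ennreal (exp (- x)))
        * offspring_hit c n t z \<partial>L) \<le> err n t"
    and "d \<le> n" "min t b \<le> u"
  shows "record_sum \<mu> (<) t b (\<lambda>k s. if k \<le> d \<and> a \<le> s then kill_tail c (n - k) s else 0) \<le>
    excess c n b t + killed_green \<mu> a t (\<lambda>j s. if j < d then err (n - 1 - j) s else 0)"
  using assms(3,4)
proof (induction d arbitrary: n t b)
  case 0
  have "record_sum \<mu> (<) t b (\<lambda>k s. if k \<le> 0 \<and> a \<le> s then kill_tail c (n - k) s else 0) =
    (if t < b \<and> a \<le> t then kill_tail c n t else 0)"
    by (subst step.record_sum_rec) (auto simp: record_sum_eq_0)
  also have "\<dots> \<le> excess c n b t"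
    by (subst excess_eq) (auto simp: add_increasing2)
  finally show ?case by (simp add: add_increasing2)
next
  case (Suc d n)
  then obtain n' where n: "n = Suc n'" and "d \<le> n'" by (cases n) auto
  let ?\<psi> = "\<lambda>d n k s. if k \<le> d \<and> a \<le> s then kill_tail c (n - k) s else 0"
  let ?e = "\<lambda>d n j s. if j < d then err (n - 1 - j) s else (0::ennreal)"
  let ?m = "min t b"
  show ?case
  proof (cases "a \<le> t \<and> a \<le> b")
    case False
    then have "record_sum \<mu> (<) t b (?\<psi> (Suc d) n) = 0"
      by (intro record_sum_eq_0) auto
    then show ?thesis by simp
  next
    case True
    \<comment> \<open>From a position below \<open>a\<close> all later records lie below
      \<open>a\<close> too, so the left side vanishes there. This makes the cutoff in
      \<open>excess_Suc_ge\<close> affordable.\<close>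
    have step: "record_sum \<mu> (<) (t + x) ?m (?\<psi> d n') \<le>
        (if a \<le> t + x then excess c n' ?m (t + x) else 0) + killed_green \<mu> a (t + x) (?e d n')" for x
    proof (cases "a \<le> t + x")
      case True
      then show ?thesis
        using Suc.IH[of n' "t + x" ?m] \<open>d \<le> n'\<close> Suc.prems by simp
    next
      case False
      then have "record_sum \<mu> (<) (t + x) ?m (?\<psi> d n') = 0"
        by (intro record_sum_eq_0) auto
      then show ?thesis by simp
    qed
    have [measurable]: "(\<lambda>x. killed_green \<mu> a (t + x) (?e d n')) \<in> borel_measurable \<mu>"
      using err by measurable
    have [measurable]: "(\<lambda>x. if a \<le> t + x then excess c n' ?m (t + x) else 0) \<in> borel_measurable \<mu>"
      by measurable
    have "record_sum \<mu> (<) t b (?\<psi> (Suc d) n) = (if t < b then kill_tail c n t else 0) +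
        (\<integral>\<^sup>+x. record_sum \<mu> (<) (t + x) ?m (?\<psi> d n') \<partial>\<mu>)"
      using True by (subst step.record_sum_rec) (simp_all add: n cong: if_cong)
    also have "\<dots> \<le> (if t < b then kill_tail c n t else 0) +
        (\<integral>\<^sup>+x. (if a \<le> t + x then excess c n' ?m (t + x) else 0) + killed_green \<mu> a (t + x) (?e d n') \<partial>\<mu>)"
      by (intro add_left_mono nn_integral_mono step)
    also have "\<dots> = (if t < b then kill_tail c n t else 0) +
        ((\<integral>\<^sup>+x. (if a \<le> t + x then excess c n' ?m (t + x) else 0) \<partial>\<mu>) +
        (\<integral>\<^sup>+x. killed_green \<mu> a (t + x) (?e d n') \<partial>\<mu>))"
      by (subst nn_integral_add) simp_all
    also have "\<dots> \<le> (if t < b then kill_tail c n t else 0) + ((excess c n ?m t + err n' t) +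
        (\<integral>\<^sup>+x. killed_green \<mu> a (t + x) (?e d n') \<partial>\<mu>))"
    proof (intro add_left_mono add_right_mono)
      have "(\<integral>\<^sup>+x. (if a \<le> t + x then excess c n' ?m (t + x) else 0) \<partial>\<mu>) \<le> excess c n ?m t +
        (\<integral>\<^sup>+z. child_sum z (\<lambda>x. (if a \<le> t + x then excess c n' ?m (t + x) else 0) * ennreal (exp (- x)))
        * offspring_hit c n' t z \<partial>L)"
        unfolding n by (rule excess_Suc_ge) simp
      also have "\<dots> \<le> excess c n ?m t + err n' t"
        using True Suc.prems by (intro add_left_mono err_le) auto
      finally show "(\<integral>\<^sup>+x. (if a \<le> t + x then excess c n' ?m (t + x) else 0) \<partial>\<mu>) \<le> excess c n ?m t + err n' t" .
    qed
    also have "\<dots> = excess c n b t + (err n' t + (\<integral>\<^sup>+x. killed_green \<mu> a (t + x) (?e d n') \<partial>\<mu>))"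
      by (subst (2) excess_eq) (simp add: add.assoc)
    also have "err n' t + (\<integral>\<^sup>+x. killed_green \<mu> a (t + x) (?e d n') \<partial>\<mu>) = killed_green \<mu> a t (?e (Suc d) n)"
      using True err by (subst (2) step.killed_green_rec) (simp_all add: n cong: if_cong)
    finally show ?thesis .
  qed
qed

end

lemma ennreal_le_suminf: "f i \<le> (\<Sum>i. f i)" for f :: "nat \<Rightarrow> ennreal"
  using sum_le_suminf[OF summableI, of "{i}" f] by simp

section \<open>Uniform constants and the tail of the offspring mass\<close>

locale critical_laws = branching_laws L \<mu> for L and \<mu> :: "real measure" +
  fixes U V :: real
  assumes U: "1 \<le> U" "\<And>t b u. record_sum \<mu> (<) t b (\<lambda>k s. indicator {u..u + 1} s) \<le> ennreal U"
    and V: "1 \<le> V" "\<And>s u. killed_green \<mu> s s (\<lambda>k x. indicator {u..u + 1} x) \<le> ennreal V"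
    and mass_moment: "(\<Sum>i. ennreal (2 + real i) *
      (\<integral>\<^sup>+z. (if ennreal (exp (real i / 2)) < offspring_mass z then offspring_mass z else 0) \<partial>L)) < \<infinity>"
begin

definition mass_tail :: "real \<Rightarrow> ennreal"
  where "mass_tail t = (\<integral>\<^sup>+z. (if ennreal (exp (t / 2)) < offspring_mass z then offspring_mass z else 0) \<partial>L)"

lemma mass_tail_antimono: "s \<le> t \<Longrightarrow> mass_tail t \<le> mass_tail s"
  unfolding mass_tail_def
proof (intro nn_integral_mono)
  fix z
  assume "s \<le> t"
  then have *: "ennreal (exp (s / 2)) \<le> ennreal (exp (t / 2))"
    by (intro ennreal_leI) simp
  show "(if ennreal (exp (t / 2)) < offspring_mass z then offspring_mass z else 0) \<le>
    (if ennreal (exp (s / 2)) < offspring_mass z then offspring_mass z else 0)"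
    using le_less_trans[OF *, of "offspring_mass z"] by (simp del: ennreal_le_iff)
qed

lemma measurable_mass_tail [measurable]: "mass_tail \<in> borel_measurable borel"
proof -
  have "(\<lambda>x. if ennreal (exp (fst x / 2)) < offspring_mass (snd x) then offspring_mass (snd x) else 0)
      \<in> borel_measurable (borel \<Otimes>\<^sub>M L)"
    by measurable
  then show ?thesis
    unfolding mass_tail_def[abs_def] by (intro borel_measurable_nn_integral) (simp add: case_prod_beta)
qed

lemma record_sum_indicator_le:
  "a \<le> b \<Longrightarrow> record_sum \<mu> (<) t b (\<lambda>k s. indicator {a..} s) \<le> ennreal (U * (b - a + 2))"
  using U by (intro step.record_sum_ge_le) auto

lemma record_sum_le_const:
  assumes "a \<le> b" "0 \<le> B" and w: "\<And>k s. s < b \<Longrightarrow> \<psi> k s \<le> ennreal B * indicator {a..} s"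
  shows "record_sum \<mu> (<) t b \<psi> \<le> ennreal (B * (U * (b - a + 2)))"
proof -
  have "record_sum \<mu> (<) t b \<psi> \<le> record_sum \<mu> (<) t b (\<lambda>k s. ennreal B * indicator {a..} s)"
    by (intro step.record_sum_mono w) auto
  also have "\<dots> = ennreal B * record_sum \<mu> (<) t b (\<lambda>k s. indicator {a..} s)"
    by (intro step.record_sum_cmult) auto
  also have "\<dots> \<le> ennreal B * ennreal (U * (b - a + 2))"
    by (intro mult_left_mono record_sum_indicator_le assms) simp
  finally show ?thesis
    using assms U by (simp add: ennreal_mult)
qed

lemma overshoot_le: "s < b \<Longrightarrow> overshoot K a c n k s \<le> ennreal (exp b) * indicator {a..} s"
  unfolding overshoot_def indicator_def
  by (auto intro!: order.trans[OF diff_le_self_ennreal] order.trans[OF kill_tail_le_exp] ennreal_leI)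

end

section \<open>Linear bound on the excess and the error terms\<close>

locale critical_tails = critical_laws +
  fixes c :: "nat \<Rightarrow> real" and K a0 :: real
  assumes K: "0 \<le> K" and a0: "0 \<le> a0"
    and kill_tail_upper: "\<And>s k. a0 \<le> s \<Longrightarrow> \<forall>\<^sub>F N in sequentially. kill_tail (c N) (N - k) s \<le> ennreal K"
begin

text \<open>At each fixed time and position the overshoot is eventually 0, and it never exceeds exp
  b above \<open>a0\<close>, where the mean number of records is finite.\<close>

lemma tendsto_record_sum_overshoot:
  "(\<lambda>N. record_sum \<mu> (<) t b (overshoot K a0 (c N) (N - j))) \<longlonglongrightarrow> 0"
proof (cases "a0 \<le> b")
  case True
  show ?thesis
  proof (rule step.tendsto_record_sum_0[where a=a0])
    show "(\<lambda>N. overshoot K a0 (c N) (N - j) k s) \<longlonglongrightarrow> 0" for k s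
    proof (rule tendsto_eventually)
      show "\<forall>\<^sub>F N in sequentially. overshoot K a0 (c N) (N - j) k s = 0"
      proof (cases "a0 \<le> s")
        case True
        from kill_tail_upper[OF this, of "j + k"] show ?thesis
          by eventually_elim (auto simp: overshoot_def diff_eq_0_iff_ennreal intro: le_less_trans[OF _ ennreal_less_top])
      qed (simp add: overshoot_def)
    qed
    show "record_sum \<mu> (<) t b (\<lambda>k s. indicator {a0..} s) < \<infinity>"
      using record_sum_indicator_le[OF True, of t] by (rule le_less_trans) simp
  qed (auto intro: overshoot_le)
next
  case False
  then have "record_sum \<mu> (<) t b (overshoot K a0 (c N) (N - j)) = 0" for N
    by (intro record_sum_eq_0) (simp add: overshoot_def)
  then show ?thesis by simp
qed

text \<open>Chosen so that \<open>exp a0 + K * U * (b - a0 + 2) \<le> B0 * (1 + b)\<close>; the 2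
  comes from \<open>b - a0 + 2 \<le> 2 * (1 + b)\<close> for \<open>a0, b \<ge> 0\<close>.\<close>

definition B0 :: real where "B0 = exp a0 + 2 * K * U"

lemma B0_nonneg: "0 \<le> B0"
  using K U by (simp add: B0_def)

lemma excess_le_linear:
  assumes "a0 \<le> b"
  shows "excess x n b t \<le> ennreal (B0 * (1 + b)) + record_sum \<mu> (<) t b (overshoot K a0 x n)"
proof -
  have "exp a0 + K * (U * (b - a0 + 2)) \<le> B0 * (1 + b)"
  proof -
    have "K * U * (b - a0 + 2) \<le> K * U * (2 + 2 * b)"
      using K a0 U assms by (intro mult_left_mono) auto
    moreover have "exp a0 \<le> exp a0 * (1 + b)"
      using assms a0 by simp
    ultimately show ?thesis by (simp add: B0_def algebra_simps)
  qed
  have "excess x n b t \<le> (ennreal (exp a0) + ennreal K * record_sum \<mu> (<) t b (\<lambda>k s. indicator {a0..} s)) +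
    record_sum \<mu> (<) t b (overshoot K a0 x n)"
    by (rule excess_le_overshoot)
  also have "ennreal (exp a0) + ennreal K * record_sum \<mu> (<) t b (\<lambda>k s. indicator {a0..} s) \<le>
    ennreal (exp a0) + ennreal K * ennreal (U * (b - a0 + 2))"
    by (intro add_left_mono mult_left_mono record_sum_indicator_le assms) simp
  also have "\<dots> = ennreal (exp a0 + K * (U * (b - a0 + 2)))"
    using K U assms by (simp add: ennreal_mult[symmetric])
  also have "\<dots> \<le> ennreal (B0 * (1 + b))"
    by (intro ennreal_leI) fact
  finally show ?thesis by (simp add: add_right_mono)
qed

text \<open>The linear bound on the excess of a child times the bound on the mass of a successful
  family. It depends on the position alone, so it can be summed over all times.\<close>

definition error_main :: "real \<Rightarrow> ennreal" where
  "error_main t = ennreal (B0 * (1 + t)) * (mass_tail t + ennreal (exp (- (t / 2))) * ennreal (B0 * (2 + t)))"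

text \<open>What the overshoots add to the error. The \<open>min 1\<close> keeps the first term
  bounded while the record sum inside it tends to 0.\<close>

definition error_rest :: "real \<Rightarrow> real \<Rightarrow> nat \<Rightarrow> real \<Rightarrow> ennreal" where
  "error_rest u x n t =
    ennreal (B0 * (1 + u)) * min 1 (ennreal (exp (- (t / 2))) * record_sum \<mu> (<) t (t + 1) (overshoot K a0 x (Suc n)))
    + (\<integral>\<^sup>+y. record_sum \<mu> (<) (t + y) u (overshoot K a0 x n) \<partial>\<mu>)"

lemma measurable_error_main [measurable]: "error_main \<in> borel_measurable borel"
  unfolding error_main_def[abs_def] by measurable

lemma measurable_error_rest [measurable]: "error_rest u x n \<in> borel_measurable borel"
proof -
  have "(\<lambda>p. record_sum \<mu> (<) (fst p + snd p) u (overshoot K a0 x n)) \<in> borel_measurable (borel \<Otimes>\<^sub>M \<mu>)"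
    by measurable
  then have [measurable]: "(\<lambda>t. \<integral>\<^sup>+y. record_sum \<mu> (<) (t + y) u (overshoot K a0 x n) \<partial>\<mu>) \<in> borel_measurable borel"
    by (intro step.borel_measurable_nn_integral) (simp add: case_prod_beta)
  show ?thesis
    unfolding error_rest_def[abs_def] by measurable
qed

text \<open>For the linear part of the excess the factor \<open>offspring_hit\<close> is kept and
  gives the product of mass and success. For the overshoot part that factor is bounded by 1, and the
  many-to-one formula leaves an average over one step.\<close>

lemma error_le:
  assumes "a0 \<le> a" "a \<le> b" "b \<le> t" "b \<le> u"
  shows "(\<integral>\<^sup>+z. child_sum z (\<lambda>y. (if a \<le> t + y then excess x n b (t + y) else 0) * ennreal (exp (- y)))
        * offspring_hit x n t z \<partial>L) \<le> error_main t + error_rest u x n t"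
proof -
  let ?J = "\<lambda>y. record_sum \<mu> (<) (t + y) u (overshoot K a0 x n)"
  let ?h = "offspring_hit x n t"
  have b0: "a0 \<le> b" "0 \<le> b" "0 \<le> t" "0 \<le> u" using assms a0 by auto
  have [measurable]: "(\<lambda>y. ?J y * ennreal (exp (- y))) \<in> borel_measurable borel" by measurable
  have point: "(if a \<le> t + y then excess x n b (t + y) else 0) * ennreal (exp (- y)) \<le>
      ennreal (B0 * (1 + b)) * ennreal (exp (- y)) + ?J y * ennreal (exp (- y))" for y
  proof -
    have "(if a \<le> t + y then excess x n b (t + y) else 0) \<le> ennreal (B0 * (1 + b)) + record_sum \<mu> (<) (t + y) b (overshoot K a0 x n)"
      using excess_le_linear[OF b0(1)] by auto
    also have "record_sum \<mu> (<) (t + y) b (overshoot K a0 x n) \<le> ?J y"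
      using assms unfolding record_sum_def
      by (intro suminf_le nn_integral_mono summableI) (auto simp: is_record_def)
    finally show ?thesis
      unfolding distrib_right[symmetric] by (intro mult_right_mono) (auto intro: add_left_mono)
  qed
  have "(\<integral>\<^sup>+z. child_sum z (\<lambda>y. (if a \<le> t + y then excess x n b (t + y) else 0) * ennreal (exp (- y))) * ?h z \<partial>L)
    \<le> (\<integral>\<^sup>+z. ennreal (B0 * (1 + b)) * (offspring_mass z * ?h z) + child_sum z (\<lambda>y. ?J y * ennreal (exp (- y))) \<partial>L)"
  proof (intro nn_integral_mono)
    fix z
    have "child_sum z (\<lambda>y. (if a \<le> t + y then excess x n b (t + y) else 0) * ennreal (exp (- y))) * ?h z \<le>
      (ennreal (B0 * (1 + b)) * offspring_mass z + child_sum z (\<lambda>y. ?J y * ennreal (exp (- y)))) * ?h z"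
      unfolding offspring_mass_def child_sum_cmult[symmetric] child_sum_add[symmetric]
      by (intro mult_right_mono child_sum_mono point) simp
    also have "\<dots> \<le> ennreal (B0 * (1 + b)) * (offspring_mass z * ?h z) + child_sum z (\<lambda>y. ?J y * ennreal (exp (- y))) * 1"
      unfolding distrib_right mult.assoc by (intro add_left_mono mult_left_mono offspring_hit_le_1) simp
    finally show "child_sum z (\<lambda>y. (if a \<le> t + y then excess x n b (t + y) else 0) * ennreal (exp (- y))) * ?h z \<le>
      ennreal (B0 * (1 + b)) * (offspring_mass z * ?h z) + child_sum z (\<lambda>y. ?J y * ennreal (exp (- y)))"
      by simp
  qed
  also have "\<dots> = ennreal (B0 * (1 + b)) * (\<integral>\<^sup>+z. offspring_mass z * ?h z \<partial>L) + (\<integral>\<^sup>+y. ?J y \<partial>\<mu>)"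
    by (subst nn_integral_add) (simp_all add: nn_integral_cmult many_to_one)
  also have "ennreal (B0 * (1 + b)) * (\<integral>\<^sup>+z. offspring_mass z * ?h z \<partial>L) \<le> error_main t +
    ennreal (B0 * (1 + u)) * min 1 (ennreal (exp (- (t / 2))) * record_sum \<mu> (<) t (t + 1) (overshoot K a0 x (Suc n)))"
  proof -
    let ?x = "mass_tail t + ennreal (exp (- (t / 2))) * ennreal (B0 * (2 + t))"
    let ?y = "ennreal (exp (- (t / 2))) * record_sum \<mu> (<) t (t + 1) (overshoot K a0 x (Suc n))"
    have "excess x (Suc n) (t + 1) t \<le> ennreal (B0 * (2 + t)) + record_sum \<mu> (<) t (t + 1) (overshoot K a0 x (Suc n))"
      using excess_le_linear[of "t + 1" x "Suc n" t] b0 assms by (simp add: add.commute)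
    then have "(\<integral>\<^sup>+z. offspring_mass z * ?h z \<partial>L) \<le> ?x + ?y"
      by (intro order.trans[OF mass_offspring_hit_le])
        (auto simp: mass_tail_def add.assoc distrib_left[symmetric] intro!: add_left_mono mult_left_mono)
    with mass_offspring_hit_le_1[of x n t] have "(\<integral>\<^sup>+z. offspring_mass z * ?h z \<partial>L) \<le> ?x + min 1 ?y"
      by (auto simp: min_def intro: add_increasing)
    then have "ennreal (B0 * (1 + b)) * (\<integral>\<^sup>+z. offspring_mass z * ?h z \<partial>L) \<le>
        ennreal (B0 * (1 + b)) * ?x + ennreal (B0 * (1 + b)) * min 1 ?y"
      unfolding distrib_left[symmetric] by (intro mult_left_mono) auto
    \<comment> \<open>The barrier is at most \<open>t\<close> and at most \<open>u\<close>. The main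
      term takes \<open>t\<close>, since with \<open>u = z\<close> an additional factor of order
      \<open>z\<close> would spoil the final estimate; the remainder takes \<open>u\<close>, so that
      it stays bounded along the walk.\<close>
    also have "\<dots> \<le> ennreal (B0 * (1 + t)) * ?x + ennreal (B0 * (1 + u)) * min 1 ?y"
      using B0_nonneg assms by (intro add_mono mult_right_mono ennreal_leI mult_left_mono) auto
    finally show ?thesis by (simp add: error_main_def)
  qed
  finally show ?thesis
    by (simp add: error_rest_def add.assoc add_right_mono)
qed

lemma error_rest_le:
  assumes "a0 \<le> u"
  shows "error_rest u x n t \<le> ennreal (B0 * (1 + u) + exp u * (U * (u - a0 + 2)))"
proof -
  have "(\<integral>\<^sup>+y. record_sum \<mu> (<) (t + y) u (overshoot K a0 x n) \<partial>\<mu>) \<le> (\<integral>\<^sup>+y. ennreal (exp u * (U * (u - a0 + 2))) \<partial>\<mu>)"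
    by (intro nn_integral_mono record_sum_le_const overshoot_le assms) simp_all
  moreover have "ennreal (B0 * (1 + u)) * min 1 y \<le> ennreal (B0 * (1 + u)) * 1" for y
    by (intro mult_left_mono) auto
  ultimately have "error_rest u x n t \<le> ennreal (B0 * (1 + u)) + ennreal (exp u * (U * (u - a0 + 2)))"
    unfolding error_rest_def by (intro add_mono) simp_all
  then show ?thesis
    using assms B0_nonneg U a0 by (simp add: ennreal_plus[symmetric] del: ennreal_plus)
qed

lemma tendsto_error_rest:
  assumes "a0 \<le> u"
  shows "(\<lambda>N. error_rest u (c N) (N - 1 - j) t) \<longlonglongrightarrow> 0"
proof -
  have "(\<lambda>N. record_sum \<mu> (<) t (t + 1) (overshoot K a0 (c N) (Suc (N - 1 - j)))) \<longlonglongrightarrow> 0"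
  proof (rule Lim_transform_eventually[OF tendsto_record_sum_overshoot[of t "t + 1" j]])
    show "\<forall>\<^sub>F N in sequentially. record_sum \<mu> (<) t (t + 1) (overshoot K a0 (c N) (N - j)) =
      record_sum \<mu> (<) t (t + 1) (overshoot K a0 (c N) (Suc (N - 1 - j)))"
      \<comment> \<open>Subtraction on naturals is truncated: \<open>Suc (N - 1 - j)\<close> equals
        \<open>N - j\<close> only for \<open>N > j\<close>.\<close>
      using eventually_gt_at_top[of j]
    proof eventually_elim
      case (elim N)
      then have "Suc (N - 1 - j) = N - j" by simp
      then show ?case by simp
    qed
  qed
  then have "(\<lambda>N. ennreal (exp (- (t / 2))) * record_sum \<mu> (<) t (t + 1) (overshoot K a0 (c N) (Suc (N - 1 - j)))) \<longlonglongrightarrow> ennreal (exp (- (t / 2))) * 0"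
    by (intro ennreal_tendsto_cmult) auto
  then have "(\<lambda>N. min 1 (ennreal (exp (- (t / 2))) * record_sum \<mu> (<) t (t + 1) (overshoot K a0 (c N) (Suc (N - 1 - j))))) \<longlonglongrightarrow> min 1 0"
    by (intro tendsto_min tendsto_const) simp
  then have 1: "(\<lambda>N. ennreal (B0 * (1 + u)) * min 1 (ennreal (exp (- (t / 2))) * record_sum \<mu> (<) t (t + 1) (overshoot K a0 (c N) (Suc (N - 1 - j))))) \<longlonglongrightarrow> ennreal (B0 * (1 + u)) * 0"
    by (intro ennreal_tendsto_cmult) auto
  have "(\<lambda>N. \<integral>\<^sup>+y. record_sum \<mu> (<) (t + y) u (overshoot K a0 (c N) (N - 1 - j)) \<partial>\<mu>) \<longlonglongrightarrow> (\<integral>\<^sup>+y. 0 \<partial>\<mu>)"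
  proof (rule nn_integral_dominated_convergence[where w="\<lambda>_. ennreal (exp u * (U * (u - a0 + 2)))"])
    show "AE y in \<mu>. record_sum \<mu> (<) (t + y) u (overshoot K a0 (c N) (N - 1 - j)) \<le> ennreal (exp u * (U * (u - a0 + 2)))" for N
      by (intro AE_I2 record_sum_le_const overshoot_le assms) simp_all
    show "AE y in \<mu>. (\<lambda>N. record_sum \<mu> (<) (t + y) u (overshoot K a0 (c N) (N - 1 - j))) \<longlonglongrightarrow> 0"
      using tendsto_record_sum_overshoot[of _ u "1 + j"] by simp
  qed auto
  from tendsto_add[OF 1 this] show ?thesis
    unfolding error_rest_def by simp
qed

text \<open>Dominates \<open>error_main\<close> on [i, i + 1]: decreasing factors are evaluated at
  the left end, the linear ones at the right end.\<close>

definition error_step :: "nat \<Rightarrow> ennreal" where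
  "error_step i = ennreal (B0 * (2 + real i)) * (mass_tail (real i) + ennreal (exp (- (real i / 2))) * ennreal (B0 * (3 + real i)))"

lemma error_main_le_step:
  assumes "real i \<le> s" "s \<le> real i + 1"
  shows "error_main s \<le> error_step i"
proof -
  have "ennreal (B0 * (1 + s)) \<le> ennreal (B0 * (2 + real i))" "ennreal (B0 * (2 + s)) \<le> ennreal (B0 * (3 + real i))"
    using assms B0_nonneg by (intro ennreal_leI mult_left_mono; simp)+
  moreover have "ennreal (exp (- (s / 2))) \<le> ennreal (exp (- (real i / 2)))"
    using assms by (intro ennreal_leI) simp
  ultimately show ?thesis
    unfolding error_main_def error_step_def
    by (intro mult_mono add_mono mass_tail_antimono assms) simp_all
qed

text \<open>Each unit interval is visited in the mean at most \<open>V\<close> times per record, and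
  at most \<open>U * (z + 3)\<close> records lie above \<open>m\<close>. The number of visits thus
  grows linearly in \<open>z\<close>, uniformly over the intervals.\<close>

lemma killed_green_error_main:
  assumes "real m \<le> z"
  shows "killed_green \<mu> (real m) z (\<lambda>j. error_main) \<le> ennreal (V * U * (z + 3)) * (\<Sum>i. error_step (m + i))"
proof -
  have "killed_green \<mu> (real m) z (\<lambda>j. error_main) \<le>
    killed_green \<mu> (real m) z (\<lambda>j s. \<Sum>i. error_step (m + i) * indicator {real (m + i)..real (m + i) + 1} s)"
  proof (intro step.killed_green_mono)
    fix s assume s: "real m \<le> s"
    define i where "i = nat \<lfloor>s\<rfloor> - m"
    have mi: "m + i = nat \<lfloor>s\<rfloor>"
      using s by (simp add: i_def le_nat_floor)
    have si: "real (m + i) \<le> s" "s \<le> real (m + i) + 1"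
      unfolding mi using s by (auto simp: of_nat_nat)
    have "error_main s \<le> error_step (m + i) * indicator {real (m + i)..real (m + i) + 1} s"
      using error_main_le_step[OF si] si by simp
    also have "\<dots> \<le> (\<Sum>i. error_step (m + i) * indicator {real (m + i)..real (m + i) + 1} s)"
      by (rule ennreal_le_suminf)
    finally show "error_main s \<le> (\<Sum>i. error_step (m + i) * indicator {real (m + i)..real (m + i) + 1} s)" .
  qed
  also have "\<dots> = (\<Sum>i. error_step (m + i) * killed_green \<mu> (real m) z (\<lambda>j. indicator {real (m + i)..real (m + i) + 1}))"
    by (subst step.killed_green_suminf) (simp_all add: step.killed_green_cmult)
  also have "\<dots> \<le> (\<Sum>i. error_step (m + i) * ennreal (V * U * (z + 3)))"
  proof (intro suminf_le mult_left_mono summableI)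
    fix i
    have "killed_green \<mu> (real m) z (\<lambda>j. indicator {real (m + i)..real (m + i) + 1}) \<le>
      ennreal V * record_sum \<mu> (<) z (z + 1) (\<lambda>k s. indicator {real m..} s)"
      by (intro step.killed_green_le_record_sum V)
    also have "\<dots> \<le> ennreal V * ennreal (U * (z + 1 - real m + 2))"
      using assms by (intro mult_left_mono record_sum_indicator_le) auto
    also have "\<dots> = ennreal (V * (U * (z + 1 - real m + 2)))"
      using V(1) U(1) assms by (simp add: ennreal_mult)
    also have "\<dots> \<le> ennreal (V * U * (z + 3))"
      unfolding mult.assoc using V(1) U(1) assms by (intro ennreal_leI mult_left_mono) auto
    finally show "killed_green \<mu> (real m) z (\<lambda>j. indicator {real (m + i)..real (m + i) + 1}) \<le> ennreal (V * U * (z + 3))" .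
  qed simp
  also have "\<dots> = ennreal (V * U * (z + 3)) * (\<Sum>i. error_step (m + i))"
    by (simp add: mult.commute ennreal_suminf_multc)
  finally show ?thesis .
qed

text \<open>From exp y \<ge> 1 + y both \<open>2 + i\<close> and \<open>3 + i\<close> are at most
  \<open>16 * exp (i / 16)\<close>; the product has constant 16 * 16 and exponent rate - 1/2 + 2/16
  = - 3/8.\<close>

lemma summable_exp_square: "summable (\<lambda>i. (2 + real i) * (exp (- (real i / 2)) * (3 + real i)))"
proof (rule summable_comparison_test')
  have "exp (- 3 / 8 :: real) < 1" by simp
  then show "summable (\<lambda>i. 256 * exp (- 3 / 8 :: real) ^ i)"
    by (intro summable_mult summable_geometric) simp
  fix i :: nat
  have "1 + real i / 16 \<le> exp (real i / 16)" by (rule exp_ge_add_one_self)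
  then have "2 + real i \<le> 16 * exp (real i / 16)" "3 + real i \<le> 16 * exp (real i / 16)" by linarith+
  then have "(2 + real i) * (exp (- (real i / 2)) * (3 + real i)) \<le>
      16 * exp (real i / 16) * (exp (- (real i / 2)) * (16 * exp (real i / 16)))"
    by (intro mult_mono) simp_all
  also have "\<dots> = 256 * exp (real i / 16 + (- (real i / 2) + real i / 16))"
    by (simp only: exp_add)
  also have "\<dots> = 256 * exp (- 3 / 8 :: real) ^ i"
    unfolding exp_of_nat_mult[symmetric] by (simp add: algebra_simps)
  finally show "norm ((2 + real i) * (exp (- (real i / 2)) * (3 + real i))) \<le> 256 * exp (- 3 / 8 :: real) ^ i"
    by simp
qed

lemma error_step_summable: "(\<Sum>i. error_step i) < \<infinity>"
proof -
  have "error_step i = ennreal B0 * (ennreal (2 + real i) * mass_tail (real i)) +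
     ennreal (B0 * B0) * ennreal ((2 + real i) * (exp (- (real i / 2)) * (3 + real i)))" for i
  proof -
    have "ennreal (B0 * (2 + real i)) = ennreal B0 * ennreal (2 + real i)"
      "ennreal (B0 * (3 + real i)) = ennreal B0 * ennreal (3 + real i)"
      "ennreal (B0 * B0) = ennreal B0 * ennreal B0"
      "ennreal ((2 + real i) * (exp (- (real i / 2)) * (3 + real i))) =
        ennreal (2 + real i) * (ennreal (exp (- (real i / 2))) * ennreal (3 + real i))"
      using B0_nonneg by (auto simp: ennreal_mult simp del: ennreal_plus)
    then show ?thesis
      unfolding error_step_def by (simp only: distrib_left mult_ac)
  qed
  then have "(\<Sum>i. error_step i) = ennreal B0 * (\<Sum>i. ennreal (2 + real i) * mass_tail (real i)) +
     ennreal (B0 * B0) * (\<Sum>i. ennreal ((2 + real i) * (exp (- (real i / 2)) * (3 + real i))))"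
    by (simp add: suminf_add[symmetric] summableI)
  moreover have "(\<Sum>i. ennreal ((2 + real i) * (exp (- (real i / 2)) * (3 + real i)))) \<noteq> \<top>"
    by (intro ennreal_suminf_neq_top summable_exp_square) simp
  ultimately show ?thesis
    using mass_moment by (simp add: ennreal_mult_less_top less_top mass_tail_def)
qed

lemma error_step_tail: "(\<lambda>m. \<Sum>i. error_step (m + i)) \<longlonglongrightarrow> 0"
proof -
  obtain f where f: "\<And>i. 0 \<le> f i" "\<And>i. error_step i = ennreal (f i)"
  proof -
    have "error_step i < \<infinity>" for i
      by (rule le_less_trans[OF ennreal_le_suminf error_step_summable])
    then have "error_step i = ennreal (enn2real (error_step i))" for i by simp
    then show thesis by (intro that[of "\<lambda>i. enn2real (error_step i)"]) auto
  qed
  have sf: "summable f"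
  proof (rule summable_suminf_not_top[OF f(1)])
    have "(\<lambda>i. ennreal (f i)) = error_step" using f(2) by auto
    then show "(\<Sum>i. ennreal (f i)) \<noteq> \<top>"
      using error_step_summable by simp
  qed
  have "(\<lambda>m. \<Sum>i. f (i + m)) \<longlonglongrightarrow> 0"
    by (rule suminf_exist_split2[OF sf])
  moreover have "(\<Sum>i. error_step (m + i)) = ennreal (\<Sum>i. f (i + m))" for m
    using sf f(1) unfolding f(2) by (simp add: add.commute[of m] suminf_ennreal2 summable_ignore_initial_segment)
  ultimately show ?thesis
    using tendsto_ennrealI[of "\<lambda>m. \<Sum>i. f (i + m)" 0 sequentially] by simp
qed

end

section \<open>Asymptotic bounds for the excess\<close>

lemma (in step_law) record_sum_truncate:
  assumes fin: "record_sum \<mu> r t b \<psi> < \<infinity>" and "0 < \<delta>"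
  shows "\<exists>d. record_sum \<mu> r t b \<psi> \<le> record_sum \<mu> r t b (\<lambda>k s. if k \<le> d then \<psi> k s else 0) + \<delta>"
proof -
  define F where "F k = (\<integral>\<^sup>+\<omega>. (if is_record r t b k \<omega> then \<psi> k (t + partial_sum k \<omega>) else 0) \<partial>paths)" for k
  have J: "record_sum \<mu> r t b \<psi> = (\<Sum>k. F k)"
    by (simp add: record_sum_def F_def[abs_def])
  have "(\<lambda>n. (\<Sum>k<n. F k) + \<delta>) \<longlonglongrightarrow> (\<Sum>k. F k) + \<delta>"
    by (intro tendsto_add tendsto_const summable_LIMSEQ summableI)
  moreover have "(\<Sum>k. F k) < (\<Sum>k. F k) + \<delta>"
    using fin assms(2) unfolding J by (simp add: less_top)
  ultimately have "\<forall>\<^sub>F n in sequentially. (\<Sum>k. F k) < (\<Sum>k<n. F k) + \<delta>"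
    by (rule order_tendstoD)
  then obtain n where n: "(\<Sum>k. F k) < (\<Sum>k<n. F k) + \<delta>"
    by (auto simp: eventually_sequentially)
  have "(\<Sum>k. F k) \<le> (\<Sum>k\<in>{..n}. F k) + \<delta>"
    using n by (intro order.trans[OF less_imp_le[OF n]] add_right_mono sum_mono2) auto
  also have "(\<Sum>k\<in>{..n}. F k) = (\<Sum>k. if k \<le> n then F k else 0)"
    by (subst suminf_finite[of "{..n}"]) auto
  also have "\<dots> = record_sum \<mu> r t b (\<lambda>k s. if k \<le> n then \<psi> k s else 0)"
    unfolding record_sum_def F_def by (intro suminf_cong) (simp cong: if_cong)
  finally show ?thesis unfolding J by blast
qed

context critical_tails
begin

lemma excess_upper:
  assumes "0 < \<delta>"
  shows "\<forall>\<^sub>F N in sequentially. excess (c N) N b t \<le> ennreal (exp a0) +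
    ennreal K * record_sum \<mu> (<) t b (\<lambda>k s. indicator {a0..} s) + ennreal \<delta>"
proof -
  have "\<forall>\<^sub>F N in sequentially. record_sum \<mu> (<) t b (overshoot K a0 (c N) (N - 0)) < ennreal \<delta>"
    using assms by (intro order_tendstoD[OF tendsto_record_sum_overshoot]) simp
  then show ?thesis
  proof eventually_elim
    case (elim N)
    then show ?case
      by (intro order.trans[OF excess_le_overshoot[of _ _ _ _ a0 K]] add_left_mono) simp
  qed
qed

text \<open>Only finitely many times are kept, because the killed tails are controlled for fixed
  delay only. Three errors of size \<open>\<delta> / 3\<close> arise: the discarded records, the
  deficit \<open>under\<close> of the killed tails below \<open>K'\<close>, and the remainders
  \<open>error_rest\<close>.\<close>

lemma excess_lower:
  assumes m: "a0 \<le> real m" "real m \<le> z" and "0 < \<delta>" "0 \<le> K'"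
    and lower: "\<And>s k. real m \<le> s \<Longrightarrow> \<forall>\<^sub>F N in sequentially. ennreal K' \<le> kill_tail (c N) (N - k) s"
  shows "\<forall>\<^sub>F N in sequentially. ennreal K' * record_sum \<mu> (<) z (z + 1) (\<lambda>k s. indicator {real m..} s) \<le>
    excess (c N) N (z + 1) z + ennreal (V * U * (z + 3)) * (\<Sum>i. error_step (m + i)) + ennreal \<delta>"
proof -
  let ?a = "real m"
  let ?J = "record_sum \<mu> (<) z (z + 1)"
  define \<delta>' where "\<delta>' = \<delta> / 3"
  have \<delta>': "0 < \<delta>'" using \<open>0 < \<delta>\<close> by (simp add: \<delta>'_def)
  have finJ: "?J (\<lambda>k s. indicator {?a..} s) < \<infinity>"
    using record_sum_indicator_le[of ?a "z + 1" z] m by (auto elim!: le_less_trans)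
  \<comment> \<open>The loss is multiplied by \<open>K'\<close> below; dividing by
    \<open>K' + 1\<close> compensates for this and also covers \<open>K' = 0\<close>.\<close>
  obtain d where d: "?J (\<lambda>k s. indicator {?a..} s) \<le>
      ?J (\<lambda>k s. if k \<le> d then indicator {?a..} s else 0) + ennreal (\<delta>' / (K' + 1))"
    using step.record_sum_truncate[OF finJ, of "ennreal (\<delta>' / (K' + 1))"] \<delta>' \<open>0 \<le> K'\<close> by auto
  define under where "under N k s = (if k \<le> d \<and> ?a \<le> s then ennreal K' - kill_tail (c N) (N - k) s else 0)" for N k s
  have [measurable]: "under N k \<in> borel_measurable borel" for N k
    unfolding under_def[abs_def] by measurable
  have "(\<lambda>N. ?J (under N)) \<longlonglongrightarrow> 0"
  proof (rule step.tendsto_record_sum_0[where a="?a" and B=K'])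
    show "(\<lambda>N. under N k s) \<longlonglongrightarrow> 0" for k s
    proof (rule tendsto_eventually)
      show "\<forall>\<^sub>F N in sequentially. under N k s = 0"
      proof (cases "?a \<le> s")
        case True
        from lower[OF this, of k] show ?thesis
          by eventually_elim (auto simp: under_def diff_eq_0_iff_ennreal)
      qed (simp add: under_def)
    qed
    show "under N k s \<le> ennreal K' * indicator {?a..} s" for N k s
      by (auto simp: under_def diff_le_self_ennreal)
  qed (use finJ in auto)
  then have ev1: "\<forall>\<^sub>F N in sequentially. ?J (under N) < ennreal \<delta>'"
    using \<delta>' by (intro order_tendstoD) auto
  define rest where "rest N k s = error_rest z (c N) (N - 1 - k) s" for N k s
  have [measurable]: "rest N k \<in> borel_measurable borel" for N k
    unfolding rest_def[abs_def] by measurable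
  have "(\<lambda>N. killed_green \<mu> ?a z (\<lambda>k s. if k < d then rest N k s else 0)) \<longlonglongrightarrow> 0"
  proof (rule step.tendsto_killed_green_0[where B="B0 * (1 + z) + exp z * (U * (z - a0 + 2))"])
    show "(\<lambda>N. rest N k s) \<longlonglongrightarrow> 0" for k s
      unfolding rest_def using m by (intro tendsto_error_rest) auto
    show "rest N k s \<le> ennreal (B0 * (1 + z) + exp z * (U * (z - a0 + 2)))" for N k s
      unfolding rest_def using m by (intro error_rest_le) auto
  qed simp
  then have ev2: "\<forall>\<^sub>F N in sequentially. killed_green \<mu> ?a z (\<lambda>k s. if k < d then rest N k s else 0) < ennreal \<delta>'"
    using \<delta>' by (intro order_tendstoD) auto
  show ?thesis
    using ev1 ev2 eventually_ge_at_top[of d]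
  proof eventually_elim
    case (elim N)
    let ?\<psi> = "\<lambda>k s. if k \<le> d \<and> ?a \<le> s then kill_tail (c N) (N - k) s else 0"
    have "?J ?\<psi> \<le> excess (c N) N (z + 1) z +
      killed_green \<mu> ?a z (\<lambda>j s. if j < d then error_main s + error_rest z (c N) (N - 1 - j) s else 0)"
    \<comment> \<open>\<open>u = z\<close> is admissible because \<open>min z (z + 1) = z\<close>:
      after the start the barrier never exceeds \<open>z\<close>.\<close>
    proof (rule record_sum_le_excess[where u=z and err="\<lambda>n s. error_main s + error_rest z (c N) n s"])
      show "(\<lambda>s. error_main s + error_rest z (c N) n s) \<in> borel_measurable borel" for n
        by measurable
    qed (use m elim in \<open>auto intro!: error_le\<close>)
    also have "killed_green \<mu> ?a z (\<lambda>j s. if j < d then error_main s + error_rest z (c N) (N - 1 - j) s else 0)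
      \<le> killed_green \<mu> ?a z (\<lambda>j s. error_main s + (if j < d then rest N j s else 0))"
      by (intro step.killed_green_mono) (auto simp: rest_def)
    also have "\<dots> = killed_green \<mu> ?a z (\<lambda>j. error_main) + killed_green \<mu> ?a z (\<lambda>j s. if j < d then rest N j s else 0)"
      by (intro step.killed_green_add) simp_all
    also have "\<dots> \<le> ennreal (V * U * (z + 3)) * (\<Sum>i. error_step (m + i)) + ennreal \<delta>'"
      using elim m by (intro add_mono killed_green_error_main) auto
    finally have 1: "?J ?\<psi> \<le> excess (c N) N (z + 1) z + (ennreal (V * U * (z + 3)) * (\<Sum>i. error_step (m + i)) + ennreal \<delta>')"
      by (simp add: add_left_mono)
    have "ennreal K' * ?J (\<lambda>k s. if k \<le> d then indicator {?a..} s else 0) =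
        ?J (\<lambda>k s. ennreal K' * (if k \<le> d then indicator {?a..} s else 0))"
      by (subst step.record_sum_cmult) simp_all
    also have "\<dots> \<le> ?J (\<lambda>k s. ?\<psi> k s + under N k s)"
      by (intro step.record_sum_mono) (auto simp: under_def ennreal_le_add_diff)
    also have "\<dots> = ?J ?\<psi> + ?J (under N)"
      by (intro step.record_sum_add) simp_all
    also have "\<dots> \<le> (excess (c N) N (z + 1) z + (ennreal (V * U * (z + 3)) * (\<Sum>i. error_step (m + i)) + ennreal \<delta>')) + ennreal \<delta>'"
      using elim 1 by (intro add_mono) auto
    finally have 2: "ennreal K' * ?J (\<lambda>k s. if k \<le> d then indicator {?a..} s else 0) \<le> \<dots>" .
    have "ennreal K' * ?J (\<lambda>k s. indicator {?a..} s) \<le>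
      ennreal K' * (?J (\<lambda>k s. if k \<le> d then indicator {?a..} s else 0) + ennreal (\<delta>' / (K' + 1)))"
      by (intro mult_left_mono d) simp
    also have "\<dots> \<le> ennreal K' * ?J (\<lambda>k s. if k \<le> d then indicator {?a..} s else 0) + ennreal \<delta>'"
    proof -
      have "K' * (\<delta>' / (K' + 1)) \<le> \<delta>'"
        using \<delta>' \<open>0 \<le> K'\<close> by (simp add: field_simps)
      then show ?thesis
        unfolding distrib_left using \<open>0 \<le> K'\<close> \<delta>'
        by (intro add_left_mono) (simp add: ennreal_mult[symmetric])
    qed
    also have "\<dots> \<le> ((excess (c N) N (z + 1) z + (ennreal (V * U * (z + 3)) * (\<Sum>i. error_step (m + i)) + ennreal \<delta>')) + ennreal \<delta>') + ennreal \<delta>'"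
      by (intro add_right_mono 2)
    also have "\<dots> = excess (c N) N (z + 1) z + ennreal (V * U * (z + 3)) * (\<Sum>i. error_step (m + i)) + (ennreal \<delta>' + ennreal \<delta>' + ennreal \<delta>')"
      by (simp only: add.assoc)
    also have "ennreal \<delta>' + ennreal \<delta>' + ennreal \<delta>' = ennreal \<delta>"
      using \<delta>' by (simp add: ennreal_plus[symmetric] \<delta>'_def del: ennreal_plus)
    finally show ?case .
  qed
qed

end

subsection \<open>Transfer to the branching random walk\<close>

lemma Cons_in_generation:
  "i # x \<in> generation N (Suc n) \<omega> \<longleftrightarrow> enat i < N [] \<omega> \<and> x \<in> generation (\<lambda>v. N (i # v)) n \<omega>"
  unfolding generation_def tree_def by (auto simp: all_less_Suc_shift)

lemma generation_0: "generation N 0 \<omega> = {[]}"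
  by (auto simp: generation_def tree_def)

lemma length_generation: "x \<in> generation N n \<omega> \<Longrightarrow> length x = n"
  by (simp add: generation_def)

lemma position_Nil [simp]: "position A [] \<omega> = 0"
  by (simp add: position_def)

lemma position_Cons: "position A (i # x) \<omega> = A [] i \<omega> + position (\<lambda>v. A (i # v)) x \<omega>"
  unfolding position_def by (simp add: sum.lessThan_Suc_shift del: sum.lessThan_Suc)

lemma hit_offspring_iff:
  "hit c n b t (\<lambda>v. offspring N A v \<omega>) \<longleftrightarrow> (\<exists>x\<in>generation N n \<omega>.
    (\<forall>k\<le>n. b \<le> ereal (t + position A (take k x) \<omega>)) \<and> t + position A x \<omega> < c)"
proof (induction n arbitrary: N A t)
  case 0
  show ?case by (simp add: generation_0)
next
  case (Suc n)
  have key: "(\<forall>k\<le>Suc n. b \<le> ereal (t + position A (take k (i # x)) \<omega>)) \<longleftrightarrow>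
    b \<le> ereal t \<and> (\<forall>k\<le>n. b \<le> ereal (t + (A [] i \<omega> + position (\<lambda>v. A (i # v)) (take k x) \<omega>)))" for i x
    unfolding less_Suc_eq_le[symmetric] by (subst all_less_Suc_shift) (simp add: position_Cons)
  have "hit c (Suc n) b t (\<lambda>v. offspring N A v \<omega>) \<longleftrightarrow> b \<le> ereal t \<and> (\<exists>i. enat i < N [] \<omega> \<and>
     hit c n b (t + A [] i \<omega>) (\<lambda>v. offspring (\<lambda>v. N (i # v)) (\<lambda>v. A (i # v)) v \<omega>))"
    by (simp add: offspring_def)
  also have "\<dots> \<longleftrightarrow> b \<le> ereal t \<and> (\<exists>i. enat i < N [] \<omega> \<and> (\<exists>x\<in>generation (\<lambda>v. N (i # v)) n \<omega>.
      (\<forall>k\<le>n. b \<le> ereal (t + A [] i \<omega> + position (\<lambda>v. A (i # v)) (take k x) \<omega>))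
      \<and> t + A [] i \<omega> + position (\<lambda>v. A (i # v)) x \<omega> < c))"
    unfolding Suc.IH ..
  also have "\<dots> \<longleftrightarrow> (\<exists>i x. i # x \<in> generation N (Suc n) \<omega> \<and>
     (\<forall>k\<le>Suc n. b \<le> ereal (t + position A (take k (i # x)) \<omega>)) \<and> t + position A (i # x) \<omega> < c)"
    unfolding key Cons_in_generation position_Cons add.assoc by blast
  also have "\<dots> \<longleftrightarrow> (\<exists>x\<in>generation N (Suc n) \<omega>.
    (\<forall>k\<le>Suc n. b \<le> ereal (t + position A (take k x) \<omega>)) \<and> t + position A x \<omega> < c)"
    (is "_ \<longleftrightarrow> (\<exists>x\<in>_. ?Q x)")
  proof
    assume "\<exists>x\<in>generation N (Suc n) \<omega>. ?Q x"
    then obtain x where x: "x \<in> generation N (Suc n) \<omega>" "?Q x" by blast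
    moreover obtain i y where "x = i # y"
      using length_generation[OF x(1)] by (cases x) auto
    ultimately show "\<exists>i y. i # y \<in> generation N (Suc n) \<omega> \<and> ?Q (i # y)" by blast
  qed blast
  finally show ?case .
qed

text \<open>An infimum lies strictly below a level exactly when some member does, attained or not.
  Starting at \<open>t\<close> with target \<open>c\<close> replaces the level
  \<open>c - t\<close>.\<close>

lemma min_position_less_iff:
  "min_position N A n \<omega> < ereal (c - t) \<longleftrightarrow> hit c n (- \<infinity>) t (\<lambda>v. offspring N A v \<omega>)"
  unfolding hit_offspring_iff min_position_def INF_less_iff by (auto simp: less_diff_eq add.commute)

lemma min_position_kill_less_iff:
  "min_position_kill N A n \<omega> < ereal (c - t) \<longleftrightarrow> hit c n (ereal t) t (\<lambda>v. offspring N A v \<omega>)"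
  unfolding hit_offspring_iff min_position_kill_def INF_less_iff by (auto simp: less_diff_eq add.commute)

section \<open>Sums over the first generation as series\<close>

lemma infsum_generation_1:
  "(\<Sum>\<^sub>\<infinity>x\<in>generation N 1 \<omega>. g (position A x \<omega>)) = (\<Sum>\<^sub>\<infinity>i\<in>{i. enat i < N [] \<omega>}. g (A [] i \<omega>))"
proof -
  have "generation N 1 \<omega> = (\<lambda>i. [i]) ` {i. enat i < N [] \<omega>}"
  proof (intro set_eqI iffI)
    fix x assume x: "x \<in> generation N 1 \<omega>"
    then obtain i where "x = [i]"
      using length_generation[OF x] by (auto simp: length_Suc_conv)
    with x show "x \<in> (\<lambda>i. [i]) ` {i. enat i < N [] \<omega>}"
      using Cons_in_generation[of i "[]" N 0 \<omega>] by auto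
  next
    fix x assume "x \<in> (\<lambda>i. [i]) ` {i. enat i < N [] \<omega>}"
    then show "x \<in> generation N 1 \<omega>"
      using Cons_in_generation[of _ "[]" N 0 \<omega>] by (auto simp: generation_0)
  qed
  then show ?thesis
    by (simp add: infsum_reindex inj_on_def o_def position_Cons)
qed

lemma infsum_ennreal_eq_suminf:
  fixes g :: "nat \<Rightarrow> ennreal"
  shows "(\<Sum>\<^sub>\<infinity>i\<in>{i. Q i}. g i) = (\<Sum>i. if Q i then g i else 0)"
proof -
  have "(\<Sum>\<^sub>\<infinity>i\<in>{i. Q i}. g i) = (\<Sum>\<^sub>\<infinity>i\<in>UNIV. if Q i then g i else 0)"
    by (rule infsum_cong_neutral) auto
  also have "\<dots> = (\<Sum>i. if Q i then g i else 0)"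
    by (intro sums_unique has_sum_imp_sums has_sum_infsum nonneg_summable_on_complete) simp
  finally show ?thesis .
qed

text \<open>Unconditional summability of reals is absolute, and \<open>infsum\<close> defaults to 0
  without it. The explicit case distinction by a series in \<open>ennreal\<close> makes the sum
  visibly measurable in the random point.\<close>

lemma infsum_real_eq_suminf:
  fixes g :: "nat \<Rightarrow> real"
  shows "(\<Sum>\<^sub>\<infinity>i\<in>{i. Q i}. g i) =
    (if (\<Sum>i. if Q i then ennreal \<bar>g i\<bar> else 0) < \<infinity> then (\<Sum>i. if Q i then g i else 0) else 0)"
proof -
  define h where "h i = (if Q i then g i else 0)" for i
  have 1: "(\<Sum>\<^sub>\<infinity>i\<in>{i. Q i}. g i) = (\<Sum>\<^sub>\<infinity>i\<in>UNIV. h i)"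
    by (rule infsum_cong_neutral) (auto simp: h_def)
  have 2: "(\<Sum>i. if Q i then ennreal \<bar>g i\<bar> else 0) = (\<Sum>i. ennreal \<bar>h i\<bar>)"
    by (intro suminf_cong) (auto simp: h_def)
  have 3: "(\<Sum>i. if Q i then g i else 0) = (\<Sum>i. h i)"
    by (simp add: h_def)
  show ?thesis
  proof (cases "(\<Sum>i. ennreal \<bar>h i\<bar>) < \<infinity>")
    case True
    then have "summable (\<lambda>i. \<bar>h i\<bar>)"
      by (intro summable_suminf_not_top) auto
    then have "(h has_sum (\<Sum>i. h i)) UNIV"
      using norm_summable_imp_has_sum[of h] summable_sums[OF summable_rabs_cancel, of h] by simp
    then have "(\<Sum>\<^sub>\<infinity>i\<in>UNIV. h i) = (\<Sum>i. h i)"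
      by (rule infsumI)
    with True show ?thesis
      by (simp only: 1 2 3 if_True)
  next
    case False
    have "\<not> h summable_on UNIV"
    proof
      assume "h summable_on UNIV"
      then have "(\<lambda>i. \<bar>h i\<bar>) summable_on UNIV"
        by (rule summable_on_iff_abs_summable_on_real[THEN iffD1, unfolded real_norm_def])
      then have "summable (\<lambda>i. \<bar>h i\<bar>)"
        by (rule summable_on_imp_summable)
      then have "(\<Sum>i. ennreal \<bar>h i\<bar>) \<noteq> \<top>"
        by (intro ennreal_suminf_neq_top) auto
      then show False using False by (simp add: less_top)
    qed
    then show ?thesis
      using False by (simp only: 1 2 3 if_False) (rule infsum_not_exists)
  qed
qed

lemma space_offspring_space [simp]: "space offspring_space = UNIV"
  by (simp add: offspring_space_def space_pair_measure space_PiM)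

section \<open>Laws of the family of offspring and of the associated walk\<close>

context branching_random_walk
begin

abbreviation "root_law \<equiv> distr P offspring_space (offspring N A [])"

lemma measurable_offspring [measurable]: "offspring N A u \<in> measurable P offspring_space"
  using offspring_indep unfolding indep_vars_def by blast

lemma measurable_N [measurable]: "N u \<in> measurable P (count_space UNIV)"
proof -
  have "(\<lambda>\<omega>. fst (offspring N A u \<omega>)) \<in> measurable P (count_space UNIV)"
    by (rule measurable_compose[OF measurable_offspring]) (simp add: offspring_space_def)
  then show ?thesis by (simp add: offspring_def)
qed

lemma measurable_A [measurable]: "A u i \<in> borel_measurable P"
proof -
  have "(\<lambda>\<omega>. snd (offspring N A u \<omega>) i) \<in> borel_measurable P"
    by (rule measurable_compose[OF measurable_offspring]) (simp add: offspring_space_def)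
  then show ?thesis by (simp add: offspring_def)
qed

sublocale root: offspring_law root_law
  unfolding offspring_law_def offspring_law_axioms_def by (auto intro: prob_space_distr)

lemma distr_tree: "distr P (\<Pi>\<^sub>M u\<in>(UNIV::nat list set). offspring_space) (\<lambda>\<omega> u. offspring N A u \<omega>) = root.tree_law"
proof -
  have "distr P (\<Pi>\<^sub>M u\<in>(UNIV::nat list set). offspring_space) (\<lambda>\<omega>. \<lambda>u\<in>UNIV. offspring N A u \<omega>) =
      (\<Pi>\<^sub>M u\<in>UNIV. distr P offspring_space (offspring N A u))"
    by (rule indep_vars_iff_distr_eq_PiM[THEN iffD1, OF _ _ offspring_indep]) simp_all
  also have "(\<Pi>\<^sub>M u\<in>(UNIV::nat list set). distr P offspring_space (offspring N A u)) = root.tree_law"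
    by (intro PiM_cong refl offspring_ident)
  finally show ?thesis by (simp add: restrict_UNIV)
qed

lemma measurable_offspring_family [measurable]:
  "(\<lambda>\<omega> u. offspring N A u \<omega>) \<in> measurable P (\<Pi>\<^sub>M u\<in>(UNIV::nat list set). offspring_space)"
  by (rule measurable_PiM_single') simp_all

lemma sets_hit_offspring: "{w. hit c n b t w} \<in> sets (\<Pi>\<^sub>M u\<in>(UNIV::nat list set). offspring_space)"
  using root.sets_hit[of c n b t] by (simp cong: sets_PiM_cong)

lemma measure_hit:
  "measure P {\<omega> \<in> space P. hit c n b t (\<lambda>v. offspring N A v \<omega>)} = measure root.tree_law {w. hit c n b t w}"
  unfolding distr_tree[symmetric] using sets_hit_offspring
  by (subst measure_distr) (auto intro!: arg_cong[where f="measure P"])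

lemma sets_min_position_kill: "{\<omega> \<in> space P. min_position_kill N A n \<omega> < ereal (c - t)} \<in> sets P"
  using measurable_sets[OF measurable_offspring_family sets_hit_offspring[of c n "ereal t" t]]
  unfolding min_position_kill_less_iff by (simp add: vimage_def Int_def conj_commute)

lemma measure_min_position:
  "ennreal (measure P {\<omega> \<in> space P. min_position N A n \<omega> < ereal (c - t)}) = root.hit_prob c n (- \<infinity>) t"
  unfolding min_position_less_iff measure_hit root.hit_prob_def by (simp add: root.tr.P.emeasure_eq_measure)

lemma measure_min_position_kill:
  "ennreal (measure P {\<omega> \<in> space P. min_position_kill N A n \<omega> < ereal (c - t)}) = root.hit_prob c n (ereal t) t"
  unfolding min_position_kill_less_iff measure_hit root.hit_prob_def by (simp add: root.tr.P.emeasure_eq_measure)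

lemma infsum_generation_1_eq_child_sum:
  fixes g :: "real \<Rightarrow> ennreal"
  shows "(\<Sum>\<^sub>\<infinity>x\<in>generation N 1 \<omega>. g (position A x \<omega>)) = child_sum (offspring N A [] \<omega>) g"
  unfolding infsum_generation_1[where g=g] infsum_ennreal_eq_suminf child_sum_def offspring_def by (simp cong: if_cong)

lemma nn_integral_root_law:
  "f \<in> borel_measurable offspring_space \<Longrightarrow> (\<integral>\<^sup>+z. f z \<partial>root_law) = (\<integral>\<^sup>+\<omega>. f (offspring N A [] \<omega>) \<partial>P)"
  by (subst nn_integral_distr) simp_all

end

context associated_random_walk
begin

abbreviation "walk_law \<equiv> distr Q borel (\<xi> 0)"

lemma measurable_step [measurable]: "\<xi> i \<in> borel_measurable Q"
  using steps_indep unfolding Q.indep_vars_def by blast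

lemma child_sum_measurable:
  "g \<in> borel_measurable borel \<Longrightarrow> (\<lambda>z. child_sum z g) \<in> borel_measurable offspring_space"
  using brw.root.measurable_child_sum[of g] by (simp only: measurable_distr_eq1)

text \<open>The right side of \<open>steps_law\<close> does not mention \<open>i\<close>; applied to
  indicators it determines the law of the step.\<close>

lemma distr_step: "distr Q borel (\<xi> i) = walk_law"
proof (rule measure_eqI)
  fix B assume B: "B \<in> sets (distr Q borel (\<xi> i))"
  then have "emeasure (distr Q borel (\<xi> j)) B = (\<integral>\<^sup>+\<omega>. indicator B (\<xi> j \<omega>) \<partial>Q)" for j
    by (subst nn_integral_indicator[symmetric], simp, subst nn_integral_distr) simp_all
  moreover have "(\<integral>\<^sup>+\<omega>. indicator B (\<xi> i \<omega>) \<partial>Q) = (\<integral>\<^sup>+\<omega>. indicator B (\<xi> 0 \<omega>) \<partial>Q)"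
    using B by (subst (1 2) steps_law) simp_all
  ultimately show "emeasure (distr Q borel (\<xi> i)) B = emeasure walk_law B" by simp
qed simp

lemma many_to_one:
  assumes [measurable]: "f \<in> borel_measurable borel"
  shows "(\<integral>\<^sup>+z. child_sum z (\<lambda>x. f x * ennreal (exp (- x))) \<partial>brw.root_law) = (\<integral>\<^sup>+x. f x \<partial>walk_law)"
proof -
  have "(\<integral>\<^sup>+z. child_sum z (\<lambda>x. f x * ennreal (exp (- x))) \<partial>brw.root_law) =
    (\<integral>\<^sup>+\<omega>. child_sum (offspring N A [] \<omega>) (\<lambda>x. f x * ennreal (exp (- x))) \<partial>P)"
    by (intro brw.nn_integral_root_law child_sum_measurable) measurable
  also have "\<dots> = (\<integral>\<^sup>+\<omega>. f (\<xi> 0 \<omega>) \<partial>Q)"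
    by (simp add: steps_law brw.infsum_generation_1_eq_child_sum[symmetric])
  also have "\<dots> = (\<integral>\<^sup>+x. f x \<partial>walk_law)"
    by (subst nn_integral_distr) simp_all
  finally show ?thesis .
qed

lemma step_law_walk_law: "step_law walk_law"
  unfolding step_law_def step_law_axioms_def by (auto intro: Q.prob_space_distr)

sublocale laws: branching_laws brw.root_law walk_law
  by (intro branching_laws.intro branching_laws_axioms.intro brw.root.offspring_law_axioms
      step_law_walk_law many_to_one)

lemma distr_walk: "distr Q (\<Pi>\<^sub>M i\<in>(UNIV::nat set). borel) (\<lambda>\<omega> i. \<xi> i \<omega>) = laws.step.paths"
proof -
  have "distr Q (\<Pi>\<^sub>M i\<in>(UNIV::nat set). borel) (\<lambda>\<omega>. \<lambda>i\<in>UNIV. \<xi> i \<omega>) = (\<Pi>\<^sub>M i\<in>UNIV. distr Q borel (\<xi> i))"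
    by (rule Q.indep_vars_iff_distr_eq_PiM[THEN iffD1, OF _ _ steps_indep]) simp_all
  also have "(\<Pi>\<^sub>M i\<in>(UNIV::nat set). distr Q borel (\<xi> i)) = laws.step.paths"
    by (intro PiM_cong refl distr_step)
  finally show ?thesis by (simp add: restrict_UNIV)
qed

text \<open>Shifting the start from \<open>z\<close> to 0 turns the level \<open>a\<close> into
  \<open>- (z - a)\<close>. The condition \<open>a < z\<close> selects the series branch of
  \<open>renewal_fun\<close>, and finiteness makes that real series agree with the sum in
  \<open>ennreal\<close>.\<close>

lemma record_sum_eq_renewal_fun:
  assumes "a < z" and fin: "record_sum walk_law (<) z (z + 1) (\<lambda>k s. indicator {a..} s) < \<infinity>"
  shows "record_sum walk_law (<) z (z + 1) (\<lambda>k s. indicator {a..} s) = ennreal (renewal_fun Q \<xi> (z - a))"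
    and "0 \<le> renewal_fun Q \<xi> (z - a)"
proof -
  define p where "p k = measure Q {\<omega> \<in> space Q. walk \<xi> k \<omega> \<ge> - (z - a) \<and> (\<forall>j<k. walk \<xi> k \<omega> < walk \<xi> j \<omega>)}" for k
  have term_eq: "(\<integral>\<^sup>+\<omega>. (if is_record (<) z (z + 1) k \<omega> then indicator {a..} (z + partial_sum k \<omega>) else 0) \<partial>laws.step.paths)
    = ennreal (p k)" for k
  proof -
    let ?f = "\<lambda>\<omega>. (if is_record (<) z (z + 1) k \<omega> then indicator {a..} (z + partial_sum k \<omega>) else 0) :: ennreal"
    have [measurable]: "(\<lambda>\<omega> i. \<xi> i \<omega>) \<in> measurable Q (\<Pi>\<^sub>M i\<in>(UNIV::nat set). borel)"
      by (rule measurable_PiM_single') simp_all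
    have "?f \<in> borel_measurable laws.step.paths"
      by (rule laws.step.measurable_record_integrand[where \<psi>="\<lambda>k s. indicator {a..} s"]) simp_all
    moreover have "sets laws.step.paths = sets (\<Pi>\<^sub>M i\<in>(UNIV::nat set). borel)"
      by (intro sets_PiM_cong) simp_all
    ultimately have f: "?f \<in> borel_measurable (\<Pi>\<^sub>M i\<in>(UNIV::nat set). borel)"
      by (simp cong: measurable_cong_sets)
    have "(\<integral>\<^sup>+\<omega>. ?f \<omega> \<partial>laws.step.paths) = (\<integral>\<^sup>+\<omega>. ?f (\<lambda>i. \<xi> i \<omega>) \<partial>Q)"
      unfolding distr_walk[symmetric] by (subst nn_integral_distr) (use f in simp_all)
    also have "\<dots> = (\<integral>\<^sup>+\<omega>. indicator {\<omega> \<in> space Q. walk \<xi> k \<omega> \<ge> - (z - a) \<and> (\<forall>j<k. walk \<xi> k \<omega> < walk \<xi> j \<omega>)} \<omega> \<partial>Q)"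
    proof (intro nn_integral_cong)
      fix \<omega> assume \<omega>: "\<omega> \<in> space Q"
      have ps: "partial_sum j (\<lambda>i. \<xi> i \<omega>) = walk \<xi> j \<omega>" for j
        by (simp add: partial_sum_def walk_def)
      \<comment> \<open>Every record is at most 0, hence below the initial barrier
        \<open>z + 1\<close> after the shift.\<close>
      have "walk \<xi> k \<omega> < 1" if "\<forall>j<k. walk \<xi> k \<omega> < walk \<xi> j \<omega>"
        using that[rule_format, of 0] by (cases "k = 0") (auto simp: walk_def)
      then show "?f (\<lambda>i. \<xi> i \<omega>) = indicator {\<omega> \<in> space Q. walk \<xi> k \<omega> \<ge> - (z - a) \<and> (\<forall>j<k. walk \<xi> k \<omega> < walk \<xi> j \<omega>)} \<omega>"
        using \<omega> by (auto simp: is_record_def ps indicator_def)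
    qed
    also have "\<dots> = ennreal (p k)"
      unfolding p_def walk_def by (subst nn_integral_indicator) (simp_all add: Q.emeasure_eq_measure)
    finally show ?thesis .
  qed
  have eq: "record_sum walk_law (<) z (z + 1) (\<lambda>k s. indicator {a..} s) = (\<Sum>k. ennreal (p k))"
    unfolding record_sum_def term_eq ..
  have p0: "0 \<le> p k" for k by (simp add: p_def)
  have "summable p"
    using fin unfolding eq by (intro summable_suminf_not_top p0) auto
  then have "(\<Sum>k. ennreal (p k)) = ennreal (\<Sum>k. p k)" "0 \<le> (\<Sum>k. p k)"
    by (auto intro: suminf_ennreal2 suminf_nonneg p0)
  then show "record_sum walk_law (<) z (z + 1) (\<lambda>k s. indicator {a..} s) = ennreal (renewal_fun Q \<xi> (z - a))"
      "0 \<le> renewal_fun Q \<xi> (z - a)"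
    using assms(1) unfolding eq by (simp_all add: renewal_fun_def p_def)
qed

end

section \<open>Consequences of the moment and non-lattice assumptions\<close>

lemma ennreal_suminf_eq:
  fixes g :: "nat \<Rightarrow> real"
  assumes "\<And>i. 0 \<le> g i" "(\<Sum>i. ennreal (g i)) < \<infinity>"
  shows "ennreal (\<Sum>i. g i) = (\<Sum>i. ennreal (g i))"
  using assms by (intro suminf_ennreal2[symmetric] summable_suminf_not_top) auto

text \<open>Only indices \<open>i < 2 * ln X\<close> contribute. There are at most 2 ln X + 1 of
  them and each has weight at most 2 + 2 ln X, so the squared logarithm is one power from the count
  and one from the weight.\<close>

lemma sum_exp_threshold_le:
  fixes X :: real
  assumes "0 \<le> X"
  shows "(\<Sum>i<n. (2 + real i) * (if exp (real i / 2) < X then X else 0)) \<le> 8 * (X * (ln_plus X)\<^sup>2) + 8 * X"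
proof (cases "1 < X")
  case False
  have "\<not> exp (real i / 2) < X" for i
    using False one_le_exp_iff[of "real i / 2"] by linarith
  then show ?thesis using assms by simp
next
  case True
  define l where "l = ln X"
  have l: "0 < l" "ln_plus X = l" using True by (auto simp: l_def ln_plus_def)
  define m where "m = nat \<lceil>2 * l\<rceil>"
  have m: "real m \<le> 2 * l + 1" using l by (simp add: m_def)
  have im: "real i < 2 * l \<and> i < m" if "exp (real i / 2) < X" for i
  proof -
    have "real i / 2 < l"
      using that True unfolding l_def by (metis exp_gt_zero ln_exp ln_less_cancel_iff order.strict_trans)
    then show ?thesis by (simp add: m_def) linarith
  qed
  have "(\<Sum>i<n. (2 + real i) * (if exp (real i / 2) < X then X else 0)) \<le> (\<Sum>i<n. if i < m then (2 + 2 * l) * X else 0)"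
    using im True l by (intro sum_mono) (auto intro!: mult_right_mono simp: less_imp_le)
  also have "\<dots> \<le> (\<Sum>i<m. (2 + 2 * l) * X)"
  proof -
    have "(\<Sum>i<n. if i < m then (2 + 2 * l) * X else 0) = (\<Sum>i\<in>{..<n} \<inter> {..<m}. (2 + 2 * l) * X)"
      by (subst sum.inter_restrict) simp_all
    also have "\<dots> \<le> (\<Sum>i<m. (2 + 2 * l) * X)"
      using True l by (intro sum_mono2) auto
    finally show ?thesis .
  qed
  also have "\<dots> = real m * ((2 + 2 * l) * X)" by simp
  also have "\<dots> \<le> (2 * l + 1) * ((2 + 2 * l) * X)"
    using m True l by (intro mult_right_mono) auto
  also have "\<dots> = (4 * l\<^sup>2 + 6 * l + 2) * X"
    by (simp add: power2_eq_square algebra_simps)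
  also have "\<dots> \<le> (8 * l\<^sup>2 + 8) * X"
  proof (intro mult_right_mono)
    have "0 \<le> (l - 1)\<^sup>2" by simp
    then have "2 * l \<le> l\<^sup>2 + 1" by (simp add: power2_eq_square algebra_simps)
    then show "4 * l\<^sup>2 + 6 * l + 2 \<le> 8 * l\<^sup>2 + 8" using zero_le_power2[of l] by linarith
  qed (use True in simp)
  finally show ?thesis by (simp add: l algebra_simps)
qed

context associated_random_walk
begin

lemma measurable_child_sum_offspring:
  assumes "g \<in> borel_measurable borel"
  shows "(\<lambda>\<omega>. child_sum (offspring N A [] \<omega>) g) \<in> borel_measurable P"
  by (rule measurable_compose[OF brw.measurable_offspring child_sum_measurable[OF assms]])

lemma expectation_child_sum:
  assumes [measurable]: "f \<in> borel_measurable borel"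
  shows "(\<integral>\<^sup>+\<omega>. child_sum (offspring N A [] \<omega>) (\<lambda>x. f x * ennreal (exp (- x))) \<partial>P) = (\<integral>\<^sup>+x. f x \<partial>walk_law)"
  unfolding many_to_one[OF assms, symmetric]
  by (intro brw.nn_integral_root_law[symmetric] child_sum_measurable) measurable

lemma child_sum_eq_0_iff:
  "child_sum z g = 0 \<longleftrightarrow> (\<forall>i. enat i < fst z \<longrightarrow> g (snd z i) = 0)"
proof -
  have "child_sum z g = 0 \<longleftrightarrow> (\<forall>i. (if enat i < fst z then g (snd z i) else 0) = 0)"
    unfolding child_sum_def by (intro suminf_eq_zero_iff summableI) simp
  then show ?thesis by auto
qed

text \<open>By the many-to-one formula the mean of the sum of exp (- x) over the children in
  \<open>B\<close> is 0, and every term of that sum is positive.\<close>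

lemma AE_children:
  assumes B: "B \<in> sets borel" "emeasure walk_law B = 0"
  shows "AE \<omega> in P. \<forall>i. enat i < N [] \<omega> \<longrightarrow> A [] i \<omega> \<notin> B"
proof -
  have "(\<integral>\<^sup>+\<omega>. child_sum (offspring N A [] \<omega>) (\<lambda>x. indicator B x * ennreal (exp (- x))) \<partial>P) = 0"
    using B by (subst expectation_child_sum) simp_all
  then have "AE \<omega> in P. child_sum (offspring N A [] \<omega>) (\<lambda>x. indicator B x * ennreal (exp (- x))) = 0"
    using B by (subst (asm) nn_integral_0_iff_AE) (auto intro!: measurable_child_sum_offspring)
  then show ?thesis
    by eventually_elim (auto simp: child_sum_eq_0_iff offspring_def indicator_def ennreal_eq_0_iff split: if_splits)
qed

lemma child_sum_offspring_real:
  assumes "\<And>x. 0 \<le> g x"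
  shows "child_sum (offspring N A [] \<omega>) (\<lambda>x. ennreal (g x)) = (\<Sum>i. ennreal (if enat i < N [] \<omega> then g (A [] i \<omega>) else 0))"
  unfolding child_sum_def offspring_def by (intro suminf_cong) simp

text \<open>A mean of one forces almost sure finiteness; the extended sum then agrees with the real
  \<open>infsum\<close>, which would otherwise default to 0.\<close>

lemma offspring_mass_finite:
  assumes crit: "critical_branching_random_walk P N A"
  shows "AE \<omega> in P. laws.offspring_mass (offspring N A [] \<omega>) = ennreal (\<Sum>\<^sub>\<infinity>x\<in>generation N 1 \<omega>. exp (- position A x \<omega>))"
proof -
  have "(\<integral>\<^sup>+\<omega>. laws.offspring_mass (offspring N A [] \<omega>) \<partial>P) = 1"
    using critical_branching_random_walk.mass_one[OF crit]
    unfolding laws.offspring_mass_def brw.infsum_generation_1_eq_child_sum[where g="\<lambda>x. ennreal (exp (- x))"] .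
  then have "AE \<omega> in P. laws.offspring_mass (offspring N A [] \<omega>) \<noteq> \<infinity>"
    unfolding laws.offspring_mass_def
    by (intro nn_integral_PInf_AE measurable_child_sum_offspring) simp_all
  then show ?thesis
  proof eventually_elim
    case (elim \<omega>)
    define h where "h i = (if enat i < N [] \<omega> then exp (- A [] i \<omega>) else 0)" for i
    have h0: "0 \<le> h i" for i by (simp add: h_def)
    have mass: "laws.offspring_mass (offspring N A [] \<omega>) = (\<Sum>i. ennreal (h i))"
      unfolding laws.offspring_mass_def h_def by (rule child_sum_offspring_real) simp
    have abs: "(\<Sum>i. if enat i < N [] \<omega> then ennreal \<bar>exp (- A [] i \<omega>)\<bar> else 0) = (\<Sum>i. ennreal (h i))"
      by (intro suminf_cong) (simp add: h_def)
    have fin: "(\<Sum>i. ennreal (h i)) < \<infinity>"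
      using elim unfolding mass by (simp add: less_top)
    have "(\<Sum>\<^sub>\<infinity>x\<in>generation N 1 \<omega>. exp (- position A x \<omega>)) = (\<Sum>i. h i)"
      unfolding infsum_generation_1[where g="\<lambda>x. exp (- x)"] infsum_real_eq_suminf abs
      using fin by (simp add: h_def)
    then show ?case
      unfolding mass using ennreal_suminf_eq[OF h0 fin] by simp
  qed
qed

lemma mass_moment:
  assumes crit: "critical_branching_random_walk P N A"
  shows "(\<Sum>i. ennreal (2 + real i) * (\<integral>\<^sup>+z. (if ennreal (exp (real i / 2)) < laws.offspring_mass z
    then laws.offspring_mass z else 0) \<partial>brw.root_law)) < \<infinity>"
proof -
  define X where "X \<omega> = (\<Sum>\<^sub>\<infinity>x\<in>generation N 1 \<omega>. exp (- position A x \<omega>))" for \<omega>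
  have X0: "0 \<le> X \<omega>" for \<omega> unfolding X_def by (intro infsum_nonneg) simp
  let ?m = "\<lambda>\<omega>. laws.offspring_mass (offspring N A [] \<omega>)"
  have m_meas[measurable]: "?m \<in> borel_measurable P"
    unfolding laws.offspring_mass_def by (rule measurable_child_sum_offspring) simp
  have mass_meas: "laws.offspring_mass \<in> borel_measurable offspring_space"
    using laws.measurable_offspring_mass by (simp only: measurable_distr_eq1)
  have int: "integrable P (\<lambda>\<omega>. X \<omega> * (ln_plus (X \<omega>))\<^sup>2)"
    using critical_branching_random_walk.X_integrable[OF crit] by (simp add: X_def Let_def)
  have "(\<Sum>i. ennreal (2 + real i) * (\<integral>\<^sup>+z. (if ennreal (exp (real i / 2)) < laws.offspring_mass z
      then laws.offspring_mass z else 0) \<partial>brw.root_law))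
    = (\<Sum>i. \<integral>\<^sup>+\<omega>. ennreal (2 + real i) * (if ennreal (exp (real i / 2)) < ?m \<omega> then ?m \<omega> else 0) \<partial>P)"
    using mass_meas by (subst brw.nn_integral_root_law) (simp_all add: nn_integral_cmult[symmetric] del: ennreal_plus)
  also have "\<dots> = (\<integral>\<^sup>+\<omega>. (\<Sum>i. ennreal (2 + real i) * (if ennreal (exp (real i / 2)) < ?m \<omega> then ?m \<omega> else 0)) \<partial>P)"
    by (rule nn_integral_suminf[symmetric]) measurable
  also have "\<dots> \<le> (\<integral>\<^sup>+\<omega>. ennreal 8 * ennreal (X \<omega> * (ln_plus (X \<omega>))\<^sup>2) + ennreal 8 * ?m \<omega> \<partial>P)"
  proof (rule nn_integral_mono_AE, use offspring_mass_finite[OF crit] in eventually_elim)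
    fix \<omega> assume m: "?m \<omega> = ennreal (\<Sum>\<^sub>\<infinity>x\<in>generation N 1 \<omega>. exp (- position A x \<omega>))"
    then have m: "?m \<omega> = ennreal (X \<omega>)" by (simp add: X_def)
    have "(\<Sum>i<n. ennreal (2 + real i) * (if ennreal (exp (real i / 2)) < ?m \<omega> then ?m \<omega> else 0))
      \<le> ennreal 8 * ennreal (X \<omega> * (ln_plus (X \<omega>))\<^sup>2) + ennreal 8 * ?m \<omega>" for n
    proof -
      have "(\<Sum>i<n. ennreal (2 + real i) * (if ennreal (exp (real i / 2)) < ?m \<omega> then ?m \<omega> else 0))
        = (\<Sum>i<n. ennreal ((2 + real i) * (if exp (real i / 2) < X \<omega> then X \<omega> else 0)))"
        using X0 unfolding m by (intro sum.cong refl) (simp add: ennreal_mult ennreal_less_iff del: ennreal_plus)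
      also have "\<dots> = ennreal (\<Sum>i<n. (2 + real i) * (if exp (real i / 2) < X \<omega> then X \<omega> else 0))"
        using X0 by (intro sum_ennreal) simp
      also have "\<dots> \<le> ennreal (8 * (X \<omega> * (ln_plus (X \<omega>))\<^sup>2) + 8 * X \<omega>)"
        by (intro ennreal_leI sum_exp_threshold_le X0)
      also have "\<dots> = ennreal 8 * ennreal (X \<omega> * (ln_plus (X \<omega>))\<^sup>2) + ennreal 8 * ?m \<omega>"
        unfolding m using X0[of \<omega>] by (subst ennreal_plus) (auto simp: ennreal_mult)
      finally show ?thesis .
    qed
    then show "(\<Sum>i. ennreal (2 + real i) * (if ennreal (exp (real i / 2)) < ?m \<omega> then ?m \<omega> else 0))
      \<le> ennreal 8 * ennreal (X \<omega> * (ln_plus (X \<omega>))\<^sup>2) + ennreal 8 * ?m \<omega>"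
      by (intro suminf_le_const summableI)
  qed
  also have "\<dots> = ennreal 8 * (\<integral>\<^sup>+\<omega>. ennreal (X \<omega> * (ln_plus (X \<omega>))\<^sup>2) \<partial>P) + ennreal 8 * (\<integral>\<^sup>+\<omega>. ?m \<omega> \<partial>P)"
    using int by (subst nn_integral_add) (auto simp: nn_integral_cmult)
  also have "(\<integral>\<^sup>+\<omega>. ?m \<omega> \<partial>P) = 1"
    using brw.nn_integral_root_law[OF mass_meas] laws.nn_integral_offspring_mass by simp
  also have "(\<integral>\<^sup>+\<omega>. ennreal (X \<omega> * (ln_plus (X \<omega>))\<^sup>2) \<partial>P) = ennreal (\<integral>\<omega>. X \<omega> * (ln_plus (X \<omega>))\<^sup>2 \<partial>P)"
    using int X0 by (intro nn_integral_eq_integral) auto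
  finally show ?thesis
    by (rule le_less_trans) (simp add: ennreal_mult_less_top)
qed

lemma nn_integral_abs_step_finite:
  assumes crit: "critical_branching_random_walk P N A"
  shows "(\<integral>\<^sup>+x. ennreal \<bar>x\<bar> \<partial>walk_law) < \<infinity>"
proof -
  have "(\<integral>\<^sup>+x. ennreal \<bar>x\<bar> \<partial>walk_law) \<le> (\<integral>\<^sup>+x. 1 + ennreal (x\<^sup>2) \<partial>walk_law)"
  proof (intro nn_integral_mono)
    fix x :: real
    have "0 \<le> (\<bar>x\<bar> - 1)\<^sup>2" by simp
    then have "2 * \<bar>x\<bar> \<le> 1 + x\<^sup>2" by (simp add: power2_eq_square algebra_simps)
    then have "\<bar>x\<bar> \<le> 1 + x\<^sup>2" by linarith
    then have "ennreal \<bar>x\<bar> \<le> ennreal (1 + x\<^sup>2)" by (rule ennreal_leI)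
    then show "ennreal \<bar>x\<bar> \<le> 1 + ennreal (x\<^sup>2)" by simp
  qed
  also have "\<dots> = 1 + (\<integral>\<^sup>+x. ennreal (x\<^sup>2) \<partial>walk_law)"
    by (subst nn_integral_add) (simp_all add: laws.step.emeasure_mu_UNIV)
  also have "(\<integral>\<^sup>+x. ennreal (x\<^sup>2) \<partial>walk_law) < \<infinity>"
  proof -
    have "(\<integral>\<^sup>+\<omega>. child_sum (offspring N A [] \<omega>) (\<lambda>x. ennreal (x\<^sup>2 * exp (- x))) \<partial>P) < \<infinity>"
      using critical_branching_random_walk.second_moment[OF crit]
      unfolding brw.infsum_generation_1_eq_child_sum[where g="\<lambda>x. ennreal (x\<^sup>2 * exp (- x))"] .
    moreover have "(\<lambda>x. ennreal (x\<^sup>2 * exp (- x))) = (\<lambda>x. ennreal (x\<^sup>2) * ennreal (exp (- x)))"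
      by (simp add: ennreal_mult)
    ultimately show ?thesis
      using expectation_child_sum[of "\<lambda>x. ennreal (x\<^sup>2)"] by simp
  qed
  finally show ?thesis by simp
qed

text \<open>A centred step law that charges only one closed half-line is the point mass at \<open>0\<close>,
  which is excluded by the non-lattice assumption.\<close>

lemma step_sign:
  assumes crit: "critical_branching_random_walk P N A" and \<sigma>: "\<sigma> \<in> {1, -1 :: real}"
  shows "emeasure walk_law {x. \<sigma> * x < 0} \<noteq> 0"
proof
  assume null: "emeasure walk_law {x. \<sigma> * x < 0} = 0"
  have sign: "AE \<omega> in P. \<forall>i. enat i < N [] \<omega> \<longrightarrow> A [] i \<omega> \<notin> {x. \<sigma> * x < 0}"
    by (rule AE_children[OF _ null]) measurable
  \<comment> \<open>\<open>Y\<close> sums absolute values. Under the one-sided hypothesis it equals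
    \<open>\<sigma>\<close> times the signed sum \<open>Z\<close> almost surely, so the vanishing
    mean of \<open>Z\<close> forces the mean of \<open>Y\<close>, which is the first absolute moment
    of a step, to be 0.\<close>
  define Y where "Y \<omega> = child_sum (offspring N A [] \<omega>) (\<lambda>x. ennreal \<bar>x * exp (- x)\<bar>)" for \<omega>
  have Y_meas [measurable]: "Y \<in> borel_measurable P"
    unfolding Y_def[abs_def] by (rule measurable_child_sum_offspring) measurable
  have Y_int: "(\<integral>\<^sup>+\<omega>. Y \<omega> \<partial>P) = (\<integral>\<^sup>+x. ennreal \<bar>x\<bar> \<partial>walk_law)"
    unfolding Y_def using expectation_child_sum[of "\<lambda>x. ennreal \<bar>x\<bar>"] by (simp add: abs_mult ennreal_mult)
  have fin: "AE \<omega> in P. Y \<omega> \<noteq> \<infinity>"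
    using nn_integral_abs_step_finite[OF crit] by (intro nn_integral_PInf_AE) (auto simp: Y_int)
  define Z where "Z \<omega> = (\<Sum>\<^sub>\<infinity>x\<in>generation N 1 \<omega>. position A x \<omega> * exp (- position A x \<omega>))" for \<omega>
  have Y_eq: "(\<Sum>i. if enat i < N [] \<omega> then ennreal \<bar>A [] i \<omega> * exp (- A [] i \<omega>)\<bar> else 0) = Y \<omega>" for \<omega>
    unfolding Y_def child_sum_def offspring_def by (intro suminf_cong) simp
  have Z_eq: "Z \<omega> = (if Y \<omega> < \<infinity> then (\<Sum>i. if enat i < N [] \<omega> then A [] i \<omega> * exp (- A [] i \<omega>) else 0) else 0)" for \<omega>
    unfolding Z_def infsum_generation_1[where g="\<lambda>x. x * exp (- x)"] infsum_real_eq_suminf Y_eq ..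
  have Z_meas [measurable]: "Z \<in> borel_measurable P"
    unfolding Z_eq[abs_def] by measurable
  have YZ: "AE \<omega> in P. 0 \<le> \<sigma> * Z \<omega> \<and> ennreal (\<sigma> * Z \<omega>) = Y \<omega>"
    using sign fin
  proof eventually_elim
    case (elim \<omega>)
    define h where "h i = (if enat i < N [] \<omega> then A [] i \<omega> * exp (- A [] i \<omega>) else 0)" for i
    have h0: "0 \<le> \<sigma> * h i" and habs: "\<sigma> * h i = \<bar>h i\<bar>" for i
    proof -
      have "0 \<le> (\<sigma> * A [] i \<omega>) * exp (- A [] i \<omega>)" if "enat i < N [] \<omega>"
      proof (rule mult_nonneg_nonneg)
        show "0 \<le> \<sigma> * A [] i \<omega>" using elim(1) that by (auto simp: not_less)
      qed simp
      then show "0 \<le> \<sigma> * h i" by (simp add: h_def mult.assoc)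
      then show "\<sigma> * h i = \<bar>h i\<bar>" using \<sigma> by auto
    qed
    have Yh: "Y \<omega> = (\<Sum>i. ennreal (\<sigma> * h i))"
      unfolding Y_eq[symmetric] habs by (intro suminf_cong) (simp add: h_def)
    have "(\<Sum>i. ennreal (\<sigma> * h i)) < \<infinity>" using elim(2) unfolding Yh by (simp add: less_top)
    note s = ennreal_suminf_eq[OF h0 this]
    have "summable (\<lambda>i. \<sigma> * h i)"
      using \<open>(\<Sum>i. ennreal (\<sigma> * h i)) < \<infinity>\<close> by (intro summable_suminf_not_top h0) auto
    moreover have "(\<Sum>i. \<sigma> * h i) = \<sigma> * (\<Sum>i. h i)"
      using \<sigma> calculation by (auto simp: suminf_minus summable_minus_iff)
    moreover have "Z \<omega> = (\<Sum>i. h i)"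
      unfolding Z_eq h_def using elim(2) by (simp add: less_top)
    moreover have "0 \<le> (\<Sum>i. \<sigma> * h i)"
      using calculation(1) h0 by (intro suminf_nonneg)
    ultimately show ?case
      using s unfolding Yh by simp
  qed
  have "(\<integral>\<^sup>+\<omega>. ennreal (\<sigma> * Z \<omega>) \<partial>P) = (\<integral>\<^sup>+\<omega>. Y \<omega> \<partial>P)"
    by (rule nn_integral_cong_AE, use YZ in eventually_elim) simp
  moreover have "integrable P (\<lambda>\<omega>. \<sigma> * Z \<omega>)"
    using YZ calculation nn_integral_abs_step_finite[OF crit] by (intro integrableI_nonneg) (auto simp: Y_int)
  moreover have "(\<integral>\<omega>. \<sigma> * Z \<omega> \<partial>P) = 0"
    using critical_branching_random_walk.mean_zero[OF crit] by (simp add: Z_def)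
  ultimately have "(\<integral>\<^sup>+\<omega>. Y \<omega> \<partial>P) = 0"
    using YZ by (subst (asm) nn_integral_eq_integral) auto
  then have "(\<integral>\<^sup>+x. ennreal \<bar>x\<bar> \<partial>walk_law) = 0"
    by (simp add: Y_int)
  then have "AE x in walk_law. x \<notin> {x. x \<noteq> 0}"
    by (subst (asm) nn_integral_0_iff_AE) (auto simp: ennreal_eq_0_iff)
  then have "emeasure walk_law {x. x \<noteq> 0} = 0"
    by (subst (asm) AE_iff_measurable[of "{x. x \<noteq> 0}"]) auto
  from AE_children[OF _ this] have "AE \<omega> in P. \<forall>i. enat i < N [] \<omega> \<longrightarrow> A [] i \<omega> = 0"
    by simp
  \<comment> \<open>Children all located at 0 lie on the lattice with \<open>b = 0\<close> and
    \<open>h = 1\<close>.\<close>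
  then have "AE \<omega> in P. \<forall>x\<in>generation N 1 \<omega>. \<exists>k::int. position A x \<omega> = 0 + 1 * of_int k"
  proof eventually_elim
    case (elim \<omega>)
    show ?case
    proof
      fix x assume x: "x \<in> generation N 1 \<omega>"
      then obtain i where i: "x = [i]"
        using length_generation[OF x] by (auto simp: length_Suc_conv)
      with x have "enat i < N [] \<omega>"
        using Cons_in_generation[of i "[]" N 0 \<omega>] by simp
      with elim have "position A x \<omega> = 0 + 1 * of_int 0"
        by (simp add: i position_Cons)
      then show "\<exists>k::int. position A x \<omega> = 0 + 1 * of_int k" by blast
    qed
  qed
  then show False
    using critical_branching_random_walk.non_lattice[OF crit] zero_less_one by blast
qed

end

section \<open>Iterated upper limits and shifts of the horizon\<close>

lemma eventually_less_of_Limsup_eq_0: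
  fixes g :: "real \<Rightarrow> nat \<Rightarrow> real"
  assumes "Limsup at_top (\<lambda>z::real. limsup (\<lambda>n::nat. ereal (g z n))) = 0" "0 < \<epsilon>"
  shows "\<forall>\<^sub>F z in at_top. \<forall>\<^sub>F n in sequentially. g z n < \<epsilon>"
proof -
  have "\<forall>\<^sub>F z in at_top. limsup (\<lambda>n. ereal (g z n)) < ereal \<epsilon>"
    using assms by (intro Limsup_lessD) simp
  then show ?thesis
  proof eventually_elim
    case (elim z)
    then have "\<forall>\<^sub>F n in sequentially. ereal (g z n) < ereal \<epsilon>"
      by (rule Limsup_lessD)
    then show ?case by simp
  qed
qed

lemma Limsup_eq_0_of_eventually_le:
  fixes g :: "real \<Rightarrow> nat \<Rightarrow> real"
  assumes nonneg: "\<And>z n. 0 \<le> g z n"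
    and le: "\<And>\<epsilon>. 0 < \<epsilon> \<Longrightarrow> \<forall>\<^sub>F z in at_top. \<forall>\<^sub>F n in sequentially. g z n \<le> \<epsilon>"
  shows "Limsup at_top (\<lambda>z::real. limsup (\<lambda>n::nat. ereal (g z n))) = 0"
proof (rule antisym)
  show "Limsup at_top (\<lambda>z. limsup (\<lambda>n. ereal (g z n))) \<le> 0"
  proof (rule ereal_le_epsilon2)
    fix \<epsilon> :: real assume "0 < \<epsilon>"
    from le[OF this] have "\<forall>\<^sub>F z in at_top. limsup (\<lambda>n. ereal (g z n)) \<le> ereal \<epsilon>"
    proof eventually_elim
      case (elim z)
      then have "\<forall>\<^sub>F n in sequentially. ereal (g z n) \<le> ereal \<epsilon>" by simp
      then show ?case by (rule Limsup_bounded)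
    qed
    then show "Limsup at_top (\<lambda>z. limsup (\<lambda>n. ereal (g z n))) \<le> 0 + ereal \<epsilon>"
      by (simp add: Limsup_bounded)
  qed
  have "0 \<le> limsup (\<lambda>n. ereal (g z n))" for z
    by (intro le_Limsup) (simp_all add: nonneg)
  then show "0 \<le> Limsup at_top (\<lambda>z. limsup (\<lambda>n. ereal (g z n)))"
    by (intro le_Limsup) simp_all
qed

lemma tendsto_log_diff: "(\<lambda>n. 3/2 * ln (real n) - 3/2 * ln (real (n - k))) \<longlonglongrightarrow> 0"
proof (rule LIMSEQ_offset[of _ k], rule Lim_transform_eventually)
  show "(\<lambda>n. 3/2 * ln (1 + real k / real n)) \<longlonglongrightarrow> 0"
  proof -
    have "(\<lambda>n. 3/2 * ln (1 + real k / real n)) \<longlonglongrightarrow> 3/2 * ln (1 + 0)"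
      by (intro tendsto_intros lim_const_over_n) simp
    then show ?thesis by simp
  qed
  show "\<forall>\<^sub>F n in sequentially. 3/2 * ln (1 + real k / real n) =
    3/2 * ln (real (n + k)) - 3/2 * ln (real (n + k - k))"
    using eventually_gt_at_top[of 0]
  proof eventually_elim
    case (elim n)
    then have "1 + real k / real n = real (n + k) / real n" by (simp add: field_simps)
    then show ?case using elim by (simp add: ln_div right_diff_distrib)
  qed
qed

lemma eventually_diff_sequentially:
  "eventually Q sequentially \<Longrightarrow> \<forall>\<^sub>F N in sequentially. Q (N - k)" for k :: nat
proof -
  assume "eventually Q sequentially"
  then obtain M where "\<And>n. M \<le> n \<Longrightarrow> Q n" by (auto simp: eventually_sequentially)
  then show ?thesis by (auto simp: eventually_sequentially intro!: exI[of _ "M + k"])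
qed

lemma tendsto_const_divide: "((\<lambda>z::real. u / z) \<longlongrightarrow> 0) at_top" for u :: real
  by (intro tendsto_divide_0[OF tendsto_const filterlim_at_top_imp_at_infinity[OF filterlim_ident]])

section \<open>Killed tails with a delayed horizon\<close>

context associated_random_walk
begin

lemma hit_prob_kill_mono:
  assumes "c - t \<le> c' - t'"
  shows "brw.root.hit_prob c n (ereal t) t \<le> brw.root.hit_prob c' n (ereal t') t'"
  unfolding brw.measure_min_position_kill[symmetric]
  by (intro ennreal_leI brw.finite_measure_mono brw.sets_min_position_kill)
    (use assms in \<open>auto elim!: less_le_trans\<close>)

lemma kill_tail_eq: "laws.kill_tail c n t =
  ennreal (exp t * measure P {\<omega> \<in> space P. min_position_kill N A n \<omega> < ereal (c - t)})"
  by (simp add: laws.kill_tail_def brw.measure_min_position_kill[symmetric] ennreal_mult)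

lemma excess_eq_min_position: "laws.excess c n (t + 1) t =
  ennreal (exp t * measure P {\<omega> \<in> space P. min_position N A n \<omega> < ereal (c - t)})"
  by (simp add: laws.excess_def brw.root.gap_no_barrier brw.measure_min_position[symmetric] ennreal_mult)

context
  fixes C1 :: real
  assumes kill: "Limsup at_top (\<lambda>z::real. limsup (\<lambda>n::nat. ereal \<bar>exp z *
           measure P {\<omega> \<in> space P. min_position_kill N A n \<omega> < ereal (3/2 * ln (real n) - z)} - C1\<bar>)) = 0"
    and C1: "0 < C1"
begin

text \<open>The hypothesis uses the same index for target and horizon, whereas here
  \<open>n - k\<close> generations face the target of index \<open>n\<close>. That target is the
  higher one, which only helps the lower bound; for the upper bound the start is lowered by a small
  \<open>\<eta>\<close> that absorbs the difference of the logarithms.\<close>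

lemma kill_tail_limits:
  assumes "0 < \<delta>"
  obtains a where "0 \<le> a"
    "\<And>s k. a \<le> s \<Longrightarrow> \<forall>\<^sub>F n in sequentially. ennreal (C1 - \<delta>) \<le> laws.kill_tail (3/2 * ln (real n)) (n - k) s"
    "\<And>s k. a \<le> s \<Longrightarrow> \<forall>\<^sub>F n in sequentially. laws.kill_tail (3/2 * ln (real n)) (n - k) s \<le> ennreal (C1 + \<delta>)"
proof -
  let ?c = "\<lambda>n::nat. 3/2 * ln (real n)"
  let ?q = "\<lambda>n z. exp z * measure P {\<omega> \<in> space P. min_position_kill N A n \<omega> < ereal (?c n - z)}"
  \<comment> \<open>Lowering the start by \<open>\<eta>\<close> costs a factor exp \<eta>, chosen to
    raise \<open>C1 + \<delta> / 2\<close> exactly to \<open>C1 + \<delta>\<close>.\<close>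
  define \<eta> where "\<eta> = ln ((C1 + \<delta>) / (C1 + \<delta> / 2))"
  have \<eta>: "0 < \<eta>" "exp \<eta> * (C1 + \<delta> / 2) = C1 + \<delta>"
    using C1 assms by (simp_all add: \<eta>_def field_simps)
  have "\<forall>\<^sub>F z in at_top. \<forall>\<^sub>F n in sequentially. \<bar>?q n z - C1\<bar> < \<delta> / 2"
    using assms by (intro eventually_less_of_Limsup_eq_0 kill) simp
  then obtain a1 where a1: "\<And>z. a1 \<le> z \<Longrightarrow> \<forall>\<^sub>F n in sequentially. \<bar>?q n z - C1\<bar> < \<delta> / 2"
    by (auto simp: eventually_at_top_linorder)
  show thesis
  proof
    show "0 \<le> max 0 (a1 + \<eta>)" by simp
    fix s k assume s: "max 0 (a1 + \<eta>) \<le> s"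
    then have s1: "a1 \<le> s" "a1 \<le> s - \<eta>" using \<eta> by auto
    show "\<forall>\<^sub>F n in sequentially. ennreal (C1 - \<delta>) \<le> laws.kill_tail (?c n) (n - k) s"
      using eventually_diff_sequentially[OF a1[OF s1(1)], of k] eventually_gt_at_top[of k]
    proof eventually_elim
      case (elim n)
      have "ennreal (C1 - \<delta>) \<le> laws.kill_tail (?c (n - k)) (n - k) s"
        unfolding kill_tail_eq using elim assms by (intro ennreal_leI) linarith
      also have "\<dots> \<le> laws.kill_tail (?c n) (n - k) s"
        unfolding laws.kill_tail_def using elim by (intro mult_left_mono hit_prob_kill_mono) auto
      finally show ?case .
    qed
    have "(\<lambda>n. ?c n - ?c (n - k)) \<longlonglongrightarrow> 0"
      by (rule tendsto_log_diff)
    then have "\<forall>\<^sub>F n in sequentially. ?c n - ?c (n - k) < \<eta>"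
      using \<eta> by (intro order_tendstoD)
    with eventually_diff_sequentially[OF a1[OF s1(2)], of k]
    show "\<forall>\<^sub>F n in sequentially. laws.kill_tail (?c n) (n - k) s \<le> ennreal (C1 + \<delta>)"
    proof eventually_elim
      case (elim n)
      have "laws.kill_tail (?c n) (n - k) s \<le> ennreal (exp s) * brw.root.hit_prob (?c (n - k)) (n - k) (ereal (s - \<eta>)) (s - \<eta>)"
        unfolding laws.kill_tail_def using elim by (intro mult_left_mono hit_prob_kill_mono) auto
      also have "ennreal (exp s) = ennreal (exp \<eta>) * ennreal (exp (s - \<eta>))"
        by (simp add: ennreal_mult[symmetric] exp_add[symmetric])
      also have "\<dots> * brw.root.hit_prob (?c (n - k)) (n - k) (ereal (s - \<eta>)) (s - \<eta>) =
          ennreal (exp \<eta>) * laws.kill_tail (?c (n - k)) (n - k) (s - \<eta>)"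
        by (simp add: laws.kill_tail_def mult.assoc)
      also have "\<dots> \<le> ennreal (exp \<eta>) * ennreal (C1 + \<delta> / 2)"
      proof -
        have "?q (n - k) (s - \<eta>) \<le> C1 + \<delta> / 2"
          using elim(1) unfolding abs_less_iff by linarith
        then show ?thesis
          unfolding kill_tail_eq by (intro mult_left_mono ennreal_leI) simp_all
      qed
      also have "\<dots> = ennreal (C1 + \<delta>)"
        unfolding \<eta>(2)[symmetric] using C1 assms by (intro ennreal_mult[symmetric]) auto
      finally show ?case .
    qed
  qed
qed

section \<open>Matching bounds for the tail of the minimum\<close>

context
  fixes c\<^sub>0 :: real
  assumes crit: "critical_branching_random_walk P N A"
    and renewal: "((\<lambda>x. renewal_fun Q \<xi> x / x) \<longlongrightarrow> c\<^sub>0) at_top"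
    and c0_pos: "0 < c\<^sub>0"
begin

abbreviation "min_tail n z \<equiv>
  measure P {\<omega> \<in> space P. min_position N A n \<omega> < ereal (3/2 * ln (real n) - z)}"

text \<open>The chance of a downward step bounds the records; that of an upward step bounds, by
  reflection, the excursions above the running minimum.\<close>

lemma critical_laws_ex:
  obtains k V where "critical_laws brw.root_law walk_law k V"
proof -
  from step_sign[OF crit, of 1] have "emeasure walk_law {x. x < 0} \<noteq> 0" by simp
  then obtain k where k: "1 \<le> k" "\<And>r t b u. r \<in> {(<), (\<le>)} \<Longrightarrow>
      record_sum walk_law r t b (\<lambda>k s. indicator {u..u + 1} s) \<le> ennreal k"
    using laws.step.ex_record_constant by metis
  from step_sign[OF crit, of "-1"] have "emeasure walk_law {x. 0 < x} \<noteq> 0" by simp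
  then obtain V where V: "1 \<le> V" "\<And>s u. killed_green walk_law s s (\<lambda>k x. indicator {u..u + 1} x) \<le> ennreal V"
    using laws.step.ex_green_constant by metis
  have "critical_laws brw.root_law walk_law k V"
    using k V mass_moment[OF crit] by (intro critical_laws.intro laws.branching_laws_axioms critical_laws_axioms.intro) auto
  then show thesis by (rule that)
qed

lemma tendsto_renewal_shift: "((\<lambda>z. renewal_fun Q \<xi> (z - a) / z) \<longlongrightarrow> c\<^sub>0) at_top"
proof -
  have "filterlim (\<lambda>z::real. z - a) at_top at_top"
    using filterlim_tendsto_add_at_top[OF tendsto_const[of "- a"] filterlim_ident] by simp
  then have "((\<lambda>z. renewal_fun Q \<xi> (z - a) / (z - a)) \<longlongrightarrow> c\<^sub>0) at_top"
    by (rule filterlim_compose[OF renewal])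
  moreover have "((\<lambda>z. 1 - a / z) \<longlongrightarrow> 1 - 0) at_top"
    by (intro tendsto_intros tendsto_divide_0[OF tendsto_const filterlim_at_top_imp_at_infinity[OF filterlim_ident]])
  ultimately have "((\<lambda>z. renewal_fun Q \<xi> (z - a) / (z - a) * (1 - a / z)) \<longlongrightarrow> c\<^sub>0 * (1 - 0)) at_top"
    by (rule tendsto_mult)
  then have "((\<lambda>z. renewal_fun Q \<xi> (z - a) / (z - a) * (1 - a / z)) \<longlongrightarrow> c\<^sub>0) at_top" by simp
  then show ?thesis
  proof (rule Lim_transform_eventually)
    show "\<forall>\<^sub>F z in at_top. renewal_fun Q \<xi> (z - a) / (z - a) * (1 - a / z) = renewal_fun Q \<xi> (z - a) / z"
      using eventually_gt_at_top[of "max 0 a"]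
      by eventually_elim (auto simp: field_simps)
  qed
qed

text \<open>After division by \<open>z\<close> the additive constants vanish and the record count
  tends to \<open>c\<^sub>0\<close>. The choice of \<open>\<delta>\<close> uses up half of
  \<open>\<epsilon>\<close> and leaves strict room for the limit in \<open>z\<close>.\<close>

lemma min_tail_upper:
  assumes "0 < \<epsilon>"
  shows "\<forall>\<^sub>F z in at_top. \<forall>\<^sub>F n in sequentially. exp z / z * min_tail n z \<le> C1 * c\<^sub>0 + \<epsilon>"
proof -
  obtain k V where "critical_laws brw.root_law walk_law k V" by (rule critical_laws_ex)
  then interpret critical_laws brw.root_law walk_law k V .
  define \<delta> where "\<delta> = \<epsilon> / (2 * c\<^sub>0)"
  have \<delta>: "0 < \<delta>" "\<delta> * c\<^sub>0 = \<epsilon> / 2" using assms c0_pos by (auto simp: \<delta>_def)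
  obtain a where a: "0 \<le> a" "\<And>s j. a \<le> s \<Longrightarrow> \<forall>\<^sub>F n in sequentially. laws.kill_tail (3/2 * ln (real n)) (n - j) s \<le> ennreal (C1 + \<delta>)"
    by (rule kill_tail_limits[OF \<delta>(1)]) blast
  interpret critical_tails brw.root_law walk_law k V "\<lambda>n. 3/2 * ln (real n)" "C1 + \<delta>" a
    using a C1 \<delta> by unfold_locales auto
  have "((\<lambda>z. (exp a + 1) / z + (C1 + \<delta>) * (renewal_fun Q \<xi> (z - a) / z)) \<longlongrightarrow> 0 + (C1 + \<delta>) * c\<^sub>0) at_top"
    by (intro tendsto_add tendsto_mult tendsto_const tendsto_renewal_shift tendsto_const_divide)
  moreover have "0 + (C1 + \<delta>) * c\<^sub>0 < C1 * c\<^sub>0 + \<epsilon>"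
    using \<delta> assms by (simp add: algebra_simps)
  ultimately have "\<forall>\<^sub>F z in at_top. (exp a + 1) / z + (C1 + \<delta>) * (renewal_fun Q \<xi> (z - a) / z) < C1 * c\<^sub>0 + \<epsilon>"
    by (rule order_tendstoD)
  then show ?thesis
    using eventually_gt_at_top[of a]
  proof eventually_elim
    case (elim z)
    then have z: "0 < z" using a by simp
    note bound = elim(1)
    have fin: "record_sum walk_law (<) z (z + 1) (\<lambda>k s. indicator {a..} s) < \<infinity>"
      using record_sum_indicator_le[of a "z + 1" z] elim by (auto elim!: le_less_trans)
    note R = record_sum_eq_renewal_fun(1)[OF elim(2) fin] and R0 = record_sum_eq_renewal_fun(2)[OF elim(2) fin]
    have "\<forall>\<^sub>F n in sequentially. laws.excess (3/2 * ln (real n)) n (z + 1) z \<le> ennreal (exp a) +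
      ennreal (C1 + \<delta>) * ennreal (renewal_fun Q \<xi> (z - a)) + ennreal 1"
      using excess_upper[of 1 "z + 1" z] unfolding R by simp
    then show ?case
    proof eventually_elim
      case (elim n)
      have "ennreal (exp z * min_tail n z) \<le> ennreal (exp a) +
        ennreal (C1 + \<delta>) * ennreal (renewal_fun Q \<xi> (z - a)) + ennreal 1"
        using elim unfolding excess_eq_min_position .
      also have "\<dots> = ennreal (exp a + (C1 + \<delta>) * renewal_fun Q \<xi> (z - a) + 1)"
        using C1 \<delta> R0 by (simp add: ennreal_mult)
      finally have "exp z * min_tail n z \<le> exp a + (C1 + \<delta>) * renewal_fun Q \<xi> (z - a) + 1"
        using C1 \<delta> R0 by (subst (asm) ennreal_le_iff) auto
      then have "exp z * min_tail n z / z \<le> (exp a + (C1 + \<delta>) * renewal_fun Q \<xi> (z - a) + 1) / z"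
        using z by (intro divide_right_mono) auto
      also have "\<dots> = (exp a + 1) / z + (C1 + \<delta>) * (renewal_fun Q \<xi> (z - a) / z)"
        by (simp add: add_divide_distrib)
      finally show ?case using bound by simp
    qed
  qed
qed

text \<open>The order of choices matters: \<open>\<delta>\<close> determines \<open>a\<close>, which
  enters \<open>B0\<close> and thereby \<open>error_step\<close>; only then is \<open>m\<close>
  taken so large that the tail of this series is small, and \<open>z\<close> tends to infinity with
  \<open>m\<close> fixed.\<close>

lemma min_tail_lower:
  assumes "0 < \<epsilon>"
  shows "\<forall>\<^sub>F z in at_top. \<forall>\<^sub>F n in sequentially. C1 * c\<^sub>0 - \<epsilon> \<le> exp z / z * min_tail n z"
proof -
  obtain k V where kV: "critical_laws brw.root_law walk_law k V" by (rule critical_laws_ex)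
  then interpret critical_laws brw.root_law walk_law k V .
  \<comment> \<open>The minimum with \<open>C1\<close> keeps \<open>C1 - \<delta>\<close>
    nonnegative, as \<open>excess_lower\<close> demands of \<open>K'\<close>.\<close>
  define \<delta> where "\<delta> = min C1 (\<epsilon> / (4 * c\<^sub>0))"
  have \<delta>: "0 < \<delta>" "\<delta> \<le> C1" using assms c0_pos C1 by (auto simp: \<delta>_def)
  have "\<delta> \<le> \<epsilon> / (4 * c\<^sub>0)" by (simp add: \<delta>_def)
  then have \<delta>c: "\<delta> * c\<^sub>0 \<le> \<epsilon> / 4" using c0_pos by (simp add: field_simps)
  obtain a where a: "0 \<le> a"
    "\<And>s j. a \<le> s \<Longrightarrow> \<forall>\<^sub>F n in sequentially. ennreal (C1 - \<delta>) \<le> laws.kill_tail (3/2 * ln (real n)) (n - j) s"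
    "\<And>s j. a \<le> s \<Longrightarrow> \<forall>\<^sub>F n in sequentially. laws.kill_tail (3/2 * ln (real n)) (n - j) s \<le> ennreal (C1 + \<delta>)"
    by (rule kill_tail_limits[OF \<delta>(1)]) blast
  interpret critical_tails brw.root_law walk_law k V "\<lambda>n. 3/2 * ln (real n)" "C1 + \<delta>" a
    using a C1 \<delta> by unfold_locales auto
  have kV1: "1 \<le> V * k"
    using U(1) V(1) mult_mono[of 1 V 1 k] by simp
  have "(\<lambda>m. ennreal (V * k) * (\<Sum>i. error_step (m + i))) \<longlonglongrightarrow> ennreal (V * k) * 0"
    by (intro ennreal_tendsto_cmult error_step_tail) simp
  then have "\<forall>\<^sub>F m in sequentially. ennreal (V * k) * (\<Sum>i. error_step (m + i)) < ennreal (\<epsilon> / 4)"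
    using assms by (intro order_tendstoD) auto
  moreover have "\<forall>\<^sub>F m in sequentially. a \<le> real m"
    using filterlim_real_sequentially by (simp add: filterlim_at_top)
  ultimately obtain m where m: "ennreal (V * k) * (\<Sum>i. error_step (m + i)) < ennreal (\<epsilon> / 4)" "a \<le> real m"
    using eventually_conj[of _ sequentially] by (metis (mono_tags, lifting) eventually_happens' sequentially_bot)
  have "(\<Sum>i. error_step (m + i)) \<noteq> \<top>"
    using m(1) U(1) V(1) by (auto simp: ennreal_mult_top)
  then obtain \<tau> where \<tau>: "0 \<le> \<tau>" "(\<Sum>i. error_step (m + i)) = ennreal \<tau>"
    by (cases "\<Sum>i. error_step (m + i)") auto
  have \<tau>\<epsilon>: "V * k * \<tau> < \<epsilon> / 4"
    using m(1) kV1 \<tau> assms unfolding \<tau>(2) by (simp add: ennreal_mult[symmetric] ennreal_less_iff)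
  have "((\<lambda>z. (C1 - \<delta>) * (renewal_fun Q \<xi> (z - real m) / z) - V * k * \<tau> * (1 + 3 / z) - 1 / z)
      \<longlongrightarrow> (C1 - \<delta>) * c\<^sub>0 - V * k * \<tau> * (1 + 0) - 0) at_top"
    by (intro tendsto_diff tendsto_add tendsto_mult tendsto_const tendsto_renewal_shift tendsto_const_divide)
  moreover have "C1 * c\<^sub>0 - \<epsilon> < (C1 - \<delta>) * c\<^sub>0 - V * k * \<tau> * (1 + 0) - 0"
    using \<delta>c \<tau>\<epsilon> assms by (simp add: algebra_simps)
  ultimately have "\<forall>\<^sub>F z in at_top. C1 * c\<^sub>0 - \<epsilon> <
      (C1 - \<delta>) * (renewal_fun Q \<xi> (z - real m) / z) - V * k * \<tau> * (1 + 3 / z) - 1 / z"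
    by (rule order_tendstoD)
  then show ?thesis
    using eventually_gt_at_top[of "real m"]
  proof eventually_elim
    case (elim z)
    then have z: "0 < z" using a m by simp
    note bound = elim(1)
    have fin: "record_sum walk_law (<) z (z + 1) (\<lambda>k s. indicator {real m..} s) < \<infinity>"
      using record_sum_indicator_le[of "real m" "z + 1" z] elim by (auto elim!: le_less_trans)
    note R = record_sum_eq_renewal_fun(1)[OF elim(2) fin] and R0 = record_sum_eq_renewal_fun(2)[OF elim(2) fin]
    have "\<forall>\<^sub>F n in sequentially. ennreal (C1 - \<delta>) * ennreal (renewal_fun Q \<xi> (z - real m)) \<le>
      laws.excess (3/2 * ln (real n)) n (z + 1) z + ennreal (V * k * (z + 3)) * ennreal \<tau> + ennreal 1"
      using excess_lower[of m z 1 "C1 - \<delta>"] m(2) elim(2) \<delta> a(2) unfolding R \<tau>(2) by auto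
    then show ?case
    proof eventually_elim
      case (elim n)
      let ?p = "exp z * min_tail n z"
      define w where "w = V * k * (z + 3)"
      have w: "0 \<le> w" using z kV1 by (simp add: w_def)
      have "ennreal ((C1 - \<delta>) * renewal_fun Q \<xi> (z - real m)) =
          ennreal (C1 - \<delta>) * ennreal (renewal_fun Q \<xi> (z - real m))"
        using \<delta> R0 by (intro ennreal_mult) auto
      also have "\<dots> \<le> ennreal ?p + ennreal w * ennreal \<tau> + ennreal 1"
        using elim unfolding excess_eq_min_position w_def .
      also have "\<dots> = ennreal (?p + V * k * (z + 3) * \<tau> + 1)"
        unfolding w_def[symmetric] using w \<tau>(1) by (simp add: ennreal_mult)
      finally have "ennreal ((C1 - \<delta>) * renewal_fun Q \<xi> (z - real m)) \<le> ennreal (?p + V * k * (z + 3) * \<tau> + 1)" .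
      then have "(C1 - \<delta>) * renewal_fun Q \<xi> (z - real m) \<le> ?p + V * k * (z + 3) * \<tau> + 1"
        using z kV1 \<tau>(1) by (subst (asm) ennreal_le_iff) auto
      then have "((C1 - \<delta>) * renewal_fun Q \<xi> (z - real m) - V * k * (z + 3) * \<tau> - 1) / z \<le> ?p / z"
        using z by (intro divide_right_mono) auto
      moreover have "((C1 - \<delta>) * renewal_fun Q \<xi> (z - real m) - V * k * (z + 3) * \<tau> - 1) / z =
        (C1 - \<delta>) * (renewal_fun Q \<xi> (z - real m) / z) - V * k * \<tau> * (1 + 3 / z) - 1 / z"
        using z by (simp add: field_simps)
      ultimately show ?case
        using bound by simp
    qed
  qed
qed

lemma Limsup_min_tail:
  "Limsup at_top (\<lambda>z::real. limsup (\<lambda>n::nat. ereal \<bar>exp z / z * min_tail n z - C1 * c\<^sub>0\<bar>)) = 0"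
proof (rule Limsup_eq_0_of_eventually_le)
  fix \<epsilon> :: real assume "0 < \<epsilon>"
  from min_tail_upper[OF this] min_tail_lower[OF this]
  show "\<forall>\<^sub>F z in at_top. \<forall>\<^sub>F n in sequentially. \<bar>exp z / z * min_tail n z - C1 * c\<^sub>0\<bar> \<le> \<epsilon>"
  proof eventually_elim
    case (elim z)
    then show ?case by eventually_elim linarith
  qed
qed simp

end

end

end

theorem proposition1p3:
  fixes P :: "'a measure" and N :: "nat list \<Rightarrow> 'a \<Rightarrow> enat" and A :: "nat list \<Rightarrow> nat \<Rightarrow> 'a \<Rightarrow> real"
    and Q :: "'b measure" and \<xi> :: "nat \<Rightarrow> 'b \<Rightarrow> real" and C\<^sub>1 c\<^sub>0 :: real
  assumes "critical_branching_random_walk P N A"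
    and "associated_random_walk P N A Q \<xi>"
    and "C\<^sub>1 > 0"
    and "Limsup at_top (\<lambda>z::real. limsup (\<lambda>n::nat. ereal \<bar>exp z *
           measure P {\<omega> \<in> space P. min_position_kill N A n \<omega> < ereal (3/2 * ln (real n) - z)} - C\<^sub>1\<bar>)) = 0"
    and "((\<lambda>x. renewal_fun Q \<xi> x / x) \<longlongrightarrow> c\<^sub>0) at_top"
    and "c\<^sub>0 > 0"
  shows "Limsup at_top (\<lambda>z::real. limsup (\<lambda>n::nat. ereal \<bar>exp z / z *
           measure P {\<omega> \<in> space P. min_position N A n \<omega> < ereal (3/2 * ln (real n) - z)} - C\<^sub>1 * c\<^sub>0\<bar>)) = 0"
  using assms by (intro associated_random_walk.Limsup_min_tail[OF assms(2)])

end
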